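(* Suppose that $f\colon\mathbb{N}\to\mathbb{R}$ is a function satisfying $$\lim_{n\to\infty}f(n)\sqrt{n\log n}=0 .$$ Then for each $v\in\mathbb{X}$ the function $t\mapsto\mathbb{E}_tf(|C^v|)$ is continuously differentiable on $(0,\infty)$ with derivative given by $$\frac{d}{dt}\mathbb{E}_tf(|C^v|)=t^{-1}\,\mathbb{E}_t\big[M^v_t\,f(|C^v|)\,\mathbf{1}\{|C^v|<\infty\}\big],\qquad t>0 .$$
   Context: Setting. $\mathbb{X}$ is a complete separable metric space with Borel $\sigma$-field; $\lambda$ is a locally finite (finite on bounded Borel sets) and diffuse measure on $\mathbb{X}$; $\varphi\colon\mathbb{X}^2\to[0,1]$ is measurable and symmetric with $D_\varphi(x):=\int\varphi(x,y)\,\lambda(dy)<\infty$ for $\lambda$-a.e. $x\in\mathbb{X}$. For $t>0$, under $\mathbb{P}_t$ (expectation $\mathbb{E}_t$), $\eta$ is a Poisson process on $\mathbb{X}$ with intensity measure $t\lambda$. For $v\in\mathbb{X}$, $\xi^v$ is the random graph with vertex set $\eta\cup\{v\}$ in which, given $\eta$, each pair of distinct vertices $x,y$ is joined by an edge with probability $\varphi(x,y)$, independently for different pairs. $C^v$ is the connected component of $v$ in $\xi^v$ and $|C^v|\in\mathbb{N}\cup\{\infty\}$ its number of vertices. Convention: $f(\infty):=0$, so $\mathbb{E}_tf(|C^v|)=\sum_{n\ge1}f(n)\mathbb{P}_t(|C^v|=n)$. For a graph $\mu$ with vertex set $V(\mu)$, $\varphi_\lambda(\mu):=\int\big(1-\prod_{y\in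 V(\mu)}(1-\varphi(x,y))\big)\lambda(dx)$, and $M^v_t:=|C^v|-1-t\varphi_\lambda(C^v)$; the product with $\mathbf{1}\{|C^v|<\infty\}$ is understood as $0$ on $\{|C^v|=\infty\}$. *)

theory Defs
  imports "HOL-Probability.Probability" "HOL-Library.Extended_Nat"
begin

text \<open>A random point set \<open>eta\<close> is identified with the counting measure it carries; this loses
  nothing, since a Poisson process with diffuse intensity is almost surely simple.\<close>

definition point_count :: "('w \<Rightarrow> 'a set) \<Rightarrow> 'a set \<Rightarrow> 'w \<Rightarrow> ennreal" where
  "point_count \<eta> B = (\<lambda>\<omega>. emeasure (count_space UNIV) (\<eta> \<omega> \<inter> B))"

text \<open>The Poisson distribution with infinite mean is the point mass at \<open>\<infinity>\<close>. The library's
  \<open>poisson_pmf\<close> is not used because it is not specified for mean \<open>0\<close>.\<close>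

definition poisson_prob :: "ennreal \<Rightarrow> nat \<Rightarrow> real" where
  "poisson_prob a k =
     (if a = \<infinity> then 0 else enn2real a ^ k / fact k * exp (- enn2real a))"

definition poisson_process ::
  "'w measure \<Rightarrow> 'a :: topological_space measure \<Rightarrow> ('w \<Rightarrow> 'a set) \<Rightarrow> bool" where
  "poisson_process M \<mu> \<eta> \<longleftrightarrow>
     (\<forall>B \<in> sets borel. point_count \<eta> B \<in> borel_measurable M) \<and>
     (\<forall>B \<in> sets borel. \<forall>k::nat.
        measure M {\<omega> \<in> space M. point_count \<eta> B \<omega> = of_nat k} = poisson_prob (emeasure \<mu> B) k) \<and>
     (\<forall>(I :: nat set) B. finite I \<longrightarrow> disjoint_family_on B I \<longrightarrow> (\<forall>i \<in> I. B i \<in> sets borel) \<longrightarrow>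
        prob_space.indep_vars M (\<lambda>_. borel) (\<lambda>i. point_count \<eta> (B i)) I)"

text \<open>A random graph is given by its random vertex set and its random set of edges, an edge
  being an unordered pair \<open>{x, y}\<close>. To make ``given \<open>\<eta>\<close>, the pairs of distinct vertices are joined
  independently with probabilities \<open>\<phi> x y\<close>'' precise, the vertices
  are enumerated without repetition by random variables \<open>X 0, X 1, \<dots>\<close>, of which only those with
  index below the (possibly infinite) random number \<open>K\<close> are used. The conditional probability
  that all of finitely many given index pairs are present as edges is the product of the
  connection probabilities (and \<open>0\<close> when some index is out of range). The values of \<open>X i\<close> for
  \<open>i \<ge> K\<close> are irrelevant.\<close>

definition vertex_algebra ::
  "'w measure \<Rightarrow> ('w \<Rightarrow> enat) \<Rightarrow> (nat \<Rightarrow> 'w \<Rightarrow> 'a :: topological_space) \<Rightarrow> 'w measure" where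
  "vertex_algebra M K X =
     vimage_algebra (space M) (\<lambda>\<omega>. (K \<omega>, \<lambda>i. X i \<omega>))
       (count_space UNIV \<Otimes>\<^sub>M (\<Pi>\<^sub>M i\<in>UNIV. borel))"

definition vertex_enumeration ::
  "'w measure \<Rightarrow> ('w \<Rightarrow> 'a :: topological_space set) \<Rightarrow> ('w \<Rightarrow> enat) \<Rightarrow> (nat \<Rightarrow> 'w \<Rightarrow> 'a) \<Rightarrow> bool" where
  "vertex_enumeration M V K X \<longleftrightarrow>
     K \<in> M \<rightarrow>\<^sub>M count_space UNIV \<and>
     (\<forall>i. X i \<in> borel_measurable M) \<and>
     (\<forall>\<omega> \<in> space M. bij_betw (\<lambda>i. X i \<omega>) {i. enat i < K \<omega>} (V \<omega>))"

definition conditionally_independent_edges ::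
  "'w measure \<Rightarrow> ('a :: topological_space \<Rightarrow> 'a \<Rightarrow> real) \<Rightarrow> ('w \<Rightarrow> 'a set set) \<Rightarrow>
   ('w \<Rightarrow> enat) \<Rightarrow> (nat \<Rightarrow> 'w \<Rightarrow> 'a) \<Rightarrow> bool" where
  "conditionally_independent_edges M \<phi> E K X \<longleftrightarrow>
     (\<forall>i j. i < j \<longrightarrow> {\<omega> \<in> space M. enat j < K \<omega> \<and> {X i \<omega>, X j \<omega>} \<in> E \<omega>} \<in> sets M) \<and>
     (\<forall>S. finite S \<longrightarrow> S \<subseteq> {(i, j). i < j} \<longrightarrow>
       (AE \<omega> in M.
          real_cond_exp M (vertex_algebra M K X)
            (indicator {\<omega> \<in> space M. \<forall>(i, j) \<in> S. enat j < K \<omega> \<and> {X i \<omega>, X j \<omega>} \<in> E \<omega>}) \<omega>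
          = (if \<forall>(i, j) \<in> S. enat j < K \<omega> then \<Prod>(i, j) \<in> S. \<phi> (X i \<omega>) (X j \<omega>) else 0)))"

definition random_connection_model ::
  "'w measure \<Rightarrow> 'a :: topological_space measure \<Rightarrow> ('a \<Rightarrow> 'a \<Rightarrow> real) \<Rightarrow> 'a \<Rightarrow>
   ('w \<Rightarrow> 'a set) \<Rightarrow> ('w \<Rightarrow> 'a set set) \<Rightarrow> bool" where
  "random_connection_model M \<mu> \<phi> v \<eta> E \<longleftrightarrow>
     prob_space M \<and>
     poisson_process M \<mu> \<eta> \<and>
     (\<forall>\<omega> \<in> space M. E \<omega> \<subseteq> {{x, y} | x y. x \<in> insert v (\<eta> \<omega>) \<and> y \<in> insert v (\<eta> \<omega>) \<and> x \<noteq> y}) \<and>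
     (\<exists>K X. vertex_enumeration M (\<lambda>\<omega>. insert v (\<eta> \<omega>)) K X \<and>
            conditionally_independent_edges M \<phi> E K X)"

text \<open>The vertex set of the connected component of \<open>v\<close> in a graph with edge set \<open>E\<close>.\<close>

definition component :: "'a set set \<Rightarrow> 'a \<Rightarrow> 'a set" where
  "component E v = {w. (v, w) \<in> {(x, y). {x, y} \<in> E}\<^sup>*}"

definition num_vertices :: "'a set \<Rightarrow> enat" where
  "num_vertices C = (if finite C then enat (card C) else \<infinity>)"

definition extend_by_zero :: "(nat \<Rightarrow> real) \<Rightarrow> enat \<Rightarrow> real" where
  "extend_by_zero f n = (case n of enat k \<Rightarrow> f k | \<infinity> \<Rightarrow> 0)"

text \<open>\<open>\<phi>_\<lambda>\<close> depends on a graph only through its vertex set \<open>V\<close>. This definition and the next are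
  meant for finite \<open>V\<close> only.\<close>

definition phi_lambda :: "'a measure \<Rightarrow> ('a \<Rightarrow> 'a \<Rightarrow> real) \<Rightarrow> 'a set \<Rightarrow> real" where
  "phi_lambda \<Lambda> \<phi> V = (\<integral>x. 1 - (\<Prod>y\<in>V. 1 - \<phi> x y) \<partial>\<Lambda>)"

definition M_stat :: "'a measure \<Rightarrow> ('a \<Rightarrow> 'a \<Rightarrow> real) \<Rightarrow> real \<Rightarrow> 'a set \<Rightarrow> real" where
  "M_stat \<Lambda> \<phi> t C = real (card C) - 1 - t * phi_lambda \<Lambda> \<phi> C"

end

theory Submission
  imports Defs
begin

text \<open>The proof rests on an explicit formula for the law of a finite cluster. Let \<open>x\<^sub>1, \<dots>, x\<^sub>m\<close> be points,
let \<open>q\<close> be the probability that the random graph on \<open>v, x\<^sub>1, \<dots>, x\<^sub>m\<close> is connected, and let \<open>a\<close> be the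
value of \<open>\<phi>\<^sub>\<lambda>\<close> at this vertex set. If these are points of \<open>\<eta>\<close>, they form, together with \<open>v\<close>, the
cluster of \<open>v\<close> if and only if the graph on them is connected and no other point of \<open>\<eta>\<close> is joined to any of
them; the points that would be joined form a Poisson process with total intensity \<open>t a\<close>, so that the
second condition has probability \<open>exp (- t a)\<close>. Hence
\<open>P\<^sub>t(|C| = m + 1, \<phi>\<^sub>\<lambda>(C) \<in> D) = t\<^sup>m / m! \<integral> 1{a \<in> D} q exp (- t a) d\<lambda>\<^sup>m = \<integral>\<^sub>D t\<^sup>m exp (- t a) \<mu>\<^sub>m(da)\<close>
with a measure \<open>\<mu>\<^sub>m\<close> that is the same for all \<open>t\<close>. This is \<open>emeasure_component_event\<close>.

Now the dependence on \<open>t\<close> is explicit. Since \<open>t\<^sup>m exp (- t a)\<close> has derivative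
\<open>t\<^sup>-\<^sup>1 (m - t a) t\<^sup>m exp (- t a)\<close>, and \<open>m - t a\<close> is the value of \<open>M\<^sub>t\<close> on \<open>|C| = m + 1\<close>, every term of the
series \<open>\<Sum>m. f (m + 1) P\<^sub>t(|C| = m + 1)\<close> has the derivative that the theorem claims for it. It remains to
show that the series of the derivatives converges uniformly. This needs a bound for the mean of
\<open>|M\<^sub>t|\<close> on \<open>|C| = m + 1\<close>, and it comes from comparing different intensities: replacing \<open>t\<close> by
\<open>t (1 \<plusminus> \<delta>)\<close> multiplies the weight \<open>t\<^sup>m exp (- t a)\<close> by a factor that is exponentially large where
\<open>|m - t a|\<close> is large and the sign is chosen suitably (\<open>gamma_weight_tilt\<close>), while the integral of the
new weight is again a probability and thus at most \<open>1\<close>. With \<open>\<delta> = sqrt (ln m / m)\<close>, deviations beyond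
\<open>4 sqrt (m ln m)\<close> contribute at most \<open>4 sqrt (m ln m) * 2 / m\<^sup>2\<close> for large \<open>m\<close>, and all others at most
\<open>4 sqrt (m ln m) P\<^sub>t(|C| = m + 1)\<close> (\<open>abs_drift_le\<close>). After multiplication with \<open>f (m + 1)\<close> the factor
\<open>4 sqrt (m ln m)\<close> tends to zero by the hypothesis on \<open>f\<close>; since the probabilities sum up to at most
\<open>1\<close>, the tails of the series are, apart from the factor \<open>t\<^sup>-\<^sup>1\<close>, small uniformly in \<open>t\<close>.

The formula for the law of the cluster is obtained as follows. The points of \<open>\<eta>\<close> in a window of
finite intensity, summed over all orders in which they can be listed, have a multiple of a product
measure as their law (\<open>nn_integral_labellings\<close>). This yields Mecke's formula in the form
\<open>nn_integral_split_configuration\<close>. The probability that given vertices form the cluster follows from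
the conditional independence of the edges by inclusion and exclusion (\<open>prob_cluster_event\<close>). The two
are combined within a window (\<open>sum_emeasure_local_event\<close>), and the window then exhausts the space.\<close>

section \<open>Labellings of coloured finite sets\<close>

text \<open>The condition \<open>extensional\<close> makes the functions unique, so that sums over labellings count every
bijection once. If \<open>J\<close> does not have exactly \<open>k\<close> elements there is none, and such sums vanish.\<close>

definition labellings :: "nat \<Rightarrow> 'i set \<Rightarrow> (nat \<Rightarrow> 'i) set" where
  "labellings k J = {\<iota> \<in> extensional {..<k}. bij_betw \<iota> {..<k} J}"

lemma finite_labellings: "finite (labellings k J)"
proof (cases "finite J")
  case True
  have "labellings k J \<subseteq> {..<k} \<rightarrow>\<^sub>E J"
    by (auto simp: labellings_def PiE_iff extensional_def bij_betw_def)
  then show ?thesis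
    using True by (meson finite_PiE finite_lessThan finite_subset)
next
  case False
  then have "labellings k J = {}"
    using bij_betw_finite by (fastforce simp: labellings_def)
  then show ?thesis by simp
qed

lemma labellings_card: "\<iota> \<in> labellings k J \<Longrightarrow> finite J \<and> card J = k"
  using bij_betw_finite bij_betw_same_card by (fastforce simp: labellings_def)

text \<open>The last label can be given to any element of its colour, and deleting this element leaves the same
problem with one label less. A colour with \<open>n\<close> labels therefore contributes the factor \<open>n!\<close>, provided
that it has \<open>n\<close> elements.\<close>

lemma card_coloured_labellings:
  assumes "finite J" "finite R" "col ` J \<subseteq> R" "a ` {..<k} \<subseteq> R"
  shows "card {\<iota> \<in> labellings k J. \<forall>j<k. col (\<iota> j) = a j} =
    (if \<forall>c\<in>R. card {x\<in>J. col x = c} = card {j\<in>{..<k}. a j = c}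
     then \<Prod>c\<in>R. fact (card {j\<in>{..<k}. a j = c}) else 0)"
  using assms(1,3,4)
proof (induction k arbitrary: J)
  case 0
  have *: "{\<iota> \<in> labellings 0 J. \<forall>j<0. col (\<iota> j) = a j} = (if J = {} then {\<lambda>_. undefined} else {})"
    by (auto simp: labellings_def bij_betw_def)
  have "(\<forall>c\<in>R. card {x\<in>J. col x = c} = 0) \<longleftrightarrow> J = {}"
    using 0 by (auto simp: card_eq_0_iff)
  then show ?case unfolding * by simp
next
  case (Suc k)
  define L where "L k J = {\<iota> \<in> labellings k J. \<forall>j<k. col (\<iota> j) = a j}" for k J
  define J1 where "J1 = {x\<in>J. col x = a k}"
  have finJ1: "finite J1" using Suc by (auto simp: J1_def)
  have "card (L (Suc k) J) = card (SIGMA x:J1. L k (J - {x}))"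
  proof (rule bij_betw_same_card[where f="\<lambda>\<iota>. (\<iota> k, \<iota>(k := undefined))"],
      rule bij_betw_byWitness[where f'="\<lambda>(x, \<kappa>). \<kappa>(k := x)"])
    show "\<forall>\<iota>\<in>L (Suc k) J. (\<lambda>(x, \<kappa>). \<kappa>(k := x)) (\<iota> k, \<iota>(k := undefined)) = \<iota>"
      by auto
    show "\<forall>p\<in>(SIGMA x:J1. L k (J - {x})). (\<lambda>\<iota>. (\<iota> k, \<iota>(k := undefined))) ((\<lambda>(x, \<kappa>). \<kappa>(k := x)) p) = p"
      by (auto simp: L_def labellings_def extensional_def)
    show "(\<lambda>\<iota>. (\<iota> k, \<iota>(k := undefined))) ` L (Suc k) J \<subseteq> (SIGMA x:J1. L k (J - {x}))"
    proof safe
      fix \<iota> assume i: "\<iota> \<in> L (Suc k) J"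
      then have b: "bij_betw \<iota> {..<Suc k} J" by (auto simp: L_def labellings_def)
      show "\<iota> k \<in> J1" using i b by (auto simp: L_def J1_def bij_betw_def)
      have "bij_betw \<iota> ({..<Suc k} - {k}) (J - {\<iota> k})"
        using b by (auto simp: bij_betw_def inj_on_def)
      then have "bij_betw (\<iota>(k := undefined)) {..<k} (J - {\<iota> k})"
        by (simp add: lessThan_Suc bij_betw_def inj_on_def)
      then show "\<iota>(k := undefined) \<in> L k (J - {\<iota> k})"
        using i by (auto simp: L_def labellings_def extensional_def)
    qed
    show "(\<lambda>(x, \<kappa>). \<kappa>(k := x)) ` (SIGMA x:J1. L k (J - {x})) \<subseteq> L (Suc k) J"
    proof safe
      fix x \<kappa> assume x: "x \<in> J1" and k: "\<kappa> \<in> L k (J - {x})"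
      then have "bij_betw (\<kappa>(k := x)) {..<k} (J - {x})"
        by (auto simp: L_def labellings_def bij_betw_def inj_on_def)
      then have "bij_betw (\<kappa>(k := x)) (insert k {..<k}) (insert x (J - {x}))"
        by (subst insert_is_Un) (auto simp: bij_betw_def)
      moreover have "insert x (J - {x}) = J" using x by (auto simp: J1_def)
      ultimately have "bij_betw (\<kappa>(k := x)) {..<Suc k} J" by (simp add: lessThan_Suc)
      then show "\<kappa>(k := x) \<in> L (Suc k) J"
        using x k by (auto simp: L_def labellings_def extensional_def J1_def less_Suc_eq)
    qed
  qed
  also have "\<dots> = (\<Sum>x\<in>J1. card (L k (J - {x})))"
    using finJ1 by (subst card_SigmaI) (auto simp: L_def finite_labellings)
  also have "\<dots> = (\<Sum>x\<in>J1. (if \<forall>c\<in>R. card {x\<in>J. col x = c} = card {j\<in>{..<Suc k}. a j = c}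
     then \<Prod>c\<in>R. fact (card {j\<in>{..<k}. a j = c}) else 0))"
  proof (rule sum.cong[OF refl])
    fix x assume x: "x \<in> J1"
    have A: "card {j\<in>{..<Suc k}. a j = c} = card {j\<in>{..<k}. a j = c} + (if c = a k then 1 else 0)" for c
    proof -
      have "{j\<in>{..<Suc k}. a j = c} = (if c = a k then insert k else id) {j\<in>{..<k}. a j = c}"
        by (auto simp: less_Suc_eq)
      then show ?thesis by simp
    qed
    have B: "card {y\<in>J. col y = c} = card {y\<in>J-{x}. col y = c} + (if c = a k then 1 else 0)" for c
    proof -
      have "{y\<in>J. col y = c} = (if c = a k then insert x else id) {y\<in>J-{x}. col y = c}"
        using x by (auto simp: J1_def)
      then show ?thesis using Suc.prems(1) by simp
    qed
    have "card (L k (J - {x})) = (if \<forall>c\<in>R. card {y\<in>J-{x}. col y = c} = card {j\<in>{..<k}. a j = c}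
     then \<Prod>c\<in>R. fact (card {j\<in>{..<k}. a j = c}) else 0)"
      unfolding L_def using Suc.prems by (intro Suc.IH) (auto simp: less_Suc_eq)
    then show "card (L k (J - {x})) = (if \<forall>c\<in>R. card {x\<in>J. col x = c} = card {j\<in>{..<Suc k}. a j = c}
     then \<Prod>c\<in>R. fact (card {j\<in>{..<k}. a j = c}) else 0)"
      unfolding A B by simp
  qed
  also have "\<dots> = (if \<forall>c\<in>R. card {x\<in>J. col x = c} = card {j\<in>{..<Suc k}. a j = c}
     then card J1 * (\<Prod>c\<in>R. fact (card {j\<in>{..<k}. a j = c})) else 0)"
    by simp
  also have "\<dots> = (if \<forall>c\<in>R. card {x\<in>J. col x = c} = card {j\<in>{..<Suc k}. a j = c}
     then \<Prod>c\<in>R. fact (card {j\<in>{..<Suc k}. a j = c}) else 0)"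
  proof (rule if_cong[OF refl _ refl])
    assume eq: "\<forall>c\<in>R. card {x\<in>J. col x = c} = card {j\<in>{..<Suc k}. a j = c}"
    have ak: "a k \<in> R" using Suc.prems by auto
    have A: "{j\<in>{..<Suc k}. a j = c} = (if c = a k then insert k {j\<in>{..<k}. a j = c} else {j\<in>{..<k}. a j = c})" for c
      by (auto simp: less_Suc_eq)
    have "card J1 = Suc (card {j\<in>{..<k}. a j = a k})"
      using eq ak A[of "a k"] by (auto simp: J1_def)
    moreover have "(\<Prod>c\<in>R. fact (card {j\<in>{..<Suc k}. a j = c})) =
      (fact (Suc (card {j\<in>{..<k}. a j = a k})) :: nat) * (\<Prod>c\<in>R-{a k}. fact (card {j\<in>{..<k}. a j = c}))"
    proof -
      have "(\<Prod>c\<in>R-{a k}. fact (card {j\<in>{..<Suc k}. a j = c}) :: nat) =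
        (\<Prod>c\<in>R-{a k}. fact (card {j\<in>{..<k}. a j = c}))"
        by (rule prod.cong[OF refl], subst A) simp
      moreover have "card {j\<in>{..<Suc k}. a j = a k} = Suc (card {j\<in>{..<k}. a j = a k})"
        by (subst A) simp
      ultimately show ?thesis
        using ak assms(2) by (subst prod.remove[of _ "a k"]) simp_all
    qed
    moreover have "(\<Prod>c\<in>R. fact (card {j\<in>{..<k}. a j = c})) =
      (fact (card {j\<in>{..<k}. a j = a k}) :: nat) * (\<Prod>c\<in>R-{a k}. fact (card {j\<in>{..<k}. a j = c}))"
      using ak assms(2) by (subst prod.remove[of _ "a k"]) auto
    ultimately show "card J1 * (\<Prod>c\<in>R. fact (card {j\<in>{..<k}. a j = c})) = (\<Prod>c\<in>R. fact (card {j\<in>{..<Suc k}. a j = c}))"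
      by (simp only: fact_Suc mult.assoc of_nat_id)
  qed
  finally show ?case unfolding L_def .
qed

text \<open>A labelling singles out the subset that gets the first \<open>m\<close> labels; colouring this subset shows that
each subset of size \<open>m\<close> is obtained \<open>m! j!\<close> times. In this way sums over possible clusters, which are
sets of points, become sums over tuples of points, which can be integrated.\<close>

lemma sum_subsets_as_labellings:
  fixes F :: "'i set \<Rightarrow> ennreal"
  assumes J: "finite J" "card J = m + j"
  shows "(\<Sum>\<iota>\<in>labellings (m + j) J. F (\<iota> ` {..<m})) =
    of_nat (fact m * fact j) * (\<Sum>I | I \<subseteq> J \<and> card I = m. F I)"
proof -
  have "(\<Sum>\<iota>\<in>labellings (m + j) J. F (\<iota> ` {..<m})) =
      (\<Sum>I | I \<subseteq> J \<and> card I = m. \<Sum>\<iota> | \<iota> \<in> labellings (m + j) J \<and> \<iota> ` {..<m} = I. F (\<iota> ` {..<m}))"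
  proof (rule sum.group[symmetric])
    show "(\<lambda>\<iota>. \<iota> ` {..<m}) ` labellings (m + j) J \<subseteq> {I. I \<subseteq> J \<and> card I = m}"
    proof safe
      fix \<iota> assume "\<iota> \<in> labellings (m + j) J"
      then have b: "inj_on \<iota> {..<m+j}" "\<iota> ` {..<m+j} = J" by (auto simp: labellings_def bij_betw_def)
      then have "inj_on \<iota> {..<m}" by (rule_tac inj_on_subset) auto
      then show "card (\<iota> ` {..<m}) = m" by (simp add: card_image)
      show "\<And>i. i < m \<Longrightarrow> \<iota> i \<in> J" using b by auto
    qed
  qed (use J in \<open>auto simp: finite_labellings\<close>)
  also have "\<dots> = (\<Sum>I | I \<subseteq> J \<and> card I = m. of_nat (fact m * fact j) * F I)"
  proof (rule sum.cong[OF refl])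
    fix I assume "I \<in> {I. I \<subseteq> J \<and> card I = m}"
    then have I: "I \<subseteq> J" "card I = m" by auto
    have finI: "finite I" using I J finite_subset by auto
    have "{\<iota> \<in> labellings (m + j) J. \<iota> ` {..<m} = I} =
      {\<iota> \<in> labellings (m + j) J. \<forall>i<m+j. (if \<iota> i \<in> I then 1 else 0::nat) = (if i < m then 1 else 0)}" (is "?A = ?B")
    proof (rule set_eqI, rule iffI)
      fix \<iota> assume "\<iota> \<in> ?A"
      then have i: "\<iota> \<in> labellings (m + j) J" "I = \<iota> ` {..<m}" by auto
      then have b: "inj_on \<iota> {..<m+j}" by (auto simp: labellings_def bij_betw_def)
      have "i = x" if "\<iota> i = \<iota> x" "x < m" "i < m + j" for i x
        using that i b by (intro inj_onD[OF b]) auto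
      then show "\<iota> \<in> ?B" using i by auto
    next
      fix \<iota> assume "\<iota> \<in> ?B"
      then have i: "\<iota> \<in> labellings (m + j) J" and
        h: "\<And>i. i < m + j \<Longrightarrow> (\<iota> i \<in> I \<longleftrightarrow> i < m)" by (auto split: if_splits)
      then have b: "\<iota> ` {..<m+j} = J" by (auto simp: labellings_def bij_betw_def)
      have "\<iota> ` {..<m} \<subseteq> I" using h by auto
      moreover have "I \<subseteq> \<iota> ` {..<m}"
      proof
        fix x assume "x \<in> I"
        then obtain i where "i < m + j" "x = \<iota> i" using b I by blast
        then show "x \<in> \<iota> ` {..<m}" using h \<open>x \<in> I\<close> by auto
      qed
      ultimately show "\<iota> \<in> ?A" using i by auto
    qed
    moreover have "card ?B = fact m * fact j"
    proof -
      have "{x\<in>J. (if x \<in> I then 1 else 0::nat) = 1} = I" "{x\<in>J. (if x \<in> I then 1 else 0::nat) = 0} = J - I"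
        using I by auto
      moreover have "{i\<in>{..<m+j}. (if i < m then 1 else 0::nat) = 1} = {..<m}"
        "{i\<in>{..<m+j}. (if i < m then 1 else 0::nat) = 0} = {m..<m+j}"
        by (auto split: if_splits)
      moreover have "card (J - I) = j" using I J finI by (simp add: card_Diff_subset)
      ultimately show ?thesis
        using I by (subst card_coloured_labellings[where R="{0,1}"]) (auto simp: J simp del: One_nat_def)
    qed
    ultimately have "card ?A = fact m * fact j" by (simp only:)
    then show "(\<Sum>\<iota> | \<iota> \<in> labellings (m + j) J \<and> \<iota> ` {..<m} = I. F (\<iota> ` {..<m})) = of_nat (fact m * fact j) * F I"
      by simp
  qed
  finally show ?thesis by (simp add: sum_distrib_left)
qed

section \<open>Tuples of points of a Poisson process\<close>

text \<open>The enumeration may depend on the whole configuration in an arbitrary measurable way, so that nothing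
can be said about the law of a single point \<open>X i\<close>. Only sums that run over all orders of the indices
have expectations that are determined by the Poisson process.\<close>

locale poisson_points = prob_space M for M :: "'w measure" +
  fixes \<Lambda> :: "'a :: polish_space measure" and t :: real and \<eta> :: "'w \<Rightarrow> 'a set" and v :: 'a
    and K :: "'w \<Rightarrow> enat" and X :: "nat \<Rightarrow> 'w \<Rightarrow> 'a"
  assumes t_pos: "t > 0"
    and sets_Lambda [measurable_cong]: "sets \<Lambda> = sets borel"
    and poisson: "poisson_process M (scale_measure (ennreal t) \<Lambda>) \<eta>"
    and enum: "vertex_enumeration M (\<lambda>\<omega>. insert v (\<eta> \<omega>)) K X"
begin

abbreviation pos :: "'w \<Rightarrow> nat \<Rightarrow> 'a" where
  "pos \<omega> \<equiv> \<lambda>i. X i \<omega>"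

definition idx :: "'a set \<Rightarrow> 'w \<Rightarrow> nat set" where
  "idx B \<omega> = {i. enat i < K \<omega> \<and> X i \<omega> \<in> B}"

lemma K_measurable [measurable]: "K \<in> M \<rightarrow>\<^sub>M count_space UNIV"
  and X_measurable [measurable]: "X i \<in> borel_measurable M"
  using enum by (auto simp: vertex_enumeration_def)

lemma idx_measurable [measurable]:
  assumes [measurable]: "B \<in> sets borel"
  shows "Measurable.pred M (\<lambda>\<omega>. i \<in> idx B \<omega>)"
  unfolding idx_def by simp

lemma bij_betw_idx:
  assumes "\<omega> \<in> space M" "v \<notin> B"
  shows "bij_betw (pos \<omega>) (idx B \<omega>) (\<eta> \<omega> \<inter> B)"
proof -
  have b: "bij_betw (pos \<omega>) {i. enat i < K \<omega>} (insert v (\<eta> \<omega>))"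
    using enum assms by (auto simp: vertex_enumeration_def)
  have "bij_betw (pos \<omega>) (idx B \<omega>) ((pos \<omega>) ` idx B \<omega>)"
    using b by (auto simp: bij_betw_def idx_def inj_on_def)
  also have "(pos \<omega>) ` idx B \<omega> = insert v (\<eta> \<omega>) \<inter> B"
  proof -
    have "(pos \<omega>) ` idx B \<omega> = (pos \<omega>) ` {i. enat i < K \<omega>} \<inter> B"
      by (auto simp: idx_def)
    then show ?thesis using b by (simp add: bij_betw_def)
  qed
  also have "\<dots> = \<eta> \<omega> \<inter> B" using assms by auto
  finally show ?thesis .
qed

lemma point_count_idx:
  assumes "\<omega> \<in> space M" "v \<notin> B"
  shows "point_count \<eta> B \<omega> = of_nat n \<longleftrightarrow> finite (idx B \<omega>) \<and> card (idx B \<omega>) = n"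
proof -
  note fin = bij_betw_finite[OF bij_betw_idx[OF assms]]
  note card = bij_betw_same_card[OF bij_betw_idx[OF assms]]
  show ?thesis
  proof (cases "finite (idx B \<omega>)")
    case True
    then show ?thesis using fin card by (simp add: point_count_def)
  next
    case False
    then have "point_count \<eta> B \<omega> = \<top>" using fin by (simp add: point_count_def)
    then show ?thesis using False by (metis ennreal_of_nat_neq_top)
  qed
qed

lemma prob_counts:
  fixes R :: "nat set"
  assumes fin: "finite R" and disj: "disjoint_family_on D R"
    and D: "\<And>c. c \<in> R \<Longrightarrow> D c \<in> sets borel" "\<And>c. c \<in> R \<Longrightarrow> v \<notin> D c" "\<And>c. c \<in> R \<Longrightarrow> emeasure \<Lambda> (D c) < \<infinity>"
  shows "prob {\<omega>\<in>space M. \<forall>c\<in>R. finite (idx (D c) \<omega>) \<and> card (idx (D c) \<omega>) = n c} =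
    (\<Prod>c\<in>R. (t * measure \<Lambda> (D c)) ^ n c / fact (n c) * exp (- (t * measure \<Lambda> (D c))))"
proof (cases "R = {}")
  case True
  then show ?thesis by (simp add: prob_space)
next
  case False
  have "\<forall>(I :: nat set) B. finite I \<longrightarrow> disjoint_family_on B I \<longrightarrow> (\<forall>i\<in>I. B i \<in> sets borel) \<longrightarrow>
      indep_vars (\<lambda>_. borel) (\<lambda>i. point_count \<eta> (B i)) I"
    using poisson by (simp add: poisson_process_def)
  from this[rule_format, OF fin disj D(1)]
  have iv: "indep_vars (\<lambda>_. borel) (\<lambda>i. point_count \<eta> (D i)) R" .
  have "prob {\<omega>\<in>space M. \<forall>c\<in>R. finite (idx (D c) \<omega>) \<and> card (idx (D c) \<omega>) = n c} =
    prob (\<Inter>c\<in>R. point_count \<eta> (D c) -` {of_nat (n c)} \<inter> space M)"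
  proof -
    have "(\<Inter>c\<in>R. point_count \<eta> (D c) -` {of_nat (n c)} \<inter> space M) =
      {\<omega>\<in>space M. \<forall>c\<in>R. point_count \<eta> (D c) \<omega> = of_nat (n c)}" using False by auto
    also have "\<dots> = {\<omega>\<in>space M. \<forall>c\<in>R. finite (idx (D c) \<omega>) \<and> card (idx (D c) \<omega>) = n c}"
      by (intro Collect_cong conj_cong ball_cong refl point_count_idx D(2))
    finally show ?thesis by simp
  qed
  also have "\<dots> = (\<Prod>c\<in>R. prob (point_count \<eta> (D c) -` {of_nat (n c)} \<inter> space M))"
    using iv False fin by (intro indep_varsD) auto
  also have "\<dots> = (\<Prod>c\<in>R. (t * measure \<Lambda> (D c)) ^ n c / fact (n c) * exp (- (t * measure \<Lambda> (D c))))"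
  proof (rule prod.cong[OF refl])
    fix c assume c: "c \<in> R"
    have "prob (point_count \<eta> (D c) -` {of_nat (n c)} \<inter> space M) =
      prob {\<omega>\<in>space M. point_count \<eta> (D c) \<omega> = of_nat (n c)}"
      by (rule arg_cong[where f=prob]) auto
    also have "\<dots> = poisson_prob (emeasure (scale_measure (ennreal t) \<Lambda>) (D c)) (n c)"
      using poisson D(1)[OF c] by (simp add: poisson_process_def)
    also have "emeasure (scale_measure (ennreal t) \<Lambda>) (D c) = ennreal (t * measure \<Lambda> (D c))"
      using D(3)[OF c] t_pos by (simp add: emeasure_eq_ennreal_measure ennreal_mult less_top)
    finally show "prob (point_count \<eta> (D c) -` {of_nat (n c)} \<inter> space M) =
      (t * measure \<Lambda> (D c)) ^ n c / fact (n c) * exp (- (t * measure \<Lambda> (D c)))"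
      using t_pos by (simp add: poisson_prob_def)
  qed
  finally show ?thesis .
qed

lemma measurable_labelling_pred [measurable]:
  assumes [measurable]: "B \<in> sets borel"
  shows "Measurable.pred M (\<lambda>\<omega>. \<iota> \<in> labellings k (idx B \<omega>))"
proof -
  have "(\<lambda>\<omega>. \<iota> \<in> labellings k (idx B \<omega>)) =
    (\<lambda>\<omega>. \<iota> \<in> extensional {..<k} \<and> inj_on \<iota> {..<k} \<and> (\<forall>i. i \<in> \<iota> ` {..<k} \<longleftrightarrow> i \<in> idx B \<omega>))"
    by (auto simp: labellings_def bij_betw_def fun_eq_iff)
  then show ?thesis by simp
qed

lemma measurable_sum_labellings [measurable]:
  assumes [measurable]: "B \<in> sets borel"
    and G: "\<And>\<iota>. (\<lambda>\<omega>. G \<omega> \<iota>) \<in> borel_measurable M"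
  shows "(\<lambda>\<omega>. \<Sum>\<iota>\<in>labellings k (idx B \<omega>). G \<omega> \<iota> :: ennreal) \<in> borel_measurable M"
proof -
  note G [measurable]
  have c: "countable ({..<k} \<rightarrow>\<^sub>E (UNIV :: nat set))" by (intro countable_PiE) auto
  have "(\<Sum>\<iota>\<in>labellings k (idx B \<omega>). G \<omega> \<iota>) =
    (\<integral>\<^sup>+\<iota>. G \<omega> \<iota> * indicator (labellings k (idx B \<omega>)) \<iota> \<partial>count_space ({..<k} \<rightarrow>\<^sub>E UNIV))" for \<omega>
  proof -
    have "labellings k (idx B \<omega>) \<subseteq> {..<k} \<rightarrow>\<^sub>E UNIV" by (auto simp: labellings_def PiE_def)
    then show ?thesis
      by (subst nn_integral_count_space'[of "labellings k (idx B \<omega>)"]) (auto simp: finite_labellings)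
  qed
  moreover have "(\<lambda>(\<iota>, \<omega>). G \<omega> \<iota> * indicator (labellings k (idx B \<omega>)) \<iota>) \<in>
      borel_measurable (count_space ({..<k} \<rightarrow>\<^sub>E UNIV) \<Otimes>\<^sub>M M)"
    by (intro measurable_pair_measure_countable1 c) (simp add: indicator_def)
  then have "(\<lambda>(\<omega>, \<iota>). G \<omega> \<iota> * indicator (labellings k (idx B \<omega>)) \<iota>) \<in>
      borel_measurable (M \<Otimes>\<^sub>M count_space ({..<k} \<rightarrow>\<^sub>E UNIV))"
    by (subst (asm) measurable_pair_swap_iff) (simp add: case_prod_beta)
  ultimately show ?thesis
    using sigma_finite_measure.borel_measurable_nn_integral[OF sigma_finite_measure_count_space_countable[OF c]]
    by simp
qed

abbreviation coloured :: "nat \<Rightarrow> 'a set \<Rightarrow> ('a \<Rightarrow> nat) \<Rightarrow> (nat \<Rightarrow> nat) \<Rightarrow> 'w \<Rightarrow> (nat \<Rightarrow> nat) set" where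
  "coloured k B col a \<omega> \<equiv> {\<iota> \<in> labellings k (idx B \<omega>). \<forall>j<k. col (X (\<iota> j) \<omega>) = a j}"

text \<open>Whether labellings with the prescribed colours exist depends only on the number of points of each
colour. If they do, their number is a product of factorials, which cancels the factorials in the
Poisson probabilities.\<close>

lemma nn_integral_coloured_labellings:
  assumes B: "B \<in> sets borel" "v \<notin> B" "emeasure \<Lambda> B < \<infinity>"
    and col: "col \<in> borel \<rightarrow>\<^sub>M count_space UNIV" and R: "finite (R :: nat set)" "col ` B \<subseteq> R"
    and a: "a ` {..<k} \<subseteq> R"
  shows "(\<integral>\<^sup>+\<omega>. of_nat (card (coloured k B col a \<omega>)) \<partial>M) =
    ennreal (exp (- t * measure \<Lambda> B) * (\<Prod>j<k. t * measure \<Lambda> {x\<in>B. col x = a j}))"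
proof -
  define D where "D c = {x\<in>B. col x = c}" for c
  define n where "n c = card {j\<in>{..<k}. a j = c}" for c
  note col[measurable] B(1)[measurable]
  have D_sets: "D c \<in> sets borel" for c
  proof -
    have "D c = B \<inter> (col -` {c} \<inter> space borel)" by (auto simp: D_def)
    then show ?thesis using B(1) measurable_sets[OF col, of "{c}"] by simp
  qed
  have D_fin: "emeasure \<Lambda> (D c) < \<infinity>" for c
    using emeasure_mono[of "D c" B \<Lambda>] B by (auto simp: D_def sets_Lambda)
  have disj: "disjoint_family_on D R" by (auto simp: disjoint_family_on_def D_def)
  have B_UN: "B = (\<Union>c\<in>R. D c)" using R(2) by (auto simp: D_def)
  have mB: "measure \<Lambda> B = (\<Sum>c\<in>R. measure \<Lambda> (D c))"
    using disj R(1) D_fin by (subst B_UN, intro measure_finite_Union) (auto simp: sets_Lambda D_sets less_top)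
  let ?C = "\<lambda>\<omega>. \<forall>c\<in>R. finite (idx (D c) \<omega>) \<and> card (idx (D c) \<omega>) = n c"
  have card: "card (coloured k B col a \<omega>) =
    (\<Prod>c\<in>R. fact (n c)) * indicator {\<omega>\<in>space M. ?C \<omega>} \<omega>" if w: "\<omega> \<in> space M" for \<omega>
  proof (cases "finite (idx B \<omega>)")
    case True
    have sub: "idx (D c) \<omega> \<subseteq> idx B \<omega>" for c by (auto simp: idx_def D_def)
    have eq: "{i \<in> idx B \<omega>. col (X i \<omega>) = c} = idx (D c) \<omega>" for c by (auto simp: idx_def D_def)
    have "(\<lambda>i. col (X i \<omega>)) ` idx B \<omega> \<subseteq> R" using R by (auto simp: idx_def)
    then show ?thesis
      using card_coloured_labellings[OF True R(1) _ a, of "\<lambda>i. col (X i \<omega>)"] w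
      by (auto simp: eq n_def finite_subset[OF sub True] split: split_indicator)
  next
    case False
    have "idx B \<omega> = (\<Union>c\<in>R. idx (D c) \<omega>)" using B_UN by (auto simp: idx_def)
    then have "\<not> ?C \<omega>" using False R(1) by auto
    moreover have "labellings k (idx B \<omega>) = {}" using labellings_card[of _ k "idx B \<omega>"] False by blast
    ultimately show ?thesis by simp
  qed
  have meas: "{\<omega>\<in>space M. ?C \<omega>} \<in> sets M"
  proof -
    have "{\<omega>\<in>space M. ?C \<omega>} = {\<omega>\<in>space M. \<forall>c\<in>R. point_count \<eta> (D c) \<omega> = of_nat (n c)}"
      using B(2) by (auto simp: point_count_idx D_def)
    moreover have [measurable]: "point_count \<eta> (D c) \<in> borel_measurable M" for c
      using poisson D_sets[of c] by (auto simp: poisson_process_def)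
    ultimately show ?thesis using R(1) by simp
  qed
  have "(\<integral>\<^sup>+\<omega>. of_nat (card (coloured k B col a \<omega>)) \<partial>M) =
    (\<integral>\<^sup>+\<omega>. of_nat (\<Prod>c\<in>R. fact (n c)) * indicator {\<omega>\<in>space M. ?C \<omega>} \<omega> \<partial>M)"
    by (intro nn_integral_cong) (simp add: card split: split_indicator)
  also have "\<dots> = of_nat (\<Prod>c\<in>R. fact (n c)) * ennreal (prob {\<omega>\<in>space M. ?C \<omega>})"
    using meas by (simp add: nn_integral_cmult_indicator emeasure_eq_measure)
  also have "prob {\<omega>\<in>space M. ?C \<omega>} = (\<Prod>c\<in>R. (t * measure \<Lambda> (D c)) ^ n c / fact (n c) * exp (- (t * measure \<Lambda> (D c))))"
    using B(2) by (intro prob_counts R disj D_sets D_fin) (auto simp: D_def)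
  also have "of_nat (\<Prod>c\<in>R. fact (n c)) * ennreal \<dots> =
    ennreal ((\<Prod>c\<in>R. fact (n c)) * (\<Prod>c\<in>R. (t * measure \<Lambda> (D c)) ^ n c / fact (n c) * exp (- (t * measure \<Lambda> (D c)))))"
    by (subst ennreal_mult') (simp_all add: ennreal_of_nat_eq_real_of_nat prod_nonneg)
  also have "(\<Prod>c\<in>R. fact (n c)) * (\<Prod>c\<in>R. (t * measure \<Lambda> (D c)) ^ n c / fact (n c) * exp (- (t * measure \<Lambda> (D c)))) =
    (\<Prod>c\<in>R. (t * measure \<Lambda> (D c)) ^ n c) * (\<Prod>c\<in>R. exp (- (t * measure \<Lambda> (D c))))"
    by (simp flip: prod.distrib)
  also have "(\<Prod>c\<in>R. exp (- (t * measure \<Lambda> (D c)))) = exp (- t * measure \<Lambda> B)"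
    by (simp add: mB exp_sum[OF R(1), symmetric] sum_negf sum_distrib_left)
  also have "(\<Prod>c\<in>R. (t * measure \<Lambda> (D c)) ^ n c) = (\<Prod>c\<in>R. \<Prod>j | j \<in> {..<k} \<and> a j = c. t * measure \<Lambda> (D (a j)))"
    by (intro prod.cong refl) (simp add: n_def)
  also have "\<dots> = (\<Prod>j<k. t * measure \<Lambda> (D (a j)))"
    using R(1) a by (intro prod.group) auto
  finally show ?thesis by (simp add: D_def mult.commute)
qed

text \<open>The sets \<open>A j\<close> may overlap. If a point is coloured by the set of all \<open>j\<close> with \<open>x \<in> A j\<close>, the colour
classes are disjoint and each \<open>A j\<close> is a union of classes. The colours are encoded as natural numbers
because these index the independent counts of a Poisson process.\<close>

lemma nn_integral_rectangle_labellings: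
  assumes B: "B \<in> sets borel" "v \<notin> B" "emeasure \<Lambda> B < \<infinity>"
    and A: "\<And>j. j < k \<Longrightarrow> A j \<in> sets borel"
  shows "(\<integral>\<^sup>+\<omega>. of_nat (card {\<iota> \<in> labellings k (idx B \<omega>). \<forall>j<k. X (\<iota> j) \<omega> \<in> A j}) \<partial>M) =
    ennreal (exp (- t * measure \<Lambda> B) * (\<Prod>j<k. t * measure \<Lambda> (A j \<inter> B)))"
proof -
  define col where "col x = set_encode {i\<in>{..<k}. x \<in> A i}" for x
  define R where "R = set_encode ` Pow {..<k}"
  define P where "P = Pi\<^sub>E {..<k} (\<lambda>j. {c\<in>R. j \<in> set_decode c})"
  have decode_col: "set_decode (col x) = {i\<in>{..<k}. x \<in> A i}" for x by (simp add: col_def)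
  have R: "finite R" by (simp add: R_def)
  have col_R: "col x \<in> R" for x by (auto simp: col_def R_def)
  have finP: "finite P" using R by (auto simp: P_def intro!: finite_PiE)
  have col: "col \<in> borel \<rightarrow>\<^sub>M count_space UNIV"
  proof -
    have "col = (\<lambda>x. \<Sum>i<k. if x \<in> A i then 2^i else 0)"
      by (auto simp: col_def set_encode_def fun_eq_iff sum.If_cases Int_def intro!: sum.cong)
    moreover have "(\<lambda>x. \<Sum>i<k. if x \<in> A i then 2^i else 0 :: nat) \<in> borel \<rightarrow>\<^sub>M count_space UNIV"
      using A by (intro measurable_sum_nat measurable_If) auto
    ultimately show ?thesis by simp
  qed
  have split: "card {\<iota> \<in> labellings k (idx B \<omega>). \<forall>j<k. X (\<iota> j) \<omega> \<in> A j} =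
    (\<Sum>a\<in>P. card (coloured k B col a \<omega>))" for \<omega>
  proof -
    have "{\<iota> \<in> labellings k (idx B \<omega>). \<forall>j<k. X (\<iota> j) \<omega> \<in> A j} =
      (\<Union>a\<in>P. (coloured k B col a \<omega>))"
    proof (intro set_eqI iffI)
      fix \<iota> assume i: "\<iota> \<in> {\<iota> \<in> labellings k (idx B \<omega>). \<forall>j<k. X (\<iota> j) \<omega> \<in> A j}"
      define a where "a = (\<lambda>j\<in>{..<k}. col (X (\<iota> j) \<omega>))"
      have "a \<in> P" using i col_R by (auto simp: P_def a_def decode_col)
      then show "\<iota> \<in> (\<Union>a\<in>P. (coloured k B col a \<omega>))"
        using i by (auto simp: a_def intro!: bexI[of _ a])
    next
      fix \<iota> assume "\<iota> \<in> (\<Union>a\<in>P. (coloured k B col a \<omega>))"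
      then obtain a where a: "a \<in> P" "\<iota> \<in> labellings k (idx B \<omega>)" "\<forall>j<k. col (X (\<iota> j) \<omega>) = a j" by auto
      have "X (\<iota> j) \<omega> \<in> A j" if "j < k" for j
      proof -
        have "j \<in> set_decode (a j)" using a(1) that by (auto simp: P_def)
        then show ?thesis using a(3) that decode_col[of "X (\<iota> j) \<omega>"] by auto
      qed
      then show "\<iota> \<in> {\<iota> \<in> labellings k (idx B \<omega>). \<forall>j<k. X (\<iota> j) \<omega> \<in> A j}" using a by auto
    qed
    also have "card \<dots> = (\<Sum>a\<in>P. card (coloured k B col a \<omega>))"
    proof (rule card_UN_disjoint)
      show "\<forall>a\<in>P. \<forall>b\<in>P. a \<noteq> b \<longrightarrow> (coloured k B col a \<omega>) \<inter>
        (coloured k B col b \<omega>) = {}"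
      proof (intro ballI impI equals0I)
        fix a b \<iota> assume ab: "a \<in> P" "b \<in> P" "a \<noteq> b" and
          "\<iota> \<in> (coloured k B col a \<omega>) \<inter>
        (coloured k B col b \<omega>)"
        then have "\<forall>j\<in>{..<k}. a j = b j" by auto
        then have "a = b" using ab unfolding P_def by (intro PiE_ext) auto
        then show False using ab by simp
      qed
    qed (auto simp: finP finite_labellings)
    finally show ?thesis .
  qed
  have meas: "(\<lambda>\<omega>. of_nat (card (coloured k B col a \<omega>)) :: ennreal) \<in> borel_measurable M" for a
  proof -
    note col[measurable] B(1)[measurable]
    have "(of_nat (card (coloured k B col a \<omega>)) :: ennreal) =
      (\<Sum>\<iota>\<in>labellings k (idx B \<omega>). if \<forall>j\<in>{..<k}. col (X (\<iota> j) \<omega>) = a j then 1 else 0)" for \<omega>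
      by (subst sum.If_cases) (simp_all add: finite_labellings Int_def Ball_def)
    then show ?thesis by simp
  qed
  have DA: "(\<Sum>c | c \<in> R \<and> j \<in> set_decode c. t * measure \<Lambda> {x\<in>B. col x = c}) = t * measure \<Lambda> (A j \<inter> B)" if "j < k" for j
  proof -
    have "A j \<inter> B = (\<Union>c\<in>{c\<in>R. j \<in> set_decode c}. {x\<in>B. col x = c})"
      using that col_R by (auto simp: decode_col)
    moreover have "{x\<in>B. col x = c} \<in> sets \<Lambda>" for c
    proof -
      have "{x\<in>B. col x = c} = B \<inter> (col -` {c} \<inter> space borel)" by auto
      then show ?thesis using B(1) measurable_sets[OF col, of "{c}"] by (simp add: sets_Lambda)
    qed
    moreover have "emeasure \<Lambda> {x\<in>B. col x = c} \<noteq> \<infinity>" for c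
      using emeasure_mono[of "{x\<in>B. col x = c}" B \<Lambda>] B by (auto simp: sets_Lambda top_unique)
    ultimately have "measure \<Lambda> (A j \<inter> B) = (\<Sum>c | c \<in> R \<and> j \<in> set_decode c. measure \<Lambda> {x\<in>B. col x = c})"
      using R by (simp only:, intro measure_finite_Union) (auto simp: disjoint_family_on_def)
    then show ?thesis by (simp add: sum_distrib_left)
  qed
  have "(\<integral>\<^sup>+\<omega>. of_nat (card {\<iota> \<in> labellings k (idx B \<omega>). \<forall>j<k. X (\<iota> j) \<omega> \<in> A j}) \<partial>M) =
    (\<Sum>a\<in>P. \<integral>\<^sup>+\<omega>. of_nat (card (coloured k B col a \<omega>)) \<partial>M)"
    by (subst nn_integral_sum[symmetric]) (auto simp: split meas)
  also have "\<dots> = (\<Sum>a\<in>P. ennreal (exp (- t * measure \<Lambda> B) * (\<Prod>j<k. t * measure \<Lambda> {x\<in>B. col x = a j})))"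
    using col_R by (intro sum.cong refl nn_integral_coloured_labellings[where R=R] B col R) (auto simp: P_def)
  also have "\<dots> = ennreal (\<Sum>a\<in>P. exp (- t * measure \<Lambda> B) * (\<Prod>j<k. t * measure \<Lambda> {x\<in>B. col x = a j}))"
    using t_pos by (intro sum_ennreal) (auto intro!: prod_nonneg mult_nonneg_nonneg)
  also have "(\<Sum>a\<in>P. exp (- t * measure \<Lambda> B) * (\<Prod>j<k. t * measure \<Lambda> {x\<in>B. col x = a j})) =
    exp (- t * measure \<Lambda> B) * (\<Prod>j<k. \<Sum>c | c \<in> R \<and> j \<in> set_decode c. t * measure \<Lambda> {x\<in>B. col x = c})"
    using R by (subst prod_sum_PiE) (auto simp: P_def sum_distrib_left)
  also have "\<dots> = exp (- t * measure \<Lambda> B) * (\<Prod>j<k. t * measure \<Lambda> (A j \<inter> B))"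
    using DA by simp
  finally show ?thesis .
qed

end

lemma emeasure_density_indicator:
  assumes "A \<in> sets M" "B \<in> sets M"
  shows "emeasure (density M (indicator B)) A = emeasure M (A \<inter> B)"
  using assms by (simp add: emeasure_density Int_commute flip: indicator_inter_arith)

context poisson_points
begin

text \<open>The left-hand side defines a finite measure on \<open>k\<close>-tuples, which is determined by its values on
rectangles.\<close>

lemma nn_integral_labellings:
  assumes B: "B \<in> sets borel" "v \<notin> B" "emeasure \<Lambda> B < \<infinity>"
    and G [measurable]: "G \<in> borel_measurable (\<Pi>\<^sub>M j\<in>{..<k}. borel)"
  shows "(\<integral>\<^sup>+\<omega>. (\<Sum>\<iota>\<in>labellings k (idx B \<omega>). G (\<lambda>j\<in>{..<k}. X (\<iota> j) \<omega>)) \<partial>M) =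
    ennreal (exp (- t * measure \<Lambda> B) * t ^ k) * (\<integral>\<^sup>+y. G y \<partial>(\<Pi>\<^sub>M j\<in>{..<k}. density \<Lambda> (indicator B)))"
proof -
  note B(1)[measurable]
  define N where "N = density \<Lambda> (indicator B)"
  have sets_N [measurable_cong]: "sets N = sets borel" by (simp add: N_def sets_Lambda)
  have emeasure_N: "emeasure N A = ennreal (measure \<Lambda> (A \<inter> B))" if [measurable]: "A \<in> sets borel" for A
  proof -
    have "emeasure N A = emeasure \<Lambda> (A \<inter> B)"
      by (simp add: N_def emeasure_density_indicator sets_Lambda)
    moreover have "emeasure \<Lambda> (A \<inter> B) \<noteq> \<infinity>"
      using emeasure_mono[of "A \<inter> B" B \<Lambda>] B by (auto simp: sets_Lambda top_unique)
    ultimately show ?thesis by (simp add: emeasure_eq_ennreal_measure)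
  qed
  have "finite_measure N"
    by (rule finite_measureI) (use emeasure_N[of UNIV] sets_eq_imp_space_eq[OF sets_N] in auto)
  then interpret N: finite_measure N .
  interpret N: product_sigma_finite "\<lambda>_. N"
    by unfold_locales
  define \<Omega> where "\<Omega> = ({..<k} \<rightarrow>\<^sub>E UNIV :: (nat \<Rightarrow> nat) set)"
  have c\<Omega>: "countable \<Omega>" by (auto simp: \<Omega>_def intro!: countable_PiE)
  interpret C: sigma_finite_measure "count_space \<Omega>"
    by (rule sigma_finite_measure_count_space_countable[OF c\<Omega>])
  interpret CM: pair_sigma_finite "count_space \<Omega>" M ..
  have PiM_eq: "sets (\<Pi>\<^sub>M j\<in>{..<k}. N) = sets (\<Pi>\<^sub>M j\<in>{..<k}. borel)"
    by (intro sets_PiM_cong) (simp_all add: sets_N)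
  define D where "D = density (count_space \<Omega> \<Otimes>\<^sub>M M) (\<lambda>(\<iota>, \<omega>). indicator (labellings k (idx B \<omega>)) \<iota>)"
  have D_meas [measurable]: "(\<lambda>(\<iota>, \<omega>). indicator (labellings k (idx B \<omega>)) \<iota> :: ennreal) \<in> borel_measurable (count_space \<Omega> \<Otimes>\<^sub>M M)"
    by (intro measurable_pair_measure_countable1 c\<Omega>) (simp add: indicator_def)
  have X_meas [measurable]: "(\<lambda>(\<iota>, \<omega>). \<lambda>j\<in>{..<k}. X (\<iota> j) \<omega>) \<in> count_space \<Omega> \<Otimes>\<^sub>M M \<rightarrow>\<^sub>M (\<Pi>\<^sub>M j\<in>{..<k}. N)"
    by (intro measurable_pair_measure_countable1 c\<Omega>) simp
  define \<nu> where "\<nu> = distr D (\<Pi>\<^sub>M j\<in>{..<k}. N) (\<lambda>(\<iota>, \<omega>). \<lambda>j\<in>{..<k}. X (\<iota> j) \<omega>)"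
  have sub: "labellings k J \<subseteq> \<Omega>" for J by (auto simp: labellings_def \<Omega>_def PiE_def)
  have \<nu>: "(\<integral>\<^sup>+y. H y \<partial>\<nu>) = (\<integral>\<^sup>+\<omega>. (\<Sum>\<iota>\<in>labellings k (idx B \<omega>). H (\<lambda>j\<in>{..<k}. X (\<iota> j) \<omega>)) \<partial>M)"
    if [measurable]: "H \<in> borel_measurable (\<Pi>\<^sub>M j\<in>{..<k}. N)" for H
  proof -
    have "(\<integral>\<^sup>+y. H y \<partial>\<nu>) = (\<integral>\<^sup>+p. (\<lambda>(\<iota>, \<omega>). indicator (labellings k (idx B \<omega>)) \<iota> * H (\<lambda>j\<in>{..<k}. X (\<iota> j) \<omega>)) p \<partial>(count_space \<Omega> \<Otimes>\<^sub>M M))"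
      unfolding \<nu>_def D_def by (simp add: nn_integral_distr nn_integral_density case_prod_beta)
    also have "\<dots> = (\<integral>\<^sup>+\<omega>. \<integral>\<^sup>+\<iota>. indicator (labellings k (idx B \<omega>)) \<iota> * H (\<lambda>j\<in>{..<k}. X (\<iota> j) \<omega>) \<partial>count_space \<Omega> \<partial>M)"
      by (subst CM.nn_integral_snd[symmetric]) simp_all
    also have "\<dots> = (\<integral>\<^sup>+\<omega>. (\<Sum>\<iota>\<in>labellings k (idx B \<omega>). H (\<lambda>j\<in>{..<k}. X (\<iota> j) \<omega>)) \<partial>M)"
    proof (rule nn_integral_cong)
      fix \<omega>
      show "(\<integral>\<^sup>+\<iota>. indicator (labellings k (idx B \<omega>)) \<iota> * H (\<lambda>j\<in>{..<k}. X (\<iota> j) \<omega>) \<partial>count_space \<Omega>) =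
        (\<Sum>\<iota>\<in>labellings k (idx B \<omega>). H (\<lambda>j\<in>{..<k}. X (\<iota> j) \<omega>))"
        using sub[of "idx B \<omega>"]
        by (subst nn_integral_count_space'[of "labellings k (idx B \<omega>)"]) (auto simp: finite_labellings)
    qed
    finally show ?thesis .
  qed
  define c where "c = exp (- t * measure \<Lambda> B) * t ^ k"
  have c: "c > 0" using t_pos by (simp add: c_def)
  have "scale_measure (ennreal (1 / c)) \<nu> = (\<Pi>\<^sub>M j\<in>{..<k}. N)"
  proof (rule N.PiM_eqI)
    fix A :: "nat \<Rightarrow> 'a set" assume "\<And>i. i \<in> {..<k} \<Longrightarrow> A i \<in> sets N"
    then have A: "\<And>i. i < k \<Longrightarrow> A i \<in> sets borel" by (simp add: sets_N)
    have [measurable]: "Pi\<^sub>E {..<k} A \<in> sets (\<Pi>\<^sub>M j\<in>{..<k}. N)"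
      using A by (intro sets_PiM_I_finite) (auto simp: sets_N)
    have "emeasure \<nu> (Pi\<^sub>E {..<k} A) = (\<integral>\<^sup>+y. indicator (Pi\<^sub>E {..<k} A) y \<partial>\<nu>)"
      by (simp add: \<nu>_def)
    also have "\<dots> = (\<integral>\<^sup>+\<omega>. of_nat (card {\<iota> \<in> labellings k (idx B \<omega>). \<forall>j<k. X (\<iota> j) \<omega> \<in> A j}) \<partial>M)"
      by (subst \<nu>) (auto intro!: nn_integral_cong simp: indicator_def sum.If_cases finite_labellings Int_def PiE_iff Ball_def)
    also have "\<dots> = ennreal (exp (- t * measure \<Lambda> B) * (\<Prod>j<k. t * measure \<Lambda> (A j \<inter> B)))"
      by (rule nn_integral_rectangle_labellings[OF B A])
    also have "\<dots> = ennreal c * (\<Prod>j<k. emeasure N (A j))"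
      using c A by (simp add: emeasure_N prod.distrib prod_ennreal ennreal_mult'[symmetric] c_def mult.assoc)
    finally show "emeasure (scale_measure (ennreal (1 / c)) \<nu>) (Pi\<^sub>E {..<k} A) = (\<Prod>j<k. emeasure N (A j))"
      using c by (simp add: mult.assoc[symmetric] ennreal_mult'[symmetric])
  qed (simp_all add: \<nu>_def)
  then have "(\<integral>\<^sup>+y. G y \<partial>(\<Pi>\<^sub>M j\<in>{..<k}. N)) = ennreal (1 / c) * (\<integral>\<^sup>+y. G y \<partial>\<nu>)"
    using G PiM_eq by (subst nn_integral_scale_measure[symmetric]) (simp_all add: \<nu>_def cong: measurable_cong_sets)
  then have "ennreal c * (\<integral>\<^sup>+y. G y \<partial>(\<Pi>\<^sub>M j\<in>{..<k}. N)) = (\<integral>\<^sup>+y. G y \<partial>\<nu>)"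
    using c by (simp add: mult.assoc[symmetric] ennreal_mult'[symmetric])
  also have "\<dots> = (\<integral>\<^sup>+\<omega>. (\<Sum>\<iota>\<in>labellings k (idx B \<omega>). G (\<lambda>j\<in>{..<k}. X (\<iota> j) \<omega>)) \<partial>M)"
    using G PiM_eq by (intro \<nu>) (simp cong: measurable_cong_sets)
  finally show ?thesis by (simp add: c_def N_def)
qed

text \<open>Mecke's formula for \<open>m\<close> points, combined with the formula for the generating functional: the sum runs
over all ways to single out \<open>m\<close> points, and each of the other points \<open>z\<close> contributes a factor \<open>w y z\<close>
that depends on the tuple \<open>y\<close> of the chosen ones. If there are \<open>j\<close> other points, their contribution
integrates to the \<open>j\<close>-th power of \<open>\<integral>w y z dz\<close>, and summation over \<open>j\<close> is an exponential series. The
functions \<open>gI\<close> and \<open>wI\<close> express \<open>g\<close> and \<open>w\<close> by the set of the chosen indices; that they are well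
defined means that the order of the points does not matter.\<close>

lemma nn_integral_split_configuration:
  fixes g :: "(nat \<Rightarrow> 'a) \<Rightarrow> ennreal" and w :: "(nat \<Rightarrow> 'a) \<Rightarrow> 'a \<Rightarrow> real"
  assumes B: "B \<in> sets borel" "v \<notin> B" "emeasure \<Lambda> B < \<infinity>"
    and g [measurable]: "g \<in> borel_measurable (\<Pi>\<^sub>M j\<in>{..<m}. borel)"
    and w [measurable]: "(\<lambda>(y, z). w y z) \<in> borel_measurable ((\<Pi>\<^sub>M j\<in>{..<m}. borel) \<Otimes>\<^sub>M borel)"
    and w01: "\<And>y z. 0 \<le> w y z" "\<And>y z. w y z \<le> 1"
    and gI: "\<And>\<iota> \<omega>. \<omega> \<in> space M \<Longrightarrow> inj_on \<iota> {..<m} \<Longrightarrow> \<iota> ` {..<m} \<subseteq> idx B \<omega> \<Longrightarrow>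
      gI (\<iota> ` {..<m}) \<omega> = g (\<lambda>j\<in>{..<m}. X (\<iota> j) \<omega>)"
    and wI: "\<And>\<iota> \<omega> z. \<omega> \<in> space M \<Longrightarrow> inj_on \<iota> {..<m} \<Longrightarrow> \<iota> ` {..<m} \<subseteq> idx B \<omega> \<Longrightarrow>
      wI (\<iota> ` {..<m}) \<omega> z = w (\<lambda>j\<in>{..<m}. X (\<iota> j) \<omega>) z"
  shows "(\<integral>\<^sup>+\<omega>. (if finite (idx B \<omega>) then \<Sum>I | I \<subseteq> idx B \<omega> \<and> card I = m.
        gI I \<omega> * (\<Prod>j\<in>idx B \<omega> - I. ennreal (wI I \<omega> (X j \<omega>))) else 0) \<partial>M) =
    ennreal (t ^ m / fact m) *
      (\<integral>\<^sup>+y. g y * ennreal (exp (- t * (\<integral>z. 1 - w y z \<partial>density \<Lambda> (indicator B))))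
        \<partial>(\<Pi>\<^sub>M j\<in>{..<m}. density \<Lambda> (indicator B)))"
proof -
  note B(1)[measurable]
  define N where "N = density \<Lambda> (indicator B)"
  have sets_N [measurable_cong]: "sets N = sets borel" by (simp add: N_def sets_Lambda)
  have space_N [simp]: "space N = UNIV" using sets_eq_imp_space_eq[OF sets_N] by simp
  have emeasure_N: "emeasure N (space N) = ennreal (measure \<Lambda> B)"
  proof -
    have "emeasure N (space N) = emeasure \<Lambda> B"
      using B(1) by (simp only: space_N) (simp add: N_def emeasure_density_indicator sets_Lambda)
    then show ?thesis using B by (simp add: emeasure_eq_ennreal_measure less_top)
  qed
  have "finite_measure N"
    by (rule finite_measureI) (use emeasure_N in simp)
  then interpret N: finite_measure N .
  interpret N: product_sigma_finite "\<lambda>_. N"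
    by unfold_locales
  have mN: "measure N UNIV = measure \<Lambda> B" using emeasure_N by (simp add: measure_def)
  have PiM_eq [measurable_cong]: "sets (\<Pi>\<^sub>M j\<in>J. N) = sets (\<Pi>\<^sub>M j\<in>J. borel)" for J :: "nat set"
    by (intro sets_PiM_cong) (simp_all add: sets_N)
  define F where "F I \<omega> = gI I \<omega> * (\<Prod>j\<in>idx B \<omega> - I. ennreal (wI I \<omega> (X j \<omega>)))" for I \<omega>
  define G where "G j y = g (restrict y {..<m}) * (\<Prod>i\<in>{m..<m+j}. ennreal (w (restrict y {..<m}) (y i)))" for j y
  have G_meas [measurable]: "G j \<in> borel_measurable (\<Pi>\<^sub>M i\<in>{..<m+j}. borel)" for j
  proof -
    have [measurable]: "(\<lambda>y. restrict y {..<m}) \<in> (\<Pi>\<^sub>M i\<in>{..<m+j}. borel) \<rightarrow>\<^sub>M (\<Pi>\<^sub>M i\<in>{..<m}. borel)"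
      by (rule measurable_restrict_subset) auto
    have [measurable]: "(\<lambda>y. w (restrict y {..<m}) (y i)) \<in> borel_measurable (\<Pi>\<^sub>M i\<in>{..<m+j}. borel)"
      if "i \<in> {m..<m+j}" for i
    proof -
      have [measurable]: "(\<lambda>y. y i) \<in> (\<Pi>\<^sub>M i\<in>{..<m+j}. borel :: 'a measure) \<rightarrow>\<^sub>M borel"
        using that by (intro measurable_component_singleton) auto
      show ?thesis using measurable_compose[OF measurable_Pair w, of "\<lambda>y. restrict y {..<m}" _ "\<lambda>y. y i"] by simp
    qed
    show ?thesis unfolding G_def by measurable
  qed
  have FG: "F (\<iota> ` {..<m}) \<omega> = G j (\<lambda>i\<in>{..<m+j}. X (\<iota> i) \<omega>)"
    if \<iota>: "\<iota> \<in> labellings (m + j) (idx B \<omega>)" and \<omega>: "\<omega> \<in> space M" for \<iota> j \<omega>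
  proof -
    have inj: "inj_on \<iota> {..<m+j}" and im: "\<iota> ` {..<m+j} = idx B \<omega>"
      using \<iota> by (auto simp: labellings_def bij_betw_def)
    have inj': "inj_on \<iota> {..<m}" by (rule inj_on_subset[OF inj]) auto
    have sub: "\<iota> ` {..<m} \<subseteq> idx B \<omega>" using im by auto
    have r: "restrict (\<lambda>i\<in>{..<m+j}. X (\<iota> i) \<omega>) {..<m} = (\<lambda>i\<in>{..<m}. X (\<iota> i) \<omega>)" by auto
    have "idx B \<omega> - \<iota> ` {..<m} = \<iota> ` ({..<m+j} - {..<m})"
      unfolding im[symmetric] by (rule inj_on_image_set_diff[OF inj, symmetric]) auto
    also have "{..<m+j} - {..<m} = {m..<m+j}" by auto
    finally have diff: "idx B \<omega> - \<iota> ` {..<m} = \<iota> ` {m..<m+j}" .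
    have "(\<Prod>i\<in>idx B \<omega> - \<iota> ` {..<m}. ennreal (wI (\<iota> ` {..<m}) \<omega> (X i \<omega>))) =
      (\<Prod>i\<in>{m..<m+j}. ennreal (wI (\<iota> ` {..<m}) \<omega> (X (\<iota> i) \<omega>)))"
    proof -
      have "inj_on \<iota> {m..<m+j}" by (rule inj_on_subset[OF inj]) auto
      then have "(\<Prod>i\<in>\<iota> ` {m..<m+j}. ennreal (wI (\<iota> ` {..<m}) \<omega> (X i \<omega>))) =
        (\<Prod>i\<in>{m..<m+j}. ennreal (wI (\<iota> ` {..<m}) \<omega> (X (\<iota> i) \<omega>)))"
        by (simp only: prod.reindex comp_def)
      with diff show ?thesis by simp
    qed
    then show ?thesis
      unfolding F_def G_def r by (simp add: gI[OF \<omega> inj' sub] wI[OF \<omega> inj' sub])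
  qed
  define c :: "nat \<Rightarrow> real" where "c j = 1 / (fact m * fact j)" for j
  \<comment> \<open>The only nonzero term is the one for which \<open>m + j\<close> is the number of points in \<open>B\<close>.\<close>
  have pointwise: "(if finite (idx B \<omega>) then \<Sum>I | I \<subseteq> idx B \<omega> \<and> card I = m. F I \<omega> else 0) =
    (\<Sum>j. ennreal (c j) * (\<Sum>\<iota>\<in>labellings (m + j) (idx B \<omega>). G j (\<lambda>i\<in>{..<m+j}. X (\<iota> i) \<omega>)))"
    (is "?l = suminf ?r") if \<omega>: "\<omega> \<in> space M" for \<omega>
  proof -
    have r: "?r j = ennreal (c j) * (\<Sum>\<iota>\<in>labellings (m + j) (idx B \<omega>). F (\<iota> ` {..<m}) \<omega>)" for j
      using FG[OF _ \<omega>] by simp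
    have empty: "labellings (m + j) (idx B \<omega>) = {}" if "\<not> (finite (idx B \<omega>) \<and> card (idx B \<omega>) = m + j)" for j
      using labellings_card[of _ "m + j" "idx B \<omega>"] that by blast
    show ?thesis
    proof (cases "finite (idx B \<omega>) \<and> m \<le> card (idx B \<omega>)")
      case True
      then obtain j where j: "card (idx B \<omega>) = m + j" using le_Suc_ex by blast
      have "suminf ?r = sum ?r {j}"
        by (rule suminf_finite) (auto simp: empty j)
      also have "\<dots> = ennreal (c j) * (\<Sum>\<iota>\<in>labellings (m + j) (idx B \<omega>). F (\<iota> ` {..<m}) \<omega>)"
        unfolding r by simp
      also have "(\<Sum>\<iota>\<in>labellings (m + j) (idx B \<omega>). F (\<iota> ` {..<m}) \<omega>) =
          of_nat (fact m * fact j) * (\<Sum>I | I \<subseteq> idx B \<omega> \<and> card I = m. F I \<omega>)"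
        using True j by (intro sum_subsets_as_labellings) auto
      also have "ennreal (c j) * (of_nat (fact m * fact j) * (\<Sum>I | I \<subseteq> idx B \<omega> \<and> card I = m. F I \<omega>)) =
          ennreal (c j) * of_nat (fact m * fact j) * (\<Sum>I | I \<subseteq> idx B \<omega> \<and> card I = m. F I \<omega>)"
        by (rule mult.assoc[symmetric])
      also have "ennreal (c j) * of_nat (fact m * fact j) = 1"
        unfolding ennreal_of_nat_eq_real_of_nat by (subst ennreal_mult'[symmetric]) (auto simp: c_def)
      finally show ?thesis using conjunct1[OF True] by (simp only: mult_1 if_True)
    next
      case False
      have "?r = (\<lambda>_. 0)" using False by (intro ext, subst empty) auto
      then have "suminf ?r = 0" by (simp only: suminf_zero)
      moreover have "?l = 0"
      proof (cases "finite (idx B \<omega>)")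
        case True
        then have "{I. I \<subseteq> idx B \<omega> \<and> card I = m} = {}" using False card_mono by fastforce
        then show ?thesis by (simp only: sum.empty if_cancel)
      qed simp
      ultimately show ?thesis by (simp only:)
    qed
  qed
  have w_y [measurable]: "w y \<in> borel_measurable borel" if "y \<in> space (\<Pi>\<^sub>M i\<in>{..<m}. borel)" for y
    using measurable_compose[OF measurable_Pair1'[OF that] w] by simp
  have int_w: "integrable N (w y)" if "y \<in> space (\<Pi>\<^sub>M i\<in>{..<m}. borel)" for y
    using w01 w_y[OF that] by (intro N.integrable_const_bound[of _ 1]) (auto simp: measurable_cong_sets[OF sets_N refl])
  define W where "W y = (\<integral>z. w y z \<partial>N)" for y
  have W0: "W y \<ge> 0" for y using w01 by (simp add: W_def)
  have W_meas [measurable]: "W \<in> borel_measurable (\<Pi>\<^sub>M i\<in>{..<m}. borel)"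
  proof -
    have [measurable]: "(\<lambda>(y, z). w y z) \<in> borel_measurable ((\<Pi>\<^sub>M j\<in>{..<m}. borel) \<Otimes>\<^sub>M N)"
      using w by (simp cong: measurable_cong_sets sets_pair_measure_cong add: sets_N)
    show ?thesis unfolding W_def by measurable
  qed
  have int_G: "(\<integral>\<^sup>+y. G j y \<partial>(\<Pi>\<^sub>M i\<in>{..<m+j}. N)) = (\<integral>\<^sup>+y. g y * ennreal (W y ^ j) \<partial>(\<Pi>\<^sub>M i\<in>{..<m}. N))" for j
  proof -
    have un: "{..<m} \<union> {m..<m+j} = {..<m+j}" by auto
    have "(\<integral>\<^sup>+y. G j y \<partial>(\<Pi>\<^sub>M i\<in>{..<m+j}. N)) =
      (\<integral>\<^sup>+y. \<integral>\<^sup>+z. G j (merge {..<m} {m..<m+j} (y, z)) \<partial>(\<Pi>\<^sub>M i\<in>{m..<m+j}. N) \<partial>(\<Pi>\<^sub>M i\<in>{..<m}. N))"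
      by (subst N.product_nn_integral_fold[of "{..<m}" "{m..<m+j}", unfolded un, symmetric]) auto
    also have "\<dots> = (\<integral>\<^sup>+y. g y * ennreal (W y ^ j) \<partial>(\<Pi>\<^sub>M i\<in>{..<m}. N))"
    proof (rule nn_integral_cong)
      fix y assume y: "y \<in> space (\<Pi>\<^sub>M i\<in>{..<m}. N)"
      then have y': "y \<in> space (\<Pi>\<^sub>M i\<in>{..<m}. borel)" by (simp add: space_PiM)
      have r: "restrict (merge {..<m} {m..<m+j} (y, z)) {..<m} = y" for z
        using y by (auto simp: space_PiM PiE_iff extensional_def restrict_def merge_def)
      have "(\<integral>\<^sup>+z. G j (merge {..<m} {m..<m+j} (y, z)) \<partial>(\<Pi>\<^sub>M i\<in>{m..<m+j}. N)) =
        (\<integral>\<^sup>+z. g y * (\<Prod>i\<in>{m..<m+j}. ennreal (w y (z i))) \<partial>(\<Pi>\<^sub>M i\<in>{m..<m+j}. N))"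
        unfolding G_def r by (intro nn_integral_cong arg_cong2[where f="(*)"] prod.cong refl) (auto simp: merge_def)
      also have "\<dots> = g y * (\<integral>\<^sup>+z. (\<Prod>i\<in>{m..<m+j}. ennreal (w y (z i))) \<partial>(\<Pi>\<^sub>M i\<in>{m..<m+j}. N))"
      proof (intro nn_integral_cmult borel_measurable_prod_ennreal)
        fix i assume i: "i \<in> {m..<m+j}"
        have "w y \<in> borel_measurable N" using w_y[OF y'] by (simp add: measurable_cong_sets[OF sets_N refl])
        then have "(\<lambda>z. w y (z i)) \<in> borel_measurable (\<Pi>\<^sub>M i\<in>{m..<m+j}. N)"
          by (rule measurable_compose[OF measurable_component_singleton[OF i]])
        then show "(\<lambda>z. ennreal (w y (z i))) \<in> borel_measurable (\<Pi>\<^sub>M i\<in>{m..<m+j}. N)"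
          by simp
      qed
      also have "(\<integral>\<^sup>+z. (\<Prod>i\<in>{m..<m+j}. ennreal (w y (z i))) \<partial>(\<Pi>\<^sub>M i\<in>{m..<m+j}. N)) =
        (\<Prod>i\<in>{m..<m+j}. \<integral>\<^sup>+z. ennreal (w y z) \<partial>N)"
        using w_y[OF y'] by (intro N.product_nn_integral_prod) (auto simp: measurable_cong_sets[OF sets_N refl])
      also have "\<dots> = ennreal (W y ^ j)"
        using int_w[OF y'] w01 W0 by (simp add: W_def nn_integral_eq_integral ennreal_power)
      finally show "(\<integral>\<^sup>+z. G j (merge {..<m} {m..<m+j} (y, z)) \<partial>(\<Pi>\<^sub>M i\<in>{m..<m+j}. N)) = g y * ennreal (W y ^ j)" .
    qed
    finally show ?thesis .
  qed
  have "(\<integral>\<^sup>+\<omega>. (if finite (idx B \<omega>) then \<Sum>I | I \<subseteq> idx B \<omega> \<and> card I = m. F I \<omega> else 0) \<partial>M) =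
    (\<integral>\<^sup>+\<omega>. (\<Sum>j. ennreal (c j) * (\<Sum>\<iota>\<in>labellings (m + j) (idx B \<omega>). G j (\<lambda>i\<in>{..<m+j}. X (\<iota> i) \<omega>))) \<partial>M)"
    by (intro nn_integral_cong pointwise)
  also have "\<dots> = (\<Sum>j. ennreal (c j) * (\<integral>\<^sup>+\<omega>. (\<Sum>\<iota>\<in>labellings (m + j) (idx B \<omega>). G j (\<lambda>i\<in>{..<m+j}. X (\<iota> i) \<omega>)) \<partial>M))"
    by (subst nn_integral_suminf) (auto intro!: nn_integral_cmult suminf_cong)
  also have "\<dots> = (\<Sum>j. \<integral>\<^sup>+y. ennreal (c j * exp (- t * measure \<Lambda> B) * t ^ (m + j)) * (g y * ennreal (W y ^ j)) \<partial>(\<Pi>\<^sub>M i\<in>{..<m}. N))"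
  proof (rule suminf_cong)
    fix j
    let ?c = "exp (- t * measure \<Lambda> B) * t ^ (m + j)"
    have "ennreal (c j) * (\<integral>\<^sup>+\<omega>. (\<Sum>\<iota>\<in>labellings (m + j) (idx B \<omega>). G j (\<lambda>i\<in>{..<m+j}. X (\<iota> i) \<omega>)) \<partial>M) =
      ennreal (c j) * (ennreal ?c * (\<integral>\<^sup>+y. g y * ennreal (W y ^ j) \<partial>(\<Pi>\<^sub>M i\<in>{..<m}. N)))"
      by (simp only: nn_integral_labellings[OF B G_meas] int_G flip: N_def)
    also have "\<dots> = ennreal (c j * ?c) * (\<integral>\<^sup>+y. g y * ennreal (W y ^ j) \<partial>(\<Pi>\<^sub>M i\<in>{..<m}. N))"
      by (subst ennreal_mult') (simp_all only: mult.assoc, simp add: c_def)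
    also have "\<dots> = (\<integral>\<^sup>+y. ennreal (c j * ?c) * (g y * ennreal (W y ^ j)) \<partial>(\<Pi>\<^sub>M i\<in>{..<m}. N))"
      by (rule nn_integral_cmult[symmetric]) measurable
    finally show "ennreal (c j) * (\<integral>\<^sup>+\<omega>. (\<Sum>\<iota>\<in>labellings (m + j) (idx B \<omega>). G j (\<lambda>i\<in>{..<m+j}. X (\<iota> i) \<omega>)) \<partial>M) =
      (\<integral>\<^sup>+y. ennreal (c j * exp (- t * measure \<Lambda> B) * t ^ (m + j)) * (g y * ennreal (W y ^ j)) \<partial>(\<Pi>\<^sub>M i\<in>{..<m}. N))"
      by (simp only: mult.assoc)
  qed
  also have "\<dots> = (\<integral>\<^sup>+y. (\<Sum>j. ennreal (c j * exp (- t * measure \<Lambda> B) * t ^ (m + j)) * (g y * ennreal (W y ^ j))) \<partial>(\<Pi>\<^sub>M i\<in>{..<m}. N))"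
    by (subst nn_integral_suminf) auto
  also have "\<dots> = (\<integral>\<^sup>+y. ennreal (t ^ m / fact m) * (g y * ennreal (exp (- t * (\<integral>z. 1 - w y z \<partial>N)))) \<partial>(\<Pi>\<^sub>M i\<in>{..<m}. N))"
  proof (rule nn_integral_cong)
    fix y assume y: "y \<in> space (\<Pi>\<^sub>M i\<in>{..<m}. N)"
    then have y': "y \<in> space (\<Pi>\<^sub>M i\<in>{..<m}. borel)" by (simp add: space_PiM)
    have "(\<Sum>j. ennreal (c j * exp (- t * measure \<Lambda> B) * t ^ (m + j)) * (g y * ennreal (W y ^ j))) =
      (\<Sum>j. g y * ennreal ((t ^ m / fact m * exp (- t * measure \<Lambda> B)) * ((t * W y) ^ j / fact j)))"
    proof (rule suminf_cong)
      fix j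
      have "ennreal (c j * exp (- t * measure \<Lambda> B) * t ^ (m + j)) * (g y * ennreal (W y ^ j)) =
        g y * (ennreal (c j * exp (- t * measure \<Lambda> B) * t ^ (m + j)) * ennreal (W y ^ j))"
        by (simp add: ac_simps)
      also have "ennreal (c j * exp (- t * measure \<Lambda> B) * t ^ (m + j)) * ennreal (W y ^ j) =
        ennreal ((t ^ m / fact m * exp (- t * measure \<Lambda> B)) * ((t * W y) ^ j / fact j))"
        using t_pos W0[of y] by (subst ennreal_mult'[symmetric]) (auto simp: c_def power_add power_mult_distrib)
      finally show "ennreal (c j * exp (- t * measure \<Lambda> B) * t ^ (m + j)) * (g y * ennreal (W y ^ j)) =
        g y * ennreal ((t ^ m / fact m * exp (- t * measure \<Lambda> B)) * ((t * W y) ^ j / fact j))" .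
    qed
    also have "\<dots> = g y * (\<Sum>j. ennreal ((t ^ m / fact m * exp (- t * measure \<Lambda> B)) * ((t * W y) ^ j / fact j)))"
      by simp
    also have "(\<Sum>j. ennreal ((t ^ m / fact m * exp (- t * measure \<Lambda> B)) * ((t * W y) ^ j / fact j))) =
      ennreal ((t ^ m / fact m * exp (- t * measure \<Lambda> B)) * exp (t * W y))"
    proof (rule suminf_ennreal_eq)
      have "(\<lambda>j. (t * W y) ^ j / fact j) sums exp (t * W y)"
        using exp_converges[of "t * W y"] by (simp add: divide_inverse mult.commute)
      then show "(\<lambda>j. (t ^ m / fact m * exp (- t * measure \<Lambda> B)) * ((t * W y) ^ j / fact j)) sums
        ((t ^ m / fact m * exp (- t * measure \<Lambda> B)) * exp (t * W y))"
        by (rule sums_mult)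
    qed (use t_pos W0[of y] in auto)
    also have "(t ^ m / fact m * exp (- t * measure \<Lambda> B)) * exp (t * W y) =
        t ^ m / fact m * exp (- t * (\<integral>z. 1 - w y z \<partial>N))"
    proof -
      have I: "(\<integral>z. 1 - w y z \<partial>N) = measure \<Lambda> B - W y"
        using int_w[OF y'] by (simp add: W_def mN)
      have "- t * measure \<Lambda> B + t * W y = - t * (measure \<Lambda> B - W y)" by (simp add: algebra_simps)
      then show ?thesis unfolding I mult.assoc exp_add[symmetric] by simp
    qed
    finally have sum: "(\<Sum>j. ennreal (c j * exp (- t * measure \<Lambda> B) * t ^ (m + j)) * (g y * ennreal (W y ^ j))) =
      g y * ennreal (t ^ m / fact m * exp (- t * (\<integral>z. 1 - w y z \<partial>N)))" .
    show "(\<Sum>j. ennreal (c j * exp (- t * measure \<Lambda> B) * t ^ (m + j)) * (g y * ennreal (W y ^ j))) =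
      ennreal (t ^ m / fact m) * (g y * ennreal (exp (- t * (\<integral>z. 1 - w y z \<partial>N))))"
    proof -
      have "ennreal (t ^ m / fact m) * ennreal (exp (- t * (\<integral>z. 1 - w y z \<partial>N))) =
        ennreal (t ^ m / fact m * exp (- t * (\<integral>z. 1 - w y z \<partial>N)))"
        using t_pos by (intro ennreal_mult'[symmetric]) auto
      then have "ennreal (t ^ m / fact m) * (g y * ennreal (exp (- t * (\<integral>z. 1 - w y z \<partial>N)))) =
        g y * ennreal (t ^ m / fact m * exp (- t * (\<integral>z. 1 - w y z \<partial>N)))"
        by (simp only: mult.left_commute[of _ "g y"])
      with sum show ?thesis by (simp only:)
    qed
  qed
  also have "\<dots> = ennreal (t ^ m / fact m) * (\<integral>\<^sup>+y. g y * ennreal (exp (- t * (\<integral>z. 1 - w y z \<partial>N))) \<partial>(\<Pi>\<^sub>M i\<in>{..<m}. N))"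
  proof (rule nn_integral_cmult)
    have [measurable]: "(\<lambda>(y, z). w y z) \<in> borel_measurable ((\<Pi>\<^sub>M j\<in>{..<m}. borel) \<Otimes>\<^sub>M N)"
      using w by (simp cong: measurable_cong_sets sets_pair_measure_cong add: sets_N)
    show "(\<lambda>y. g y * ennreal (exp (- t * (\<integral>z. 1 - w y z \<partial>N)))) \<in> borel_measurable (\<Pi>\<^sub>M i\<in>{..<m}. N)"
      by measurable
  qed
  finally show ?thesis unfolding F_def N_def .
qed

end

section \<open>Connectedness of finite random graphs\<close>

definition edge_pairs :: "'i set \<Rightarrow> 'i set set" where
  "edge_pairs V = {{i, j} | i j. i \<in> V \<and> j \<in> V \<and> i \<noteq> j}"

text \<open>Edges are unordered pairs. If \<open>\<phi>\<close> is symmetric, the set on the right-hand side has only one element.\<close>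

definition edge_prob :: "('a \<Rightarrow> 'a \<Rightarrow> real) \<Rightarrow> 'a set \<Rightarrow> real" where
  "edge_prob \<phi> e = the_elem {\<phi> a b | a b. e = {a, b}}"

text \<open>If vertex \<open>i\<close> sits at \<open>x i\<close>, this is the probability that all vertices in \<open>V\<close> are connected to \<open>r\<close> by
edges within \<open>V\<close>: the sum runs over the connected graphs \<open>H\<close> on \<open>V\<close>.\<close>

definition conn_prob :: "('a \<Rightarrow> 'a \<Rightarrow> real) \<Rightarrow> 'i set \<Rightarrow> 'i \<Rightarrow> ('i \<Rightarrow> 'a) \<Rightarrow> real" where
  "conn_prob \<phi> V r x = (\<Sum>H | H \<subseteq> edge_pairs V \<and> component H r = V.
     (\<Prod>e\<in>H. edge_prob \<phi> (x ` e)) * (\<Prod>e\<in>edge_pairs V - H. 1 - edge_prob \<phi> (x ` e)))"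

text \<open>The probability that a point at \<open>z\<close> is not joined to any vertex in \<open>V\<close>.\<close>

definition avoid_prob :: "('a \<Rightarrow> 'a \<Rightarrow> real) \<Rightarrow> 'i set \<Rightarrow> ('i \<Rightarrow> 'a) \<Rightarrow> 'a \<Rightarrow> real" where
  "avoid_prob \<phi> V x z = (\<Prod>i\<in>V. 1 - \<phi> z (x i))"

lemma edge_prob_doubleton:
  assumes "\<And>x y. \<phi> x y = \<phi> y x"
  shows "edge_prob \<phi> {a, b} = \<phi> a b"
proof -
  have "{\<phi> a' b' | a' b'. {a, b} = {a', b'}} = {\<phi> a b}"
    using assms by (auto simp: doubleton_eq_iff)
  then show ?thesis by (simp add: edge_prob_def)
qed

lemma finite_edge_pairs [simp]: "finite V \<Longrightarrow> finite (edge_pairs V)"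
  by (rule finite_subset[of _ "Pow V"]) (auto simp: edge_pairs_def)

lemma root_in_component [simp]: "r \<in> component H r"
  by (simp add: component_def)

lemma component_step: "u \<in> component H r \<Longrightarrow> {u, w} \<in> H \<Longrightarrow> w \<in> component H r"
  unfolding component_def by (auto intro: rtrancl_into_rtrancl)

lemma component_least:
  assumes "r \<in> S" "\<And>u w. u \<in> S \<Longrightarrow> {u, w} \<in> H \<Longrightarrow> w \<in> S"
  shows "component H r \<subseteq> S"
proof
  fix w assume "w \<in> component H r"
  then have "(r, w) \<in> {(x, y). {x, y} \<in> H}\<^sup>*" by (simp add: component_def)
  then show "w \<in> S" by (induction rule: rtrancl_induct) (use assms in auto)
qed

lemma component_image:
  assumes inj: "inj_on f V" and H: "H \<subseteq> edge_pairs V" and r: "r \<in> V"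
  shows "component ((`) f ` H) (f r) = f ` component H r"
proof
  have sub: "component H r \<subseteq> V"
    using H r by (intro component_least) (auto simp: edge_pairs_def doubleton_eq_iff dest!: subsetD)
  show "component ((`) f ` H) (f r) \<subseteq> f ` component H r"
  proof (rule component_least)
    fix u w assume u: "u \<in> f ` component H r" and "{u, w} \<in> (`) f ` H"
    then obtain e where e: "e \<in> H" "{u, w} = f ` e" by auto
    then obtain a b where ab: "e = {a, b}" "a \<in> V" "b \<in> V" using H by (auto simp: edge_pairs_def)
    obtain a' where a': "a' \<in> component H r" "u = f a'" using u by auto
    have "a' \<in> V" using a' sub by auto
    from e(2) ab have "u = f a \<and> w = f b \<or> u = f b \<and> w = f a" by (auto simp: doubleton_eq_iff)
    then obtain c where c: "e = {a', c}" "w = f c"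
    proof
      assume "u = f a \<and> w = f b"
      then have "a = a'" using inj a' ab \<open>a' \<in> V\<close> by (auto dest: inj_onD)
      then show thesis using that[of b] ab \<open>u = f a \<and> w = f b\<close> by auto
    next
      assume "u = f b \<and> w = f a"
      then have "b = a'" using inj a' ab \<open>a' \<in> V\<close> by (auto dest: inj_onD)
      then show thesis using that[of a] ab \<open>u = f b \<and> w = f a\<close> by auto
    qed
    then show "w \<in> f ` component H r" using a' e component_step[of a' H r c] by auto
  qed auto
  have "component H r \<subseteq> {u. f u \<in> component ((`) f ` H) (f r)}"
  proof (rule component_least)
    fix u w assume u: "u \<in> {u. f u \<in> component ((`) f ` H) (f r)}" and uw: "{u, w} \<in> H"
    have "f ` {u, w} \<in> (`) f ` H" using uw by (rule imageI)
    then show "w \<in> {u. f u \<in> component ((`) f ` H) (f r)}"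
      using u component_step[of "f u" "(`) f ` H" "f r" "f w"] by auto
  qed auto
  then show "f ` component H r \<subseteq> component ((`) f ` H) (f r)" by auto
qed

lemma edge_pairs_image:
  assumes "inj_on f V"
  shows "edge_pairs (f ` V) = (`) f ` edge_pairs V"
proof (intro equalityI subsetI)
  fix e assume "e \<in> edge_pairs (f ` V)"
  then obtain i j where "i \<in> V" "j \<in> V" "f i \<noteq> f j" "e = f ` {i, j}" by (auto simp: edge_pairs_def)
  then show "e \<in> (`) f ` edge_pairs V" by (auto simp: edge_pairs_def intro!: imageI)
next
  fix e assume "e \<in> (`) f ` edge_pairs V"
  then obtain i j where "i \<in> V" "j \<in> V" "i \<noteq> j" "e = {f i, f j}" by (auto simp: edge_pairs_def)
  then show "e \<in> edge_pairs (f ` V)" using assms by (auto simp: edge_pairs_def inj_on_def)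
qed

text \<open>The indices of the points in the cluster are random. This lemma and the next replace them by fixed
ones.\<close>

lemma conn_prob_reindex:
  assumes inj: "inj_on f V" and r: "r \<in> V"
  shows "conn_prob \<phi> (f ` V) (f r) x = conn_prob \<phi> V r (x \<circ> f)"
proof -
  have inj1: "inj_on ((`) f) (edge_pairs V)"
    by (rule inj_on_subset[OF inj_on_image_Pow[OF inj]]) (auto simp: edge_pairs_def)
  have inj2: "inj_on ((`) ((`) f)) (Pow (edge_pairs V))"
    by (rule inj_on_image_Pow[OF inj1])
  have img: "{H. H \<subseteq> edge_pairs (f ` V) \<and> component H (f r) = f ` V} =
    (`) ((`) f) ` {H. H \<subseteq> edge_pairs V \<and> component H r = V}" (is "?L = ?R")
  proof (intro equalityI subsetI)
    fix H assume "H \<in> ?L"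
    then obtain H' where H': "H' \<subseteq> edge_pairs V" "H = (`) f ` H'" "component H (f r) = f ` V"
      by (auto simp: edge_pairs_image[OF inj] subset_image_iff)
    then have "f ` component H' r = f ` V" using component_image[OF inj H'(1) r] by simp
    moreover have "component H' r \<subseteq> V"
      using H' r by (intro component_least) (auto simp: edge_pairs_def doubleton_eq_iff dest!: subsetD)
    ultimately have "component H' r = V" using inj by (simp add: inj_on_image_eq_iff)
    then show "H \<in> ?R" using H' by auto
  next
    fix H assume "H \<in> ?R"
    then obtain H' where H': "H' \<subseteq> edge_pairs V" "H = (`) f ` H'" "component H' r = V" by auto
    then show "H \<in> ?L" using component_image[OF inj H'(1) r] by (auto simp: edge_pairs_image[OF inj])
  qed
  have "conn_prob \<phi> (f ` V) (f r) x =
    (\<Sum>H | H \<subseteq> edge_pairs V \<and> component H r = V.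
     (\<Prod>e\<in>(`) f ` H. edge_prob \<phi> (x ` e)) * (\<Prod>e\<in>edge_pairs (f ` V) - (`) f ` H. 1 - edge_prob \<phi> (x ` e)))"
    unfolding conn_prob_def img
    by (subst sum.reindex[OF inj_on_subset[OF inj2]]) (auto simp: comp_def)
  also have "\<dots> = conn_prob \<phi> V r (x \<circ> f)"
    unfolding conn_prob_def
  proof (intro sum.cong refl arg_cong2[where f="(*)"])
    fix H assume "H \<in> {H. H \<subseteq> edge_pairs V \<and> component H r = V}"
    then have H: "H \<subseteq> edge_pairs V" by auto
    show "(\<Prod>e\<in>(`) f ` H. edge_prob \<phi> (x ` e)) = (\<Prod>e\<in>H. edge_prob \<phi> ((x \<circ> f) ` e))"
      by (subst prod.reindex[OF inj_on_subset[OF inj1 H]]) (simp add: image_comp comp_def)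
    have "edge_pairs (f ` V) - (`) f ` H = (`) f ` (edge_pairs V - H)"
      unfolding edge_pairs_image[OF inj] using inj1 H by (intro inj_on_image_set_diff[symmetric]) auto
    then show "(\<Prod>e\<in>edge_pairs (f ` V) - (`) f ` H. 1 - edge_prob \<phi> (x ` e)) =
      (\<Prod>e\<in>edge_pairs V - H. 1 - edge_prob \<phi> ((x \<circ> f) ` e))"
      by (simp only: prod.reindex[OF inj_on_subset[OF inj1 Diff_subset]] comp_def image_image)
  qed
  finally show ?thesis .
qed

lemma avoid_prob_reindex:
  assumes "inj_on f V"
  shows "avoid_prob \<phi> (f ` V) x z = avoid_prob \<phi> V (x \<circ> f) z"
  using assms by (simp add: avoid_prob_def prod.reindex)

section \<open>Edges given the vertices\<close>

locale rcm_graph = poisson_points M \<Lambda> t \<eta> v K X for M :: "'w measure" and \<Lambda> :: "'a :: polish_space measure"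
    and t \<eta> v K X +
  fixes \<phi> :: "'a \<Rightarrow> 'a \<Rightarrow> real" and E :: "'w \<Rightarrow> 'a set set"
  assumes phi_measurable: "(\<lambda>(x, y). \<phi> x y) \<in> borel_measurable (borel \<Otimes>\<^sub>M borel)"
    and phi_range: "\<And>x y. \<phi> x y \<in> {0..1}"
    and phi_sym: "\<And>x y. \<phi> x y = \<phi> y x"
    and edges_subset: "\<And>\<omega>. \<omega> \<in> space M \<Longrightarrow>
      E \<omega> \<subseteq> {{x, y} | x y. x \<in> insert v (\<eta> \<omega>) \<and> y \<in> insert v (\<eta> \<omega>) \<and> x \<noteq> y}"
    and edges_indep: "conditionally_independent_edges M \<phi> E K X"
begin

abbreviation "\<F> \<equiv> vertex_algebra M K X"

text \<open>The random graph transported to the indices of the vertices. A possible cluster is then a deterministic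
set of indices, and there are only countably many finite ones.\<close>

definition iedges :: "'w \<Rightarrow> nat set set" where
  "iedges \<omega> = {{i, j} | i j. i < j \<and> enat j < K \<omega> \<and> {X i \<omega>, X j \<omega>} \<in> E \<omega>}"

lemma edge_prob_pair [simp]: "edge_prob \<phi> {a, b} = \<phi> a b"
  by (rule edge_prob_doubleton[OF phi_sym])

lemma phi_measurable' [measurable]:
  assumes [measurable]: "f \<in> N \<rightarrow>\<^sub>M borel" "g \<in> N \<rightarrow>\<^sub>M borel"
  shows "(\<lambda>x. \<phi> (f x) (g x)) \<in> borel_measurable N"
  using measurable_compose[OF measurable_Pair[OF assms] phi_measurable] by simp

lemma KX_measurable: "(\<lambda>\<omega>. (K \<omega>, \<lambda>i. X i \<omega>)) \<in> M \<rightarrow>\<^sub>M (count_space UNIV \<Otimes>\<^sub>M (\<Pi>\<^sub>M i\<in>UNIV. borel))"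
  by (intro measurable_Pair K_measurable measurable_abs_UNIV X_measurable)

lemma space_F [simp]: "space \<F> = space M"
  by (simp add: vertex_algebra_def)

lemma subalgebra_F: "subalgebra M \<F>"
  unfolding subalgebra_def space_F vertex_algebra_def
  using measurable_sets[OF KX_measurable]
  by (auto simp: sets_vimage_algebra2 space_pair_measure space_PiM)

lemma sets_F_M: "A \<in> sets \<F> \<Longrightarrow> A \<in> sets M"
  using subalgebra_F by (auto simp: subalgebra_def)

lemma KX_measurable_F: "(\<lambda>\<omega>. (K \<omega>, \<lambda>i. X i \<omega>)) \<in> \<F> \<rightarrow>\<^sub>M (count_space UNIV \<Otimes>\<^sub>M (\<Pi>\<^sub>M i\<in>UNIV. borel))"
  unfolding vertex_algebra_def by (rule measurable_vimage_algebra1) (auto simp: space_pair_measure space_PiM)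

lemma K_measurable_F [measurable]: "K \<in> \<F> \<rightarrow>\<^sub>M count_space UNIV"
  using measurable_compose[OF KX_measurable_F measurable_fst] by simp

lemma X_measurable_F [measurable]: "X i \<in> \<F> \<rightarrow>\<^sub>M borel"
  using measurable_compose[OF measurable_compose[OF KX_measurable_F measurable_snd] measurable_component_singleton[of i]]
  by simp

lemma doubleton_cases:
  assumes "e \<in> edge_pairs (UNIV :: nat set)"
  obtains i j where "i < j" "e = {i, j}"
proof -
  obtain i j where "i \<noteq> j" "e = {i, j}" using assms by (auto simp: edge_pairs_def)
  then show thesis using that[of i j] that[of j i] by (cases "i < j") (auto simp: insert_commute)
qed

lemma iedges_iff: "i < j \<Longrightarrow> {i, j} \<in> iedges \<omega> \<longleftrightarrow> enat j < K \<omega> \<and> {X i \<omega>, X j \<omega>} \<in> E \<omega>"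
  by (auto simp: iedges_def doubleton_eq_iff)

lemma iedges_measurable [measurable]: "Measurable.pred M (\<lambda>\<omega>. e \<in> iedges \<omega>)"
proof (cases "e \<in> edge_pairs UNIV")
  case True
  then obtain i j where ij: "i < j" "e = {i, j}" by (rule doubleton_cases)
  then have "{\<omega> \<in> space M. enat j < K \<omega> \<and> {X i \<omega>, X j \<omega>} \<in> E \<omega>} \<in> sets M"
    using edges_indep by (auto simp: conditionally_independent_edges_def)
  then show ?thesis using ij by (simp add: iedges_iff pred_def)
next
  case False
  then have "e \<notin> iedges \<omega>" for \<omega> by (auto simp: iedges_def edge_pairs_def)
  then show ?thesis by simp
qed

lemma edge_prob_measurable [measurable]:
  assumes "e \<in> edge_pairs UNIV"
  shows "(\<lambda>\<omega>. edge_prob \<phi> (pos \<omega> ` e)) \<in> borel_measurable M"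
proof -
  obtain i j where "e = {i, j}" using assms by (auto simp: edge_pairs_def)
  then show ?thesis by simp
qed

lemma edge_prob_range:
  assumes "e \<in> edge_pairs UNIV"
  shows "edge_prob \<phi> (pos \<omega> ` e) \<in> {0..1}"
proof -
  obtain i j where "e = {i, j}" using assms by (auto simp: edge_pairs_def)
  then show ?thesis using phi_range[of "X i \<omega>" "X j \<omega>"] by simp
qed

text \<open>This is the conditional independence of the edges, integrated over an event \<open>W\<close> that is determined by
the vertices and on which the vertices in question exist.\<close>

lemma prob_edges_present:
  assumes S: "finite S" "S \<subseteq> edge_pairs UNIV" and W: "W \<in> sets \<F>"
    and WK: "\<And>\<omega> i. \<omega> \<in> W \<Longrightarrow> i \<in> \<Union>S \<Longrightarrow> enat i < K \<omega>"
  shows "prob (W \<inter> {\<omega>\<in>space M. S \<subseteq> iedges \<omega>}) =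
    (\<integral>\<omega>. indicator W \<omega> * (\<Prod>e\<in>S. edge_prob \<phi> (pos \<omega> ` e)) \<partial>M)"
proof -
  define S' where "S' = {(i, j). i < j \<and> {i, j} \<in> S}"
  have bij: "bij_betw (\<lambda>(i, j). {i, j}) S' S"
  proof (rule bij_betwI')
    show "\<And>x y. x \<in> S' \<Longrightarrow> y \<in> S' \<Longrightarrow> ((case x of (i, j) \<Rightarrow> {i, j}) = (case y of (i, j) \<Rightarrow> {i, j})) = (x = y)"
      by (auto simp: S'_def doubleton_eq_iff)
    show "\<And>x. x \<in> S' \<Longrightarrow> (case x of (i, j) \<Rightarrow> {i, j}) \<in> S" by (auto simp: S'_def)
    fix e assume e: "e \<in> S"
    then obtain i j where "i < j" "e = {i, j}" using S doubleton_cases by blast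
    then show "\<exists>x\<in>S'. e = (case x of (i, j) \<Rightarrow> {i, j})" using e by (auto simp: S'_def intro!: bexI[of _ "(i, j)"])
  qed
  have S': "finite S'" "S' \<subseteq> {(i, j). i < j}" using bij S bij_betw_finite by (auto simp: S'_def)
  have S_img: "S = (\<lambda>(i, j). {i, j}) ` S'" using bij by (simp add: bij_betw_def)
  define A where "A = {\<omega> \<in> space M. \<forall>(i, j) \<in> S'. enat j < K \<omega> \<and> {X i \<omega>, X j \<omega>} \<in> E \<omega>}"
  have A: "A = {\<omega>\<in>space M. S \<subseteq> iedges \<omega>}"
  proof -
    have "(case p of (i, j) \<Rightarrow> {i, j}) \<in> iedges \<omega> \<longleftrightarrow>
        (case p of (i, j) \<Rightarrow> enat j < K \<omega> \<and> {X i \<omega>, X j \<omega>} \<in> E \<omega>)" if "p \<in> S'" for p \<omega>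
      using that S'(2) by (auto simp: iedges_iff)
    then show ?thesis unfolding A_def S_img image_subset_iff by blast
  qed
  have A_meas [measurable]: "A \<in> sets M"
  proof -
    have "A = {\<omega>\<in>space M. \<forall>e\<in>S. e \<in> iedges \<omega>}" using A by auto
    then show ?thesis using S(1) by simp
  qed
  note W_M [measurable] = sets_F_M[OF W]
  interpret sigma_finite_subalgebra M \<F>
    by (rule finite_measure_subalgebra_is_sigma_finite) (unfold_locales, rule subalgebra_F)
  have ae: "AE \<omega> in M. real_cond_exp M \<F> (indicator A) \<omega>
          = (if \<forall>(i, j) \<in> S'. enat j < K \<omega> then \<Prod>(i, j) \<in> S'. \<phi> (X i \<omega>) (X j \<omega>) else 0)"
    using edges_indep S' unfolding conditionally_independent_edges_def A_def by blast
  have "prob (W \<inter> A) = (\<integral>\<omega>\<in>W. indicator A \<omega> \<partial>M)"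
    by (simp add: set_lebesgue_integral_def flip: indicator_inter_arith)
  also have "\<dots> = (\<integral>\<omega>\<in>W. real_cond_exp M \<F> (indicator A) \<omega> \<partial>M)"
    using W by (intro real_cond_exp_intA) (auto intro!: integrable_real_indicator simp: emeasure_eq_measure)
  also have "\<dots> = (\<integral>\<omega>. indicator W \<omega> * (\<Prod>e\<in>S. edge_prob \<phi> (pos \<omega> ` e)) \<partial>M)"
    unfolding set_lebesgue_integral_def
  proof (rule integral_cong_AE)
    show "AE \<omega> in M. indicator W \<omega> *\<^sub>R real_cond_exp M \<F> (indicator A) \<omega> =
      indicator W \<omega> * (\<Prod>e\<in>S. edge_prob \<phi> (pos \<omega> ` e))"
      using ae
    proof eventually_elim
      fix \<omega> assume *: "real_cond_exp M \<F> (indicator A) \<omega>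
          = (if \<forall>(i, j) \<in> S'. enat j < K \<omega> then \<Prod>(i, j) \<in> S'. \<phi> (X i \<omega>) (X j \<omega>) else 0)"
      have "(\<Prod>e\<in>S. edge_prob \<phi> (pos \<omega> ` e)) = (\<Prod>(i, j) \<in> S'. \<phi> (X i \<omega>) (X j \<omega>))"
        by (subst prod.reindex_bij_betw[OF bij, symmetric]) (auto intro!: prod.cong)
      moreover have "\<forall>(i, j) \<in> S'. enat j < K \<omega>" if "\<omega> \<in> W"
        using WK[OF that] unfolding S_img by auto
      ultimately show "indicator W \<omega> *\<^sub>R real_cond_exp M \<F> (indicator A) \<omega> =
        indicator W \<omega> * (\<Prod>e\<in>S. edge_prob \<phi> (pos \<omega> ` e))"
        unfolding * real_scaleR_def by (cases "\<omega> \<in> W") simp_all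
    qed
    have [measurable]: "(\<lambda>\<omega>. edge_prob \<phi> (pos \<omega> ` e)) \<in> borel_measurable M" if "e \<in> S" for e
      using S that by (intro edge_prob_measurable) auto
    show "(\<lambda>\<omega>. indicator W \<omega> * (\<Prod>e\<in>S. edge_prob \<phi> (pos \<omega> ` e))) \<in> borel_measurable M"
      by measurable
    show "(\<lambda>\<omega>. indicator W \<omega> *\<^sub>R real_cond_exp M \<F> (indicator A) \<omega>) \<in> borel_measurable M"
      by simp
  qed
  finally show ?thesis by (simp add: A)
qed

text \<open>Forbidding one more edge \<open>e\<close> means to subtract the event that \<open>e\<close> is present, and the expectations
differ in the same way.\<close>

lemma prob_edges:
  assumes T: "finite T" "T \<subseteq> edge_pairs UNIV" and S: "finite S" "S \<subseteq> edge_pairs UNIV" and "S \<inter> T = {}"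
    and W: "W \<in> sets \<F>"
    and WK: "\<And>\<omega> i. \<omega> \<in> W \<Longrightarrow> i \<in> \<Union>(S \<union> T) \<Longrightarrow> enat i < K \<omega>"
  shows "prob (W \<inter> {\<omega>\<in>space M. S \<subseteq> iedges \<omega> \<and> T \<inter> iedges \<omega> = {}}) =
    (\<integral>\<omega>. indicator W \<omega> * ((\<Prod>e\<in>S. edge_prob \<phi> (pos \<omega> ` e)) *
      (\<Prod>e\<in>T. 1 - edge_prob \<phi> (pos \<omega> ` e))) \<partial>M)"
  using T S \<open>S \<inter> T = {}\<close> WK
proof (induction T arbitrary: S rule: finite_induct)
  case empty
  then show ?case using prob_edges_present[OF empty(2,3) W] by simp
next
  case (insert e T)
  note W_M [measurable] = sets_F_M[OF W]
  define A where "A S = W \<inter> {\<omega>\<in>space M. S \<subseteq> iedges \<omega> \<and> T \<inter> iedges \<omega> = {}}" for S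
  have A_meas: "A S \<in> sets M" if "finite S" for S
  proof -
    have "A S = W \<inter> {\<omega>\<in>space M. (\<forall>e\<in>S. e \<in> iedges \<omega>) \<and> (\<forall>e\<in>T. e \<notin> iedges \<omega>)}"
      by (auto simp: A_def)
    also have "\<dots> \<in> sets M" using that insert(1) by measurable
    finally show ?thesis .
  qed
  define h where "h S T \<omega> = indicator W \<omega> * ((\<Prod>e\<in>S. edge_prob \<phi> (pos \<omega> ` e)) *
      (\<Prod>e\<in>T. 1 - edge_prob \<phi> (pos \<omega> ` e)))" for S T \<omega>
  have integrable_h: "integrable M (h S T)" if "S \<subseteq> edge_pairs UNIV" "T \<subseteq> edge_pairs UNIV" for S T
  proof (rule integrable_const_bound[where B=1])
    have r: "0 \<le> edge_prob \<phi> (pos \<omega> ` e)" "edge_prob \<phi> (pos \<omega> ` e) \<le> 1" if "e \<in> edge_pairs UNIV" for e \<omega>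
      using edge_prob_range[OF that, of \<omega>] by auto
    have "0 \<le> h S T \<omega>" "h S T \<omega> \<le> 1" for \<omega>
      using that r unfolding h_def
      by (auto intro!: mult_nonneg_nonneg prod_nonneg mult_le_one prod_le_1 split: split_indicator simp: subset_iff)
    then show "AE \<omega> in M. norm (h S T \<omega>) \<le> 1" by auto
    show "h S T \<in> borel_measurable M"
      unfolding h_def using that
      by (auto intro!: borel_measurable_times borel_measurable_prod borel_measurable_diff edge_prob_measurable)
  qed
  have "W \<inter> {\<omega>\<in>space M. S \<subseteq> iedges \<omega> \<and> insert e T \<inter> iedges \<omega> = {}} = A S - A (insert e S)"
    by (auto simp: A_def)
  also have "prob \<dots> = prob (A S) - prob (A (insert e S))"
    using insert.prems(2) by (intro finite_measure_Diff A_meas) (auto simp: A_def)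
  also have "prob (A S) = (\<integral>\<omega>. h S T \<omega> \<partial>M)"
    unfolding A_def h_def using insert.prems by (intro insert.IH) auto
  also have "prob (A (insert e S)) = (\<integral>\<omega>. h (insert e S) T \<omega> \<partial>M)"
    unfolding A_def h_def using insert.prems insert.hyps by (intro insert.IH) auto
  also have "(\<integral>\<omega>. h S T \<omega> \<partial>M) - (\<integral>\<omega>. h (insert e S) T \<omega> \<partial>M) = (\<integral>\<omega>. h S T \<omega> - h (insert e S) T \<omega> \<partial>M)"
    using insert.prems by (intro Bochner_Integration.integral_diff[symmetric] integrable_h) auto
  also have "\<dots> = (\<integral>\<omega>. h S (insert e T) \<omega> \<partial>M)"
  proof (rule Bochner_Integration.integral_cong[OF refl])
    fix \<omega>
    have "e \<notin> S" using insert.prems by auto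
    then show "h S T \<omega> - h (insert e S) T \<omega> = h S (insert e T) \<omega>"
      using insert.prems(2) insert.hyps by (simp add: h_def algebra_simps)
  qed
  finally show ?case by (simp add: h_def)
qed

text \<open>When only the vertices in \<open>V\<close> and \<open>J\<close> are considered, \<open>V\<close> is the cluster of \<open>r\<close>.\<close>

definition cluster_event :: "nat set \<Rightarrow> nat \<Rightarrow> nat set \<Rightarrow> 'w set" where
  "cluster_event V r J = {\<omega>\<in>space M. component (iedges \<omega> \<inter> edge_pairs V) r = V \<and>
     (\<forall>i\<in>V. \<forall>j\<in>J. {i, j} \<notin> iedges \<omega>)}"

lemma cluster_event_UN:
  assumes "finite V" "V \<inter> J = {}"
  shows "cluster_event V r J = (\<Union>H\<in>{H. H \<subseteq> edge_pairs V \<and> component H r = V}.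
    {\<omega>\<in>space M. H \<subseteq> iedges \<omega> \<and> (edge_pairs V - H \<union> (\<lambda>(i, j). {i, j}) ` (V \<times> J)) \<inter> iedges \<omega> = {}})"
    (is "?L = ?R")
proof (intro equalityI subsetI)
  fix \<omega> assume "\<omega> \<in> ?L"
  then show "\<omega> \<in> ?R"
    by (intro UN_I[of "iedges \<omega> \<inter> edge_pairs V"]) (auto simp: cluster_event_def)
next
  fix \<omega> assume "\<omega> \<in> ?R"
  then obtain H where H: "H \<subseteq> edge_pairs V" "component H r = V" "\<omega> \<in> space M" "H \<subseteq> iedges \<omega>"
    "(edge_pairs V - H \<union> (\<lambda>(i, j). {i, j}) ` (V \<times> J)) \<inter> iedges \<omega> = {}" by auto
  have "iedges \<omega> \<inter> edge_pairs V = H" using H by auto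
  then show "\<omega> \<in> ?L" using H by (fastforce simp: cluster_event_def)
qed

text \<open>The event splits according to the graph \<open>H\<close> that the edges form on \<open>V\<close>. Each part prescribes the state
of every pair within \<open>V\<close> and of every pair between \<open>V\<close> and \<open>J\<close>, and these are different pairs.\<close>

lemma prob_cluster_event:
  assumes V: "finite V" and J: "finite J" and VJ: "V \<inter> J = {}" and W: "W \<in> sets \<F>"
    and WK: "\<And>\<omega> i. \<omega> \<in> W \<Longrightarrow> i \<in> V \<union> J \<Longrightarrow> enat i < K \<omega>"
  shows "prob (W \<inter> cluster_event V r J) =
    (\<integral>\<omega>. indicator W \<omega> * (conn_prob \<phi> V r (pos \<omega>) *
      (\<Prod>j\<in>J. avoid_prob \<phi> V (pos \<omega>) (X j \<omega>))) \<partial>M)"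
proof -
  note W_M [measurable] = sets_F_M[OF W]
  define cross where "cross = (\<lambda>(i, j). {i, j}) ` (V \<times> J)"
  define \<H> where "\<H> = {H. H \<subseteq> edge_pairs V \<and> component H r = V}"
  have fin\<H>: "finite \<H>" using V by (auto simp: \<H>_def)
  define A where "A H = W \<inter> {\<omega>\<in>space M. H \<subseteq> iedges \<omega> \<and> (edge_pairs V - H \<union> cross) \<inter> iedges \<omega> = {}}" for H
  have cross: "finite cross" "cross \<subseteq> edge_pairs UNIV" "cross \<inter> edge_pairs V = {}"
  proof -
    show "finite cross" using V J by (simp add: cross_def)
    show "cross \<subseteq> edge_pairs UNIV"
    proof
      fix e assume "e \<in> cross"
      then obtain i j where "i \<in> V" "j \<in> J" "e = {i, j}" by (auto simp: cross_def)
      moreover from this have "i \<noteq> j" using VJ by auto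
      ultimately show "e \<in> edge_pairs UNIV" by (auto simp: edge_pairs_def)
    qed
    show "cross \<inter> edge_pairs V = {}"
      using VJ by (auto simp: cross_def edge_pairs_def doubleton_eq_iff)
  qed
  have pairs: "edge_pairs V \<subseteq> edge_pairs UNIV" "\<Union>(edge_pairs V) \<subseteq> V" by (auto simp: edge_pairs_def)
  have inj: "inj_on (\<lambda>(i, j). {i, j}) (V \<times> J)" using VJ by (auto simp: inj_on_def doubleton_eq_iff)
  have prod_cross: "(\<Prod>e\<in>cross. 1 - edge_prob \<phi> (pos \<omega> ` e)) =
    (\<Prod>j\<in>J. avoid_prob \<phi> V (pos \<omega>) (X j \<omega>))" for \<omega>
  proof -
    have "(\<Prod>e\<in>cross. 1 - edge_prob \<phi> (pos \<omega> ` e)) = (\<Prod>(i, j)\<in>V \<times> J. 1 - \<phi> (X j \<omega>) (X i \<omega>))"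
      unfolding cross_def by (subst prod.reindex[OF inj]) (rule prod.cong[OF refl], clarsimp, rule phi_sym)
    also have "\<dots> = (\<Prod>i\<in>V. \<Prod>j\<in>J. 1 - \<phi> (X j \<omega>) (X i \<omega>))"
      by (simp add: prod.cartesian_product)
    also have "\<dots> = (\<Prod>j\<in>J. avoid_prob \<phi> V (pos \<omega>) (X j \<omega>))"
      unfolding avoid_prob_def by (rule prod.swap)
    finally show ?thesis .
  qed
  have A_meas: "A H \<in> sets M" if "H \<in> \<H>" for H
  proof -
    have "finite H" using that V finite_subset[of H "edge_pairs V"] by (auto simp: \<H>_def)
    moreover have "A H = W \<inter> {\<omega>\<in>space M. (\<forall>e\<in>H. e \<in> iedges \<omega>) \<and> (\<forall>e\<in>edge_pairs V - H \<union> cross. e \<notin> iedges \<omega>)}"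
      by (auto simp: A_def)
    moreover have "finite (edge_pairs V - H \<union> cross)" using V cross by auto
    ultimately show ?thesis by simp
  qed
  have disj: "disjoint_family_on A \<H>"
    by (auto simp: disjoint_family_on_def A_def \<H>_def)
  define h where "h H \<omega> = indicator W \<omega> * ((\<Prod>e\<in>H. edge_prob \<phi> (pos \<omega> ` e)) *
      (\<Prod>e\<in>edge_pairs V - H \<union> cross. 1 - edge_prob \<phi> (pos \<omega> ` e)))" for H \<omega>
  have h: "h H \<omega> = indicator W \<omega> * ((\<Prod>e\<in>H. edge_prob \<phi> (pos \<omega> ` e)) *
      (\<Prod>e\<in>edge_pairs V - H. 1 - edge_prob \<phi> (pos \<omega> ` e)) *
      (\<Prod>j\<in>J. avoid_prob \<phi> V (pos \<omega>) (X j \<omega>)))" for H \<omega>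
    unfolding h_def prod_cross[symmetric] using V cross by (subst prod.union_disjoint) (auto simp: mult.assoc)
  have int_h: "integrable M (h H)" if "H \<in> \<H>" for H
  proof (rule integrable_const_bound[where B=1])
    have HV: "H \<subseteq> edge_pairs V" using that by (auto simp: \<H>_def)
    have r: "0 \<le> edge_prob \<phi> (pos \<omega> ` e)" "edge_prob \<phi> (pos \<omega> ` e) \<le> 1" if "e \<in> edge_pairs UNIV" for e \<omega>
      using edge_prob_range[OF that, of \<omega>] by auto
    have "0 \<le> h H \<omega>" "h H \<omega> \<le> 1" for \<omega>
      using HV pairs cross r unfolding h_def
      by (auto intro!: mult_nonneg_nonneg prod_nonneg mult_le_one prod_le_1 split: split_indicator simp: subset_iff)
    then show "AE \<omega> in M. norm (h H \<omega>) \<le> 1" by auto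
    show "h H \<in> borel_measurable M"
      unfolding h_def using HV pairs cross
      by (intro borel_measurable_times borel_measurable_prod borel_measurable_diff edge_prob_measurable
            borel_measurable_indicator borel_measurable_const W_M) auto
  qed
  have "W \<inter> cluster_event V r J = (\<Union>H\<in>\<H>. A H)"
    unfolding cluster_event_UN[OF V VJ] A_def \<H>_def cross_def by auto
  then have "prob (W \<inter> cluster_event V r J) = (\<Sum>H\<in>\<H>. prob (A H))"
    using fin\<H> disj A_meas by (simp add: finite_measure_finite_Union image_subset_iff)
  also have "\<dots> = (\<Sum>H\<in>\<H>. \<integral>\<omega>. h H \<omega> \<partial>M)"
  proof (rule sum.cong[OF refl])
    fix H assume "H \<in> \<H>"
    then have H: "H \<subseteq> edge_pairs V" by (auto simp: \<H>_def)
    show "prob (A H) = (\<integral>\<omega>. h H \<omega> \<partial>M)"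
      unfolding A_def h_def
    proof (rule prob_edges)
      show "finite (edge_pairs V - H \<union> cross)" using V cross by auto
      show "finite H" using H V by (rule_tac finite_subset[of H "edge_pairs V"]) auto
      show "edge_pairs V - H \<union> cross \<subseteq> edge_pairs UNIV" "H \<subseteq> edge_pairs UNIV" "H \<inter> (edge_pairs V - H \<union> cross) = {}"
        using H cross pairs by auto
      fix \<omega> i assume "\<omega> \<in> W" "i \<in> \<Union>(H \<union> (edge_pairs V - H \<union> cross))"
      moreover have "\<Union>cross \<subseteq> V \<union> J" by (auto simp: cross_def)
      ultimately show "enat i < K \<omega>" using WK[of \<omega> i] H pairs(2) by blast
    qed (rule W)
  qed
  also have "\<dots> = (\<integral>\<omega>. (\<Sum>H\<in>\<H>. h H \<omega>) \<partial>M)"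
    by (rule Bochner_Integration.integral_sum[symmetric]) (rule int_h)
  also have "\<dots> = (\<integral>\<omega>. indicator W \<omega> * (conn_prob \<phi> V r (pos \<omega>) *
      (\<Prod>j\<in>J. avoid_prob \<phi> V (pos \<omega>) (X j \<omega>))) \<partial>M)"
    unfolding h conn_prob_def by (simp add: \<H>_def sum_distrib_left sum_distrib_right)
  finally show ?thesis .
qed

end

section \<open>Clusters within a bounded window\<close>

text \<open>This is \<open>\<phi>\<^sub>\<lambda>\<close> as a function of the positions of indexed vertices.\<close>

definition hit_integral :: "'a measure \<Rightarrow> ('a \<Rightarrow> 'a \<Rightarrow> real) \<Rightarrow> 'i set \<Rightarrow> ('i \<Rightarrow> 'a) \<Rightarrow> real" where
  "hit_integral \<Lambda> \<phi> V x = (\<integral>z. 1 - avoid_prob \<phi> V x z \<partial>\<Lambda>)"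

lemma phi_lambda_image:
  assumes "inj_on x V"
  shows "phi_lambda \<Lambda> \<phi> (x ` V) = hit_integral \<Lambda> \<phi> V x"
  using assms by (simp add: phi_lambda_def hit_integral_def avoid_prob_def prod.reindex)

lemma conn_prob_cong:
  assumes "\<And>i. i \<in> V \<Longrightarrow> x i = y i"
  shows "conn_prob \<phi> V r x = conn_prob \<phi> V r y"
proof -
  have "x ` e = y ` e" if "e \<in> edge_pairs V" for e
    using that assms by (auto simp: edge_pairs_def)
  then show ?thesis
    unfolding conn_prob_def by (intro sum.cong refl arg_cong2[where f="(*)"] prod.cong) auto
qed

lemma avoid_prob_cong:
  assumes "\<And>i. i \<in> V \<Longrightarrow> x i = y i"
  shows "avoid_prob \<phi> V x z = avoid_prob \<phi> V y z"
  using assms by (simp add: avoid_prob_def)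

text \<open>A window only restricts the domain of integration. Removing it from the measure makes integrals for
different windows comparable.\<close>

lemma nn_integral_PiM_density_indicator:
  fixes \<Lambda> :: "'a measure"
  assumes sf: "sigma_finite_measure \<Lambda>" and B [measurable]: "B \<in> sets \<Lambda>" "emeasure \<Lambda> B < \<infinity>" and J: "finite J"
    and f [measurable]: "f \<in> borel_measurable (\<Pi>\<^sub>M j\<in>J. \<Lambda>)"
    and supp: "\<And>y. y \<in> space (\<Pi>\<^sub>M j\<in>J. \<Lambda>) \<Longrightarrow> \<not> (\<forall>j\<in>J. y j \<in> B) \<Longrightarrow> f y = 0"
  shows "(\<integral>\<^sup>+y. f y \<partial>(\<Pi>\<^sub>M j\<in>J. density \<Lambda> (indicator B))) = (\<integral>\<^sup>+y. f y \<partial>(\<Pi>\<^sub>M j\<in>J. \<Lambda>))"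
proof -
  interpret L: sigma_finite_measure \<Lambda> by fact
  interpret L: product_sigma_finite "\<lambda>_. \<Lambda>" by unfold_locales
  have "finite_measure (density \<Lambda> (indicator B))"
    using B sets.sets_into_space[OF B(1)]
    by (intro finite_measureI) (simp add: emeasure_density_indicator Int_absorb1)
  then interpret N: finite_measure "density \<Lambda> (indicator B)" .
  interpret N: product_sigma_finite "\<lambda>_. density \<Lambda> (indicator B)" by unfold_locales
  have eq: "density (\<Pi>\<^sub>M j\<in>J. \<Lambda>) (\<lambda>y. \<Prod>j\<in>J. indicator B (y j)) = (\<Pi>\<^sub>M j\<in>J. density \<Lambda> (indicator B))"
  proof (rule N.PiM_eqI)
    fix A assume "\<And>i. i \<in> J \<Longrightarrow> A i \<in> sets (density \<Lambda> (indicator B))"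
    then have A [measurable]: "\<And>i. i \<in> J \<Longrightarrow> A i \<in> sets \<Lambda>" by simp
    have "emeasure (density (\<Pi>\<^sub>M j\<in>J. \<Lambda>) (\<lambda>y. \<Prod>j\<in>J. indicator B (y j))) (Pi\<^sub>E J A) =
      (\<integral>\<^sup>+y. (\<Prod>j\<in>J. indicator B (y j)) * indicator (Pi\<^sub>E J A) y \<partial>(\<Pi>\<^sub>M j\<in>J. \<Lambda>))"
      using J A by (subst emeasure_density) (auto intro!: sets_PiM_I_finite)
    also have "\<dots> = (\<integral>\<^sup>+y. (\<Prod>j\<in>J. indicator (A j \<inter> B) (y j)) \<partial>(\<Pi>\<^sub>M j\<in>J. \<Lambda>))"
    proof (rule nn_integral_cong)
      fix y assume "y \<in> space (\<Pi>\<^sub>M j\<in>J. \<Lambda>)"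
      then have "indicator (Pi\<^sub>E J A) y = (\<Prod>j\<in>J. indicator (A j) (y j) :: ennreal)"
        using J by (auto simp: space_PiM PiE_iff indicator_def prod_zero_iff intro!: prod.neutral[symmetric])
      then show "(\<Prod>j\<in>J. indicator B (y j)) * indicator (Pi\<^sub>E J A) y = (\<Prod>j\<in>J. indicator (A j \<inter> B) (y j) :: ennreal)"
        by (simp add: prod.distrib[symmetric] indicator_inter_arith mult.commute)
    qed
    also have "\<dots> = (\<Prod>j\<in>J. emeasure \<Lambda> (A j \<inter> B))"
      using J A by (subst L.product_nn_integral_prod) auto
    also have "\<dots> = (\<Prod>j\<in>J. emeasure (density \<Lambda> (indicator B)) (A j))"
      using A by (intro prod.cong refl) (simp add: emeasure_density_indicator)
    finally show "emeasure (density (\<Pi>\<^sub>M j\<in>J. \<Lambda>) (\<lambda>y. \<Prod>j\<in>J. indicator B (y j))) (Pi\<^sub>E J A) = \<dots>" .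
  qed (use J in \<open>auto intro!: sets_PiM_cong\<close>)
  show ?thesis
    unfolding eq[symmetric]
  proof (subst nn_integral_density)
    show "(\<integral>\<^sup>+y. (\<Prod>j\<in>J. indicator B (y j)) * f y \<partial>(\<Pi>\<^sub>M j\<in>J. \<Lambda>)) = (\<integral>\<^sup>+y. f y \<partial>(\<Pi>\<^sub>M j\<in>J. \<Lambda>))"
    proof (rule nn_integral_cong)
      fix y assume "y \<in> space (\<Pi>\<^sub>M j\<in>J. \<Lambda>)"
      then show "(\<Prod>j\<in>J. indicator B (y j)) * f y = f y"
        using supp[of y] by (cases "\<forall>j\<in>J. y j \<in> B") auto
    qed
  qed (use J in auto)
qed

locale rcm = rcm_graph M \<Lambda> t \<eta> v K X \<phi> E for M :: "'w measure" and \<Lambda> :: "'a :: polish_space measure"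
    and t \<eta> v K X \<phi> E +
  assumes locally_finite: "\<And>B. B \<in> sets borel \<Longrightarrow> bounded B \<Longrightarrow> emeasure \<Lambda> B < \<infinity>"
    and diffuse: "\<And>x. emeasure \<Lambda> {x} = 0"
begin

lemma space_Lambda [simp]: "space \<Lambda> = UNIV"
  using sets_eq_imp_space_eq[OF sets_Lambda] by simp

lemma sigma_finite_Lambda: "sigma_finite_measure \<Lambda>"
proof
  have "(\<Union>n. ball v (real n)) = UNIV"
    by (auto simp: set_eq_iff) (metis reals_Archimedean2)
  then show "\<exists>A. countable A \<and> A \<subseteq> sets \<Lambda> \<and> \<Union> A = space \<Lambda> \<and> (\<forall>a\<in>A. emeasure \<Lambda> a \<noteq> \<infinity>)"
    using locally_finite
    by (intro exI[of _ "range (\<lambda>n. ball v (real n))"]) (auto simp: sets_Lambda less_top)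
qed

sublocale Lambda: sigma_finite_measure \<Lambda> by (rule sigma_finite_Lambda)

abbreviation tuples :: "nat \<Rightarrow> (nat \<Rightarrow> 'a) measure" where
  "tuples m \<equiv> \<Pi>\<^sub>M j\<in>{..<m}. \<Lambda>"

abbreviation rooted_avoid :: "nat \<Rightarrow> (nat \<Rightarrow> 'a) \<Rightarrow> 'a \<Rightarrow> real" where
  "rooted_avoid m y \<equiv> avoid_prob \<phi> {..m} (y(m := v))"

abbreviation rooted_hit :: "nat \<Rightarrow> (nat \<Rightarrow> 'a) \<Rightarrow> real" where
  "rooted_hit m y \<equiv> hit_integral \<Lambda> \<phi> {..m} (y(m := v))"

abbreviation rooted_conn :: "nat \<Rightarrow> (nat \<Rightarrow> 'a) \<Rightarrow> real" where
  "rooted_conn m y \<equiv> conn_prob \<phi> {..m} m (y(m := v))"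

text \<open>The probability that no point of the process in \<open>B\<close> is joined to \<open>v\<close> or to one of the points in \<open>y\<close>.\<close>

definition window_void :: "'a set \<Rightarrow> nat \<Rightarrow> (nat \<Rightarrow> 'a) \<Rightarrow> ennreal" where
  "window_void B m y = ennreal (exp (- t * (\<integral>z. 1 - rooted_avoid m y z \<partial>density \<Lambda> (indicator B))))"

lemma sets_tuples: "sets (tuples m) = sets (\<Pi>\<^sub>M j\<in>{..<m}. borel)"
  by (intro sets_PiM_cong) (simp_all add: sets_Lambda)

lemma avoid_prob_measurable [measurable]:
  assumes "\<And>i. i \<in> V \<Longrightarrow> (\<lambda>\<omega>. x \<omega> i) \<in> borel_measurable N" "f \<in> borel_measurable N"
  shows "(\<lambda>\<omega>. avoid_prob \<phi> V (x \<omega>) (f \<omega>)) \<in> borel_measurable N"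
  unfolding avoid_prob_def using assms
  by (intro borel_measurable_prod borel_measurable_diff borel_measurable_const phi_measurable') auto

lemma hit_integral_measurable [measurable]:
  assumes "\<And>i. i \<in> V \<Longrightarrow> (\<lambda>\<omega>. x \<omega> i) \<in> borel_measurable N"
  shows "(\<lambda>\<omega>. hit_integral \<Lambda> \<phi> V (x \<omega>)) \<in> borel_measurable N"
proof -
  have [measurable]: "(\<lambda>p. avoid_prob \<phi> V (x (fst p)) (snd p)) \<in> borel_measurable (N \<Otimes>\<^sub>M \<Lambda>)"
  proof (rule avoid_prob_measurable)
    show "(\<lambda>p. x (fst p) i) \<in> borel_measurable (N \<Otimes>\<^sub>M \<Lambda>)" if "i \<in> V" for i
      by (rule measurable_compose[OF measurable_fst assms[OF that]])
    show "snd \<in> borel_measurable (N \<Otimes>\<^sub>M \<Lambda>)"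
      using measurable_snd[of N \<Lambda>] by (simp add: measurable_cong_sets[OF refl sets_Lambda])
  qed
  show ?thesis
    unfolding hit_integral_def
    by (intro Lambda.borel_measurable_lebesgue_integral) (simp add: case_prod_beta)
qed

lemma conn_prob_measurable [measurable]:
  assumes "\<And>i. i \<in> V \<Longrightarrow> (\<lambda>\<omega>. x \<omega> i) \<in> borel_measurable N"
  shows "(\<lambda>\<omega>. conn_prob \<phi> V r (x \<omega>)) \<in> borel_measurable N"
proof -
  have e: "(\<lambda>\<omega>. edge_prob \<phi> (x \<omega> ` e)) \<in> borel_measurable N" if e: "e \<in> edge_pairs V" for e
  proof -
    obtain i j where ij: "i \<in> V" "j \<in> V" "e = {i, j}" using e by (auto simp: edge_pairs_def)
    then show ?thesis using assms[OF ij(1)] assms[OF ij(2)] by simp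
  qed
  show ?thesis
    unfolding conn_prob_def
    by (intro borel_measurable_sum borel_measurable_times borel_measurable_prod borel_measurable_diff
          borel_measurable_const e) auto
qed

lemma avoid_prob_range: "0 \<le> avoid_prob \<phi> V x z" "avoid_prob \<phi> V x z \<le> 1"
  using phi_range by (auto simp: avoid_prob_def intro!: prod_nonneg prod_le_1)

lemma conn_prob_terms:
  assumes "H \<subseteq> edge_pairs V"
  shows "0 \<le> (\<Prod>e\<in>H. edge_prob \<phi> (x ` e)) * (\<Prod>e\<in>edge_pairs V - H. 1 - edge_prob \<phi> (x ` e))"
    "(\<Prod>e\<in>H. edge_prob \<phi> (x ` e)) * (\<Prod>e\<in>edge_pairs V - H. 1 - edge_prob \<phi> (x ` e)) \<le> 1"
proof -
  have r: "0 \<le> edge_prob \<phi> (x ` e)" "edge_prob \<phi> (x ` e) \<le> 1" if "e \<in> edge_pairs V" for e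
    using that phi_range by (auto simp: edge_pairs_def)
  show "0 \<le> (\<Prod>e\<in>H. edge_prob \<phi> (x ` e)) * (\<Prod>e\<in>edge_pairs V - H. 1 - edge_prob \<phi> (x ` e))"
    using assms r by (intro mult_nonneg_nonneg prod_nonneg) auto
  show "(\<Prod>e\<in>H. edge_prob \<phi> (x ` e)) * (\<Prod>e\<in>edge_pairs V - H. 1 - edge_prob \<phi> (x ` e)) \<le> 1"
    using assms r by (intro mult_le_one prod_le_1 prod_nonneg) auto
qed

lemma conn_prob_nonneg: "0 \<le> conn_prob \<phi> V r x"
  unfolding conn_prob_def by (intro sum_nonneg conn_prob_terms) auto

lemma conn_prob_le: "conn_prob \<phi> V r x \<le> real (card {H. H \<subseteq> edge_pairs V \<and> component H r = V})"
proof -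
  have "conn_prob \<phi> V r x \<le> of_nat (card {H. H \<subseteq> edge_pairs V \<and> component H r = V}) * 1"
    unfolding conn_prob_def by (rule sum_bounded_above) (use conn_prob_terms(2) in auto)
  then show ?thesis by simp
qed

text \<open>The Poisson probabilities of the finite values sum up to one.\<close>

lemma AE_finite_idx:
  assumes B: "B \<in> sets borel" "v \<notin> B" "emeasure \<Lambda> B < \<infinity>"
  shows "AE \<omega> in M. finite (idx B \<omega>)"
proof -
  note B(1)[measurable]
  have f: "ennreal (prob {\<omega>\<in>space M. finite (idx B \<omega>) \<and> card (idx B \<omega>) = k}) =
    ennreal ((t * measure \<Lambda> B) ^ k / fact k * exp (- (t * measure \<Lambda> B)))" for k
    using prob_counts[of "{0}" "\<lambda>_. B" "\<lambda>_. k"] B by (simp add: disjoint_family_on_def)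
  have sets: "{\<omega>\<in>space M. finite (idx B \<omega>) \<and> card (idx B \<omega>) = k} \<in> sets M" for k
  proof -
    have "{\<omega>\<in>space M. finite (idx B \<omega>) \<and> card (idx B \<omega>) = k} = {\<omega>\<in>space M. point_count \<eta> B \<omega> = of_nat k}"
      using B(2) by (auto simp: point_count_idx)
    moreover have [measurable]: "point_count \<eta> B \<in> borel_measurable M"
      using poisson B(1) by (auto simp: poisson_process_def)
    ultimately show ?thesis by simp
  qed
  have fin_UN: "{\<omega>\<in>space M. finite (idx B \<omega>)} = (\<Union>k. {\<omega>\<in>space M. finite (idx B \<omega>) \<and> card (idx B \<omega>) = k})"
    by auto
  have "emeasure M {\<omega>\<in>space M. finite (idx B \<omega>)} =
    (\<Sum>k. emeasure M {\<omega>\<in>space M. finite (idx B \<omega>) \<and> card (idx B \<omega>) = k})"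
    unfolding fin_UN using sets by (intro suminf_emeasure[symmetric]) (auto simp: disjoint_family_on_def)
  also have "\<dots> = (\<Sum>k. ennreal ((t * measure \<Lambda> B) ^ k / fact k * exp (- (t * measure \<Lambda> B))))"
    by (simp add: emeasure_eq_measure f)
  also have "\<dots> = ennreal (exp (t * measure \<Lambda> B) * exp (- (t * measure \<Lambda> B)))"
  proof (rule suminf_ennreal_eq)
    show "(\<lambda>k. (t * measure \<Lambda> B) ^ k / fact k * exp (- (t * measure \<Lambda> B))) sums
      (exp (t * measure \<Lambda> B) * exp (- (t * measure \<Lambda> B)))"
      using exp_converges[of "t * measure \<Lambda> B"] by (intro sums_mult2) (simp add: divide_inverse mult.commute)
  qed (use t_pos in auto)
  also have "\<dots> = 1" by (simp add: exp_minus)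
  finally have "emeasure M {\<omega>\<in>space M. finite (idx B \<omega>)} = 1" .
  moreover have "{\<omega>\<in>space M. finite (idx B \<omega>)} \<in> sets M"
    unfolding fin_UN using sets by auto
  ultimately show ?thesis
    by (subst AE_iff_emeasure_eq_1) auto
qed

text \<open>These are the conditions for \<open>r\<close> and \<open>I\<close> to be the indices of \<open>v\<close> and of the other vertices of its
cluster that concern the vertices alone. The window \<open>A\<close> confines the cluster, and \<open>D\<close> restricts the
value of \<open>\<phi>\<^sub>\<lambda>\<close>.\<close>

definition root_event :: "'a set \<Rightarrow> real set \<Rightarrow> nat \<Rightarrow> nat set \<Rightarrow> 'w set" where
  "root_event A D r I = {\<omega>\<in>space M. enat r < K \<omega> \<and> X r \<omega> = v \<and> I \<subseteq> idx A \<omega> \<and>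
     hit_integral \<Lambda> \<phi> (insert r I) (pos \<omega>) \<in> D}"

text \<open>A second window \<open>B\<close> bounds the points that are taken into account as possible further neighbours.\<close>

definition local_event :: "'a set \<Rightarrow> 'a set \<Rightarrow> real set \<Rightarrow> nat \<Rightarrow> nat set \<Rightarrow> 'w set" where
  "local_event A B D r I = {\<omega>\<in>root_event A D r I. \<omega> \<in> cluster_event (insert r I) r (idx B \<omega> - I)}"

lemma root_event_sets:
  assumes [measurable]: "A \<in> sets borel" "D \<in> sets borel" and I: "finite I"
  shows "root_event A D r I \<in> sets \<F>"
proof -
  have [measurable]: "Measurable.pred \<F> (\<lambda>\<omega>. i \<in> idx A \<omega>)" for i unfolding idx_def by simp
  have "root_event A D r I = {\<omega>\<in>space \<F>. enat r < K \<omega> \<and> X r \<omega> = v \<and> (\<forall>i\<in>I. i \<in> idx A \<omega>) \<and>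
     hit_integral \<Lambda> \<phi> (insert r I) (pos \<omega>) \<in> D}"
    by (auto simp: root_event_def)
  also have "\<dots> \<in> sets \<F>" using I by measurable
  finally show ?thesis .
qed

lemma cluster_event_sets [measurable]:
  assumes "finite V"
  shows "cluster_event V r J \<in> sets M"
proof -
  have "cluster_event V r J = (\<Union>H\<in>{H. H \<subseteq> edge_pairs V \<and> component H r = V}.
    {\<omega>\<in>space M. (\<forall>e\<in>edge_pairs V. e \<in> iedges \<omega> \<longleftrightarrow> e \<in> H) \<and> (\<forall>i\<in>V. \<forall>j. j \<in> J \<longrightarrow> {i, j} \<notin> iedges \<omega>)})"
    (is "_ = ?R")
  proof (intro equalityI subsetI)
    fix \<omega> assume "\<omega> \<in> cluster_event V r J"
    then show "\<omega> \<in> ?R"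
      by (intro UN_I[of "iedges \<omega> \<inter> edge_pairs V"]) (auto simp: cluster_event_def)
  next
    fix \<omega> assume "\<omega> \<in> ?R"
    then obtain H where H: "H \<subseteq> edge_pairs V" "component H r = V" "\<omega> \<in> space M"
      "\<forall>e\<in>edge_pairs V. e \<in> iedges \<omega> \<longleftrightarrow> e \<in> H" "\<forall>i\<in>V. \<forall>j. j \<in> J \<longrightarrow> {i, j} \<notin> iedges \<omega>" by auto
    then have "iedges \<omega> \<inter> edge_pairs V = H" by auto
    then show "\<omega> \<in> cluster_event V r J" using H by (auto simp: cluster_event_def)
  qed
  also have "\<dots> \<in> sets M"
    using assms by (intro sets.finite_UN) auto
  finally show ?thesis .
qed

lemma local_event_sets:
  assumes [measurable]: "A \<in> sets borel" "B \<in> sets borel" "D \<in> sets borel" and I: "finite I"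
  shows "local_event A B D r I \<in> sets M"
proof -
  have [measurable]: "root_event A D r I \<in> sets M"
    by (intro sets_F_M root_event_sets I) auto
  have [measurable]: "cluster_event (insert r I) r {} \<in> sets M" using I by (intro cluster_event_sets) auto
  have "local_event A B D r I = root_event A D r I \<inter> cluster_event (insert r I) r {} \<inter>
    {\<omega>\<in>space M. \<forall>i\<in>insert r I. \<forall>j. j \<in> idx B \<omega> \<longrightarrow> j \<notin> I \<longrightarrow> {i, j} \<notin> iedges \<omega>}"
    by (auto simp: local_event_def cluster_event_def)
  also have "\<dots> \<in> sets M" using I by measurable
  finally show ?thesis .
qed

text \<open>Almost surely \<open>B\<close> contains only finitely many points, so that their index set takes countably many
values \<open>J\<close>. On the event that it equals \<open>J\<close>, which is determined by the vertices, the pairs in question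
are fixed and \<open>prob_cluster_event\<close> applies.\<close>

lemma emeasure_local_event:
  assumes B: "B \<in> sets borel" "v \<notin> B" "emeasure \<Lambda> B < \<infinity>" and AB: "A \<subseteq> B"
    and A: "A \<in> sets borel" and D: "D \<in> sets borel" and I: "finite I"
  shows "emeasure M (local_event A B D r I) =
    (\<integral>\<^sup>+\<omega>. indicator (root_event A D r I) \<omega> * (if finite (idx B \<omega>) then ennreal (conn_prob \<phi> (insert r I) r (pos \<omega>)) *
      (\<Prod>j\<in>idx B \<omega> - I. ennreal (avoid_prob \<phi> (insert r I) (pos \<omega>) (X j \<omega>))) else 0) \<partial>M)"
proof -
  let ?V = "insert r I"
  note A[measurable] B(1)[measurable] D[measurable]
  define \<J> where "\<J> = {J :: nat set. finite J}"
  have c\<J>: "countable \<J>" unfolding \<J>_def by (rule countable_Collect_finite)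
  define h where "h J \<omega> = ennreal (conn_prob \<phi> ?V r (pos \<omega>) *
      (\<Prod>j\<in>J - I. avoid_prob \<phi> ?V (pos \<omega>) (X j \<omega>)))" for J \<omega>
  have [measurable]: "h J \<in> borel_measurable M" if "finite J" for J
    unfolding h_def by measurable
  have eqJ_F: "{\<omega>\<in>space M. idx B \<omega> = J} \<in> sets \<F>" for J
  proof -
    have [measurable]: "Measurable.pred \<F> (\<lambda>\<omega>. i \<in> idx B \<omega>)" for i unfolding idx_def by simp
    have "{\<omega>\<in>space M. idx B \<omega> = J} = {\<omega>\<in>space \<F>. \<forall>i. i \<in> idx B \<omega> \<longleftrightarrow> i \<in> J}" by auto
    also have "\<dots> \<in> sets \<F>" by measurable
    finally show ?thesis .
  qed
  define W where "W J = root_event A D r I \<inter> {\<omega>\<in>space M. idx B \<omega> = J}" for J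
  have W_F: "W J \<in> sets \<F>" for J
    unfolding W_def by (intro sets.Int root_event_sets eqJ_F A D I)
  have W_M [measurable]: "W J \<in> sets M" for J by (rule sets_F_M[OF W_F])
  have [measurable]: "local_event A B D r I \<in> sets M" by (intro local_event_sets A B D I)
  have single: "(\<integral>\<^sup>+J. f J * indicator (W J) \<omega> \<partial>count_space \<J>) =
    (if finite (idx B \<omega>) then f (idx B \<omega>) * indicator (root_event A D r I) \<omega> else 0)"
    if \<omega>: "\<omega> \<in> space M" for f :: "nat set \<Rightarrow> ennreal" and \<omega>
  proof (cases "finite (idx B \<omega>)")
    case True
    define F where "F J = f J * indicator (W J) \<omega>" for J
    have "(\<integral>\<^sup>+J. F J \<partial>count_space \<J>) = (\<Sum>J\<in>{idx B \<omega>}. F J)"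
    proof (rule nn_integral_count_space')
      show "F J = 0" if "J \<notin> {idx B \<omega>}" for J
        using that by (auto simp: W_def F_def)
    qed (use True in \<open>simp_all add: \<J>_def\<close>)
    also have "\<dots> = F (idx B \<omega>)" by simp
    also have "indicator (W (idx B \<omega>)) \<omega> = (indicator (root_event A D r I) \<omega> :: ennreal)"
      using \<omega> by (simp add: W_def indicator_def)
    then have "F (idx B \<omega>) = f (idx B \<omega>) * indicator (root_event A D r I) \<omega>"
      by (simp add: F_def)
    finally show ?thesis using True by (simp add: F_def)
  next
    case False
    have "(\<integral>\<^sup>+J. f J * indicator (W J) \<omega> \<partial>count_space \<J>) = (\<integral>\<^sup>+J. 0 \<partial>count_space \<J>)"
    proof (rule nn_integral_cong)
      fix J assume "J \<in> space (count_space \<J>)"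
      then have "\<omega> \<notin> W J" using False by (auto simp: \<J>_def W_def)
      then show "f J * indicator (W J) \<omega> = 0" by simp
    qed
    then show ?thesis using False by simp
  qed
  have piece: "(\<integral>\<^sup>+\<omega>. indicator (cluster_event ?V r (J - I)) \<omega> * indicator (W J) \<omega> \<partial>M) =
    (\<integral>\<^sup>+\<omega>. h J \<omega> * indicator (W J) \<omega> \<partial>M)" if J: "J \<in> \<J>" for J
  proof (cases "W J = {}")
    case False
    have finJ: "finite J" using J by (simp add: \<J>_def)
    obtain \<omega>\<^sub>0 where \<omega>\<^sub>0: "\<omega>\<^sub>0 \<in> W J" using False by auto
    have rJ: "r \<notin> J" using \<omega>\<^sub>0 B(2) by (auto simp: W_def root_event_def idx_def)
    have "(\<integral>\<^sup>+\<omega>. indicator (cluster_event ?V r (J - I)) \<omega> * indicator (W J) \<omega> \<partial>M) =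
      emeasure M (W J \<inter> cluster_event ?V r (J - I))"
    proof -
      have "W J \<inter> cluster_event ?V r (J - I) \<in> sets M"
        using I by (intro sets.Int W_M cluster_event_sets) auto
      then have "emeasure M (W J \<inter> cluster_event ?V r (J - I)) =
        (\<integral>\<^sup>+\<omega>. indicator (W J \<inter> cluster_event ?V r (J - I)) \<omega> \<partial>M)" by simp
      also have "\<dots> = (\<integral>\<^sup>+\<omega>. indicator (cluster_event ?V r (J - I)) \<omega> * indicator (W J) \<omega> \<partial>M)"
        by (intro nn_integral_cong) (simp split: split_indicator)
      finally show ?thesis by (rule sym)
    qed
    also have "\<dots> = ennreal (prob (W J \<inter> cluster_event ?V r (J - I)))"
      by (rule emeasure_eq_measure)
    also have "prob (W J \<inter> cluster_event ?V r (J - I)) =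
      (\<integral>\<omega>. indicator (W J) \<omega> * (conn_prob \<phi> ?V r (pos \<omega>) *
      (\<Prod>j\<in>J - I. avoid_prob \<phi> ?V (pos \<omega>) (X j \<omega>))) \<partial>M)"
    proof (rule prob_cluster_event)
      show "finite ?V" "finite (J - I)" "?V \<inter> (J - I) = {}" "W J \<in> sets \<F>"
        using I finJ rJ W_F by auto
      fix \<omega> i assume "\<omega> \<in> W J" "i \<in> ?V \<union> (J - I)"
      then show "enat i < K \<omega>" by (auto simp: W_def root_event_def idx_def)
    qed
    also have "ennreal \<dots> = (\<integral>\<^sup>+\<omega>. ennreal (indicator (W J) \<omega> * (conn_prob \<phi> ?V r (pos \<omega>) *
      (\<Prod>j\<in>J - I. avoid_prob \<phi> ?V (pos \<omega>) (X j \<omega>)))) \<partial>M)"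
    proof (rule nn_integral_eq_integral[symmetric])
      let ?c = "real (card {H. H \<subseteq> edge_pairs ?V \<and> component H r = ?V})"
      have b: "0 \<le> (\<Prod>j\<in>J - I. avoid_prob \<phi> ?V (pos \<omega>) (X j \<omega>))"
        "(\<Prod>j\<in>J - I. avoid_prob \<phi> ?V (pos \<omega>) (X j \<omega>)) \<le> 1" for \<omega>
        using avoid_prob_range by (auto intro!: prod_nonneg prod_le_1)
      have bb: "0 \<le> conn_prob \<phi> ?V r (pos \<omega>) * (\<Prod>j\<in>J - I. avoid_prob \<phi> ?V (pos \<omega>) (X j \<omega>))"
        "conn_prob \<phi> ?V r (pos \<omega>) * (\<Prod>j\<in>J - I. avoid_prob \<phi> ?V (pos \<omega>) (X j \<omega>)) \<le> ?c * 1" for \<omega>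
        by (intro mult_nonneg_nonneg conn_prob_nonneg b, intro mult_mono conn_prob_le b of_nat_0_le_iff)
      show "integrable M (\<lambda>\<omega>. indicator (W J) \<omega> * (conn_prob \<phi> ?V r (pos \<omega>) *
        (\<Prod>j\<in>J - I. avoid_prob \<phi> ?V (pos \<omega>) (X j \<omega>))))"
        using bb by (intro integrable_const_bound[where B="?c"]) (auto split: split_indicator)
      show "AE \<omega> in M. 0 \<le> indicator (W J) \<omega> * (conn_prob \<phi> ?V r (pos \<omega>) *
        (\<Prod>j\<in>J - I. avoid_prob \<phi> ?V (pos \<omega>) (X j \<omega>)))"
        using bb by auto
    qed
    also have "\<dots> = (\<integral>\<^sup>+\<omega>. h J \<omega> * indicator (W J) \<omega> \<partial>M)"
      unfolding h_def by (intro nn_integral_cong) (simp split: split_indicator)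
    finally show ?thesis .
  qed simp
  have "emeasure M (local_event A B D r I) = (\<integral>\<^sup>+\<omega>. indicator (local_event A B D r I) \<omega> \<partial>M)"
    by simp
  also have "\<dots> = (\<integral>\<^sup>+\<omega>. \<integral>\<^sup>+J. indicator (cluster_event ?V r (J - I)) \<omega> * indicator (W J) \<omega> \<partial>count_space \<J> \<partial>M)"
  proof (rule nn_integral_cong_AE)
    show "AE \<omega> in M. indicator (local_event A B D r I) \<omega> =
      (\<integral>\<^sup>+J. indicator (cluster_event ?V r (J - I)) \<omega> * indicator (W J) \<omega> \<partial>count_space \<J>)"
      using AE_finite_idx[OF B] AE_space
    proof eventually_elim
      fix \<omega> assume fin: "finite (idx B \<omega>)" and \<omega>: "\<omega> \<in> space M"
      show "indicator (local_event A B D r I) \<omega> =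
        (\<integral>\<^sup>+J. indicator (cluster_event ?V r (J - I)) \<omega> * indicator (W J) \<omega> \<partial>count_space \<J>)"
        using fin unfolding single[OF \<omega>, of "\<lambda>J. indicator (cluster_event ?V r (J - I)) \<omega>"]
        by (auto simp: local_event_def indicator_def)
    qed
  qed
  also have "\<dots> = (\<integral>\<^sup>+J. \<integral>\<^sup>+\<omega>. indicator (cluster_event ?V r (J - I)) \<omega> * indicator (W J) \<omega> \<partial>M \<partial>count_space \<J>)"
    using c\<J> cluster_event_sets[of ?V r] I by (intro nn_integral_count_space_nn_integral) auto
  also have "\<dots> = (\<integral>\<^sup>+J. \<integral>\<^sup>+\<omega>. h J \<omega> * indicator (W J) \<omega> \<partial>M \<partial>count_space \<J>)"
    by (intro nn_integral_cong piece) simp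
  also have "\<dots> = (\<integral>\<^sup>+\<omega>. \<integral>\<^sup>+J. h J \<omega> * indicator (W J) \<omega> \<partial>count_space \<J> \<partial>M)"
    using c\<J> by (intro nn_integral_count_space_nn_integral[symmetric]) (auto simp: \<J>_def)
  also have "\<dots> = (\<integral>\<^sup>+\<omega>. indicator (root_event A D r I) \<omega> * (if finite (idx B \<omega>) then ennreal (conn_prob \<phi> (insert r I) r (pos \<omega>)) *
      (\<Prod>j\<in>idx B \<omega> - I. ennreal (avoid_prob \<phi> (insert r I) (pos \<omega>) (X j \<omega>))) else 0) \<partial>M)"
  proof (rule nn_integral_cong)
    fix \<omega> assume \<omega>: "\<omega> \<in> space M"
    have "h J \<omega> = ennreal (conn_prob \<phi> ?V r (pos \<omega>)) *
      (\<Prod>j\<in>J - I. ennreal (avoid_prob \<phi> ?V (pos \<omega>) (X j \<omega>)))" for J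
      unfolding h_def by (subst ennreal_mult'[OF conn_prob_nonneg]) (simp add: prod_ennreal avoid_prob_range)
    then show "(\<integral>\<^sup>+J. h J \<omega> * indicator (W J) \<omega> \<partial>count_space \<J>) =
      indicator (root_event A D r I) \<omega> * (if finite (idx B \<omega>) then ennreal (conn_prob \<phi> (insert r I) r (pos \<omega>)) *
      (\<Prod>j\<in>idx B \<omega> - I. ennreal (avoid_prob \<phi> (insert r I) (pos \<omega>) (X j \<omega>))) else 0)"
      unfolding single[OF \<omega>, of "\<lambda>J. h J \<omega>"] by (simp add: mult.commute)
  qed
  finally show ?thesis .
qed

definition root_index :: "'w \<Rightarrow> nat" where
  "root_index \<omega> = (THE r. enat r < K \<omega> \<and> X r \<omega> = v)"

lemma X_inj: "\<omega> \<in> space M \<Longrightarrow> enat i < K \<omega> \<Longrightarrow> enat j < K \<omega> \<Longrightarrow> X i \<omega> = X j \<omega> \<Longrightarrow> i = j"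
  using enum by (auto simp: vertex_enumeration_def bij_betw_def inj_on_def)

lemma X_image: "\<omega> \<in> space M \<Longrightarrow> (pos \<omega>) ` {i. enat i < K \<omega>} = insert v (\<eta> \<omega>)"
  using enum by (auto simp: vertex_enumeration_def bij_betw_def)

lemma root_iff: "\<omega> \<in> space M \<Longrightarrow> enat r < K \<omega> \<and> X r \<omega> = v \<longleftrightarrow> r = root_index \<omega>"
proof -
  assume \<omega>: "\<omega> \<in> space M"
  have "v \<in> (pos \<omega>) ` {i. enat i < K \<omega>}" using X_image[OF \<omega>] by auto
  then obtain r0 where r0: "enat r0 < K \<omega>" "X r0 \<omega> = v" by auto
  then have "root_index \<omega> = r0"
    unfolding root_index_def using X_inj[OF \<omega>] by (intro the_equality) auto
  then show ?thesis using r0 X_inj[OF \<omega>] by auto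
qed

text \<open>The positions of the other points of the cluster are numbered by \<open>j < m\<close>, and \<open>v\<close> is put at
position \<open>m\<close>.\<close>

definition tuple_weight :: "nat \<Rightarrow> 'a set \<Rightarrow> real set \<Rightarrow> (nat \<Rightarrow> 'a) \<Rightarrow> ennreal" where
  "tuple_weight m A D y = (\<Prod>j<m. indicator A (y j)) * indicator D (rooted_hit m y) *
     ennreal (rooted_conn m y)"

lemma rooted_measurable:
  fixes i m :: nat
  assumes "i \<in> {..m}"
  shows "(\<lambda>y. (y(m := v)) i) \<in> borel_measurable (\<Pi>\<^sub>M j\<in>{..<m}. borel)"
proof (cases "i = m")
  case False
  then have "i \<in> {..<m}" using assms by (simp add: less_le)
  then show ?thesis using False by (simp add: measurable_component_singleton)
qed simp

lemma tuple_weight_measurable: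
  assumes A: "A \<in> sets borel" and D: "D \<in> sets borel"
  shows "tuple_weight m A D \<in> borel_measurable (\<Pi>\<^sub>M j\<in>{..<m}. borel)"
proof -
  note rooted_measurable[measurable] A[measurable] D[measurable]
  have [measurable]: "(\<lambda>y. rooted_hit m y) \<in> borel_measurable (\<Pi>\<^sub>M j\<in>{..<m}. borel)"
    by (intro hit_integral_measurable rooted_measurable)
  have [measurable]: "(\<lambda>y. rooted_conn m y) \<in> borel_measurable (\<Pi>\<^sub>M j\<in>{..<m}. borel)"
    by (intro conn_prob_measurable rooted_measurable)
  have [measurable]: "(\<lambda>y. y j) \<in> borel_measurable (\<Pi>\<^sub>M j\<in>{..<m}. borel :: 'a measure)" if "j < m" for j
    using that by (intro measurable_component_singleton) auto
  show ?thesis unfolding tuple_weight_def by measurable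
qed

lemma rooted_avoid_measurable:
  fixes m :: nat
  shows "(\<lambda>(y, z). rooted_avoid m y z) \<in> borel_measurable ((\<Pi>\<^sub>M j\<in>{..<m}. borel) \<Otimes>\<^sub>M borel)"
  unfolding case_prod_beta
proof (rule avoid_prob_measurable)
  show "(\<lambda>p. ((fst p)(m := v)) i) \<in> borel_measurable ((\<Pi>\<^sub>M j\<in>{..<m}. borel) \<Otimes>\<^sub>M borel)" if "i \<in> {..m}" for i
    by (rule measurable_compose[OF measurable_fst rooted_measurable[OF that]])
qed (rule measurable_snd)

lemma window_void_measurable:
  assumes B: "B \<in> sets borel" "emeasure \<Lambda> B < \<infinity>"
  shows "window_void B m \<in> borel_measurable (tuples m)"
proof -
  have "finite_measure (density \<Lambda> (indicator B))"
    using B by (intro finite_measureI) (simp add: emeasure_density_indicator sets_Lambda)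
  then interpret N: finite_measure "density \<Lambda> (indicator B)" .
  have "(\<lambda>(y, z). rooted_avoid m y z) \<in> borel_measurable (tuples m \<Otimes>\<^sub>M density \<Lambda> (indicator B))"
    using rooted_avoid_measurable
    by (simp add: measurable_cong_sets[OF sets_pair_measure_cong[OF sets_tuples] refl] sets_Lambda)
  then have [measurable]: "(\<lambda>y. \<integral>z. 1 - rooted_avoid m y z \<partial>density \<Lambda> (indicator B)) \<in> borel_measurable (tuples m)"
    by (intro N.borel_measurable_lebesgue_integral) (simp add: case_prod_beta)
  show ?thesis unfolding window_void_def by measurable
qed

definition cluster_labels :: "nat \<Rightarrow> (nat \<times> nat set) set" where
  "cluster_labels m = UNIV \<times> {I. finite I \<and> card I = m}"

lemma countable_cluster_labels: "countable (cluster_labels m)"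
  unfolding cluster_labels_def
  by (intro countable_SIGMA countable_subset[OF _ countable_Collect_finite]) auto

text \<open>Only one index belongs to \<open>v\<close>, so that the sum over \<open>r\<close> has one nonzero term. In the sum over \<open>I\<close> the
terms do not depend on the order of the points, as conditions on the cluster are invariant under
relabelling; hence Mecke's formula applies.\<close>

lemma sum_emeasure_local_event:
  assumes B: "B \<in> sets borel" "v \<notin> B" "emeasure \<Lambda> B < \<infinity>" and AB: "A \<subseteq> B"
    and A: "A \<in> sets borel" and D: "D \<in> sets borel"
  shows "(\<integral>\<^sup>+p. emeasure M (local_event A B D (fst p) (snd p)) \<partial>count_space (cluster_labels m)) =
    ennreal (t ^ m / fact m) * (\<integral>\<^sup>+y. tuple_weight m A D y *
      window_void B m y
      \<partial>(tuples m))"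
proof -
  note A[measurable] B(1)[measurable] D[measurable]
  let ?X = "\<lambda>\<omega> i. X i \<omega>"
  define G where "G r I \<omega> = indicator (root_event A D r I) \<omega> * ennreal (conn_prob \<phi> (insert r I) r (?X \<omega>))" for r I \<omega>
  define T where "T r I \<omega> = indicator (root_event A D r I) \<omega> * (if finite (idx B \<omega>) then ennreal (conn_prob \<phi> (insert r I) r (?X \<omega>)) *
      (\<Prod>j\<in>idx B \<omega> - I. ennreal (avoid_prob \<phi> (insert r I) (?X \<omega>) (X j \<omega>))) else 0)" for r I \<omega>
  define gI where "gI I \<omega> = G (root_index \<omega>) I \<omega>" for I \<omega>
  define wI where "wI I \<omega> z = avoid_prob \<phi> (insert (root_index \<omega>) I) (?X \<omega>) z" for I \<omega> z
  have T_meas: "T r I \<in> borel_measurable M" if I: "finite I" for r I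
  proof -
    define \<J> where "\<J> = {J :: nat set. finite J}"
    have c\<J>: "countable \<J>" unfolding \<J>_def by (rule countable_Collect_finite)
    have [measurable]: "root_event A D r I \<in> sets M" by (intro sets_F_M root_event_sets A D I)
    have [measurable]: "Measurable.pred M (\<lambda>\<omega>. idx B \<omega> = J)" for J
    proof -
      have "(\<lambda>\<omega>. idx B \<omega> = J) = (\<lambda>\<omega>. \<forall>i. i \<in> idx B \<omega> \<longleftrightarrow> i \<in> J)" by (auto simp: fun_eq_iff)
      then show ?thesis by simp
    qed
    define h where "h J \<omega> = indicator (root_event A D r I) \<omega> * (ennreal (conn_prob \<phi> (insert r I) r (?X \<omega>)) *
      (\<Prod>j\<in>J - I. ennreal (avoid_prob \<phi> (insert r I) (?X \<omega>) (X j \<omega>))))" for J \<omega>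
    have h_meas: "h J \<in> borel_measurable M" if "J \<in> \<J>" for J
      using that unfolding h_def \<J>_def by measurable
    have "T r I \<omega> = (\<integral>\<^sup>+J. (if idx B \<omega> = J then h J \<omega> else 0) \<partial>count_space \<J>)" for \<omega>
      by (subst nn_integral_count_space'[of "if finite (idx B \<omega>) then {idx B \<omega>} else {}"])
         (auto simp: \<J>_def T_def h_def)
    moreover have "(\<lambda>(J, \<omega>). if idx B \<omega> = J then h J \<omega> else 0) \<in> borel_measurable (count_space \<J> \<Otimes>\<^sub>M M)"
    proof (intro measurable_pair_measure_countable1 c\<J>)
      fix J assume "J \<in> \<J>"
      note h_meas[OF this, measurable]
      show "(\<lambda>\<omega>. case (J, \<omega>) of (J, \<omega>) \<Rightarrow> if idx B \<omega> = J then h J \<omega> else 0) \<in> borel_measurable M"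
        by simp
    qed
    then have "(\<lambda>(\<omega>, J). if idx B \<omega> = J then h J \<omega> else 0) \<in> borel_measurable (M \<Otimes>\<^sub>M count_space \<J>)"
      by (subst (asm) measurable_pair_swap_iff) (simp add: case_prod_unfold cong: if_cong)
    then have "(\<lambda>\<omega>. \<integral>\<^sup>+J. (if idx B \<omega> = J then h J \<omega> else 0) \<partial>count_space \<J>) \<in> borel_measurable M"
      by (rule sigma_finite_measure.borel_measurable_nn_integral[OF sigma_finite_measure_count_space_countable[OF c\<J>]])
    ultimately show ?thesis
      by (subst measurable_cong) auto
  qed
  have sumT: "(\<integral>\<^sup>+p. T (fst p) (snd p) \<omega> \<partial>count_space (cluster_labels m)) =
    (if finite (idx B \<omega>) then \<Sum>I | I \<subseteq> idx B \<omega> \<and> card I = m. gI I \<omega> * (\<Prod>j\<in>idx B \<omega> - I. ennreal (wI I \<omega> (X j \<omega>))) else 0)"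
    if \<omega>: "\<omega> \<in> space M" for \<omega>
  proof (cases "finite (idx B \<omega>)")
    case True
    let ?S = "{I. I \<subseteq> idx B \<omega> \<and> card I = m}"
    have "(\<integral>\<^sup>+p. T (fst p) (snd p) \<omega> \<partial>count_space (cluster_labels m)) =
      (\<Sum>p\<in>Pair (root_index \<omega>) ` ?S. T (fst p) (snd p) \<omega>)"
    proof (rule nn_integral_count_space')
      show "finite (Pair (root_index \<omega>) ` ?S)" using True by auto
      show "Pair (root_index \<omega>) ` ?S \<subseteq> cluster_labels m"
        using True finite_subset by (auto simp: cluster_labels_def)
      fix p assume p: "p \<in> cluster_labels m" "p \<notin> Pair (root_index \<omega>) ` ?S"
      show "T (fst p) (snd p) \<omega> = 0"
      proof (rule ccontr)
        assume "T (fst p) (snd p) \<omega> \<noteq> 0"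
        then have "\<omega> \<in> root_event A D (fst p) (snd p)" by (rule_tac ccontr) (simp add: T_def)
        then have "fst p = root_index \<omega>" "snd p \<subseteq> idx B \<omega>"
          using root_iff[OF \<omega>] AB by (auto simp: root_event_def idx_def)
        then show False using p by (cases p) (auto simp: cluster_labels_def)
      qed
    qed
    also have "\<dots> = (\<Sum>I\<in>?S. T (root_index \<omega>) I \<omega>)"
      by (subst sum.reindex) (auto simp: inj_on_def)
    finally show ?thesis using True by (simp add: T_def gI_def G_def wI_def mult.assoc)
  next
    case False
    then show ?thesis by (simp add: T_def)
  qed
  have relabel: "gI (\<iota> ` {..<m}) \<omega> = tuple_weight m A D (\<lambda>j\<in>{..<m}. X (\<iota> j) \<omega>)"
     "wI (\<iota> ` {..<m}) \<omega> z = avoid_prob \<phi> {..m} ((\<lambda>j\<in>{..<m}. X (\<iota> j) \<omega>)(m := v)) z"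
    if \<omega>: "\<omega> \<in> space M" and \<iota>: "inj_on \<iota> {..<m}" "\<iota> ` {..<m} \<subseteq> idx B \<omega>" for \<iota> \<omega> z
  proof -
    \<comment> \<open>The labelling, extended by the index of \<open>v\<close> at position \<open>m\<close>\<close>
    define f where "f = \<iota>(m := root_index \<omega>)"
    have root: "enat (root_index \<omega>) < K \<omega>" "X (root_index \<omega>) \<omega> = v" using root_iff[OF \<omega>, of "root_index \<omega>"] by auto
    have r: "root_index \<omega> \<notin> \<iota> ` {..<m}" using \<iota> root B(2) by (auto simp: idx_def)
    have im: "f ` {..m} = insert (root_index \<omega>) (\<iota> ` {..<m})"
      by (auto simp: f_def lessThan_Suc_atMost[symmetric] lessThan_Suc)
    have inj: "inj_on f {..m}"
    proof -
      have "inj_on f {..<m}" using \<iota>(1) by (simp add: f_def inj_on_def)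
      moreover have "f m \<notin> f ` {..<m}" using r by (auto simp: f_def)
      moreover have "{..m} = insert m {..<m}" by auto
      ultimately show ?thesis by simp
    qed
    have fm: "f m = root_index \<omega>" by (simp add: f_def)
    have eq: "(?X \<omega> \<circ> f) i = ((\<lambda>j\<in>{..<m}. X (\<iota> j) \<omega>)(m := v)) i" if "i \<in> {..m}" for i
      using that root by (auto simp: f_def)
    have avoid: "avoid_prob \<phi> (insert (root_index \<omega>) (\<iota> ` {..<m})) (?X \<omega>) z =
      avoid_prob \<phi> {..m} ((\<lambda>j\<in>{..<m}. X (\<iota> j) \<omega>)(m := v)) z" for z
      unfolding im[symmetric] avoid_prob_reindex[OF inj] by (rule avoid_prob_cong[OF eq])
    then show "wI (\<iota> ` {..<m}) \<omega> z = avoid_prob \<phi> {..m} ((\<lambda>j\<in>{..<m}. X (\<iota> j) \<omega>)(m := v)) z"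
      by (simp add: wI_def)
    have hit: "hit_integral \<Lambda> \<phi> (insert (root_index \<omega>) (\<iota> ` {..<m})) (?X \<omega>) =
      hit_integral \<Lambda> \<phi> {..m} ((\<lambda>j\<in>{..<m}. X (\<iota> j) \<omega>)(m := v))"
      unfolding hit_integral_def avoid ..
    have conn: "conn_prob \<phi> (insert (root_index \<omega>) (\<iota> ` {..<m})) (root_index \<omega>) (?X \<omega>) =
      conn_prob \<phi> {..m} m ((\<lambda>j\<in>{..<m}. X (\<iota> j) \<omega>)(m := v))"
    proof -
      have "conn_prob \<phi> (f ` {..m}) (f m) (?X \<omega>) = conn_prob \<phi> {..m} m (?X \<omega> \<circ> f)"
        by (rule conn_prob_reindex[OF inj]) simp
      also have "\<dots> = conn_prob \<phi> {..m} m ((\<lambda>j\<in>{..<m}. X (\<iota> j) \<omega>)(m := v))"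
        by (rule conn_prob_cong[OF eq])
      finally show ?thesis unfolding im fm .
    qed
    have "(\<iota> ` {..<m} \<subseteq> idx A \<omega>) \<longleftrightarrow> (\<forall>j<m. X (\<iota> j) \<omega> \<in> A)"
      using \<iota> by (auto simp: idx_def)
    moreover have "(\<Prod>j<m. indicator A ((\<lambda>j\<in>{..<m}. X (\<iota> j) \<omega>) j) :: ennreal) = (if \<forall>j<m. X (\<iota> j) \<omega> \<in> A then 1 else 0)"
      by (auto simp: indicator_def prod_zero_iff intro!: prod.neutral)
    ultimately show "gI (\<iota> ` {..<m}) \<omega> = tuple_weight m A D (\<lambda>j\<in>{..<m}. X (\<iota> j) \<omega>)"
      unfolding gI_def G_def tuple_weight_def conn hit[symmetric]
      using \<omega> root by (auto simp: root_event_def indicator_def)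
  qed
  have "(\<integral>\<^sup>+p. emeasure M (local_event A B D (fst p) (snd p)) \<partial>count_space (cluster_labels m)) =
    (\<integral>\<^sup>+p. \<integral>\<^sup>+\<omega>. T (fst p) (snd p) \<omega> \<partial>M \<partial>count_space (cluster_labels m))"
    unfolding T_def by (intro nn_integral_cong emeasure_local_event B AB A D) (auto simp: cluster_labels_def)
  also have "\<dots> = (\<integral>\<^sup>+\<omega>. \<integral>\<^sup>+p. T (fst p) (snd p) \<omega> \<partial>count_space (cluster_labels m) \<partial>M)"
    by (intro nn_integral_count_space_nn_integral[symmetric] countable_cluster_labels T_meas)
       (auto simp: cluster_labels_def)
  also have "\<dots> = (\<integral>\<^sup>+\<omega>. (if finite (idx B \<omega>) then \<Sum>I | I \<subseteq> idx B \<omega> \<and> card I = m.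
      gI I \<omega> * (\<Prod>j\<in>idx B \<omega> - I. ennreal (wI I \<omega> (X j \<omega>))) else 0) \<partial>M)"
    by (intro nn_integral_cong sumT)
  also have "\<dots> = ennreal (t ^ m / fact m) *
      (\<integral>\<^sup>+y. tuple_weight m A D y *
        window_void B m y
        \<partial>(\<Pi>\<^sub>M j\<in>{..<m}. density \<Lambda> (indicator B)))"
    unfolding window_void_def
    by (intro nn_integral_split_configuration B tuple_weight_measurable A D rooted_avoid_measurable
         avoid_prob_range relabel)
  also have "(\<integral>\<^sup>+y. tuple_weight m A D y *
        window_void B m y
        \<partial>(\<Pi>\<^sub>M j\<in>{..<m}. density \<Lambda> (indicator B))) =
     (\<integral>\<^sup>+y. tuple_weight m A D y *
        window_void B m y
        \<partial>(tuples m))"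
  proof (rule nn_integral_PiM_density_indicator[OF sigma_finite_Lambda])
    have [measurable]: "tuple_weight m A D \<in> borel_measurable (tuples m)"
      using tuple_weight_measurable[OF A D] by (simp add: measurable_cong_sets[OF sets_tuples refl])
    note window_void_measurable[OF B(1,3), measurable]
    show "(\<lambda>y. tuple_weight m A D y *
        window_void B m y)
      \<in> borel_measurable (tuples m)"
      by measurable
    show "tuple_weight m A D y *
        window_void B m y = 0"
      if outside: "\<not> (\<forall>j\<in>{..<m}. y j \<in> B)" for y
    proof -
      obtain j where "j < m" "y j \<notin> A" using outside AB by auto
      then have "(\<Prod>j<m. indicator A (y j)) = (0 :: ennreal)"
        by (auto simp: prod_zero_iff intro!: bexI[of _ j])
      then show ?thesis by (simp add: tuple_weight_def)
    qed
  qed (use B in \<open>auto simp: sets_Lambda\<close>)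
  finally show ?thesis .
qed

end

section \<open>The law of the finite cluster\<close>

lemma component_mono: "H \<subseteq> H' \<Longrightarrow> component H r \<subseteq> component H' r"
  by (rule component_least) (auto intro: component_step)

lemma component_restrict:
  assumes "component H r = V" and H: "H \<subseteq> edge_pairs UNIV"
  shows "component (H \<inter> edge_pairs V) r = V"
proof (rule antisym)
  show "component (H \<inter> edge_pairs V) r \<subseteq> V"
    using component_mono[of "H \<inter> edge_pairs V" H r] assms by auto
  have "component H r \<subseteq> component (H \<inter> edge_pairs V) r"
  proof (rule component_least)
    fix u w assume u: "u \<in> component (H \<inter> edge_pairs V) r" and uw: "{u, w} \<in> H"
    have uV: "u \<in> component H r" using u component_mono[of "H \<inter> edge_pairs V" H r] by auto
    then have wV: "w \<in> component H r" using uw by (rule component_step)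
    have "u \<noteq> w" using uw H by (auto simp: edge_pairs_def)
    then have "{u, w} \<in> edge_pairs V" using uV wV assms by (auto simp: edge_pairs_def)
    then show "w \<in> component (H \<inter> edge_pairs V) r"
      using u uw by (intro component_step[OF u]) auto
  qed simp
  then show "V \<subseteq> component (H \<inter> edge_pairs V) r" using assms by simp
qed

lemma prod_indicator_eq:
  fixes m :: nat
  shows "(\<Prod>j<m. indicator A (y j)) = (if \<forall>j<m. y j \<in> A then 1 else 0 :: ennreal)"
  by (auto simp: indicator_def prod_zero_iff intro!: prod.neutral)

text \<open>Multiplied with \<open>t\<^sup>m exp (- t a)\<close>, this measure is the law of \<open>a = \<phi>\<^sub>\<lambda>(C)\<close> on the event \<open>|C| = m + 1\<close>. Tuples
for which \<open>\<phi>\<^sub>\<lambda>\<close> is infinite have to be left out: almost surely they are not finite clusters, but the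
integral in \<open>hit_integral\<close> has the default value \<open>0\<close> for them.\<close>

definition cluster_measure :: "'a measure \<Rightarrow> ('a \<Rightarrow> 'a \<Rightarrow> real) \<Rightarrow> 'a \<Rightarrow> nat \<Rightarrow> real measure" where
  "cluster_measure \<Lambda> \<phi> v m =
     distr (density (\<Pi>\<^sub>M j\<in>{..<m}. \<Lambda>) (\<lambda>y. ennreal (conn_prob \<phi> {..m} m (y(m := v)) / fact m) *
       indicator {y. (\<forall>j<m. y j \<noteq> v) \<and> integrable \<Lambda> (\<lambda>z. 1 - avoid_prob \<phi> {..m} (y(m := v)) z)} y))
     borel (\<lambda>y. hit_integral \<Lambda> \<phi> {..m} (y(m := v)))"

context rcm
begin

lemma iedges_subset: "iedges \<omega> \<subseteq> edge_pairs {i. enat i < K \<omega>}"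
proof
  fix e assume "e \<in> iedges \<omega>"
  then obtain i j where ij: "i < j" "enat j < K \<omega>" "e = {i, j}" by (auto simp: iedges_def)
  then have "enat i < K \<omega>" by (metis enat_ord_simps(2) less_trans)
  then show "e \<in> edge_pairs {i. enat i < K \<omega>}" using ij by (auto simp: edge_pairs_def)
qed

lemma image_iedges:
  assumes \<omega>: "\<omega> \<in> space M"
  shows "(`) (pos \<omega>) ` iedges \<omega> = E \<omega>"
proof (intro equalityI subsetI)
  fix e assume "e \<in> (`) (pos \<omega>) ` iedges \<omega>"
  then show "e \<in> E \<omega>" by (auto simp: iedges_def)
next
  fix e assume e: "e \<in> E \<omega>"
  then obtain x y where xy: "x \<in> insert v (\<eta> \<omega>)" "y \<in> insert v (\<eta> \<omega>)" "x \<noteq> y" "e = {x, y}"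
    using edges_subset[OF \<omega>] by blast
  then obtain i j where ij: "enat i < K \<omega>" "enat j < K \<omega>" "x = X i \<omega>" "y = X j \<omega>"
    unfolding X_image[OF \<omega>, symmetric] by blast
  then have "i \<noteq> j" using xy by auto
  have "{i, j} \<in> iedges \<omega>"
  proof (cases "i < j")
    case True then show ?thesis using ij e xy by (simp add: iedges_iff)
  next
    case False then show ?thesis using ij e xy \<open>i \<noteq> j\<close> iedges_iff[of j i \<omega>] by (simp add: insert_commute)
  qed
  then show "e \<in> (`) (pos \<omega>) ` iedges \<omega>" using xy ij by (intro image_eqI[of _ _ "{i, j}"]) auto
qed

lemma component_iedges_subset:
  assumes \<omega>: "\<omega> \<in> space M"
  shows "component (iedges \<omega>) (root_index \<omega>) \<subseteq> {i. enat i < K \<omega>}"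
proof (rule component_least)
  show "root_index \<omega> \<in> {i. enat i < K \<omega>}" using root_iff[OF \<omega>, of "root_index \<omega>"] by auto
  show "w \<in> {i. enat i < K \<omega>}" if "{u, w} \<in> iedges \<omega>" for u w
    using iedges_subset[of \<omega>] that by (auto simp: edge_pairs_def doubleton_eq_iff dest!: subsetD)
qed

text \<open>The enumeration is an isomorphism from the graph of the indices to the random graph.\<close>

lemma component_iedges:
  assumes \<omega>: "\<omega> \<in> space M"
  shows "component (E \<omega>) v = (pos \<omega>) ` component (iedges \<omega>) (root_index \<omega>)"
proof -
  have "inj_on (pos \<omega>) {i. enat i < K \<omega>}" using X_inj[OF \<omega>] by (auto simp: inj_on_def)
  from component_image[OF this iedges_subset, of "root_index \<omega>"]
  show ?thesis
    unfolding image_iedges[OF \<omega>] using root_iff[OF \<omega>, of "root_index \<omega>"] by auto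
qed

definition global_event :: "'a set \<Rightarrow> real set \<Rightarrow> nat \<Rightarrow> nat set \<Rightarrow> 'w set" where
  "global_event A D r I = {\<omega>\<in>root_event A D r I. component (iedges \<omega>) r = insert r I}"

text \<open>The point \<open>v\<close> is taken out so that the index of \<open>v\<close> never counts as an index of a point in the window.\<close>

definition window :: "nat \<Rightarrow> 'a set" where
  "window l = ball v (real l) - {v}"

lemma window: "window l \<in> sets borel" "v \<notin> window l" "emeasure \<Lambda> (window l) < \<infinity>"
  using locally_finite[of "window l"] bounded_subset[OF bounded_ball[of v "real l"], of "window l"] by (auto simp: window_def)

lemma window_mono: "k \<le> l \<Longrightarrow> window k \<subseteq> window l"
  by (auto simp: window_def)

lemma UN_window: "(\<Union>l. window l) = - {v}"
  by (auto simp: window_def) (metis reals_Archimedean2)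

text \<open>Every vertex other than \<open>v\<close> lies in some window. Hence a set that has no edge to the other points in
any window is closed under the edge relation.\<close>

lemma global_event_INT:
  assumes A: "v \<notin> A"
  shows "global_event A D r I = (\<Inter>l. local_event A (window (k + l)) D r I)"
proof (intro equalityI subsetI)
  fix \<omega> assume w: "\<omega> \<in> global_event A D r I"
  then have \<omega>: "\<omega> \<in> space M" and c: "component (iedges \<omega>) r = insert r I" and R: "\<omega> \<in> root_event A D r I"
    by (auto simp: global_event_def root_event_def)
  have ie: "iedges \<omega> \<subseteq> edge_pairs UNIV" by (auto simp: iedges_def edge_pairs_def)
  have "{i, j} \<notin> iedges \<omega>" if "i \<in> insert r I" "j \<in> idx (window (k + l)) \<omega> - I" for i j l
  proof
    assume "{i, j} \<in> iedges \<omega>"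
    then have "j \<in> insert r I" using that(1) unfolding c[symmetric] by (rule_tac component_step)
    then have "j = r" using that by auto
    then show False using R that window(2) by (auto simp: root_event_def idx_def)
  qed
  then show "\<omega> \<in> (\<Inter>l. local_event A (window (k + l)) D r I)"
    using R \<omega> component_restrict[OF c ie] by (auto simp: local_event_def cluster_event_def)
next
  fix \<omega> assume w: "\<omega> \<in> (\<Inter>l. local_event A (window (k + l)) D r I)"
  then have R: "\<omega> \<in> root_event A D r I" and c: "component (iedges \<omega> \<inter> edge_pairs (insert r I)) r = insert r I"
    and cross: "\<And>i j l. i \<in> insert r I \<Longrightarrow> j \<in> idx (window (k + l)) \<omega> \<Longrightarrow> j \<notin> I \<Longrightarrow> {i, j} \<notin> iedges \<omega>"
    by (auto simp: local_event_def cluster_event_def)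
  have \<omega>: "\<omega> \<in> space M" using R by (simp add: root_event_def)
  have "component (iedges \<omega>) r \<subseteq> insert r I"
  proof (rule component_least)
    fix u x assume u: "u \<in> insert r I" and ux: "{u, x} \<in> iedges \<omega>"
    show "x \<in> insert r I"
    proof (rule ccontr)
      assume x: "x \<notin> insert r I"
      have "{u, x} \<in> edge_pairs {i. enat i < K \<omega>}" using iedges_subset ux by (rule subsetD)
      then have xK: "enat x < K \<omega>" by (auto simp: edge_pairs_def doubleton_eq_iff)
      have "r = root_index \<omega>" using R root_iff[OF \<omega>, of r] by (simp add: root_event_def)
      then have "X x \<omega> \<noteq> v" using x xK root_iff[OF \<omega>, of x] by auto
      then have "X x \<omega> \<in> (\<Union>l. window l)" unfolding UN_window by auto
      then obtain l where "X x \<omega> \<in> window l" by auto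
      then have "X x \<omega> \<in> window (k + l)" using window_mono[of l "k + l"] by auto
      then show False using cross[OF u, of x l] x xK ux by (auto simp: idx_def)
    qed
  qed simp
  moreover have "insert r I \<subseteq> component (iedges \<omega>) r"
    using component_mono[of "iedges \<omega> \<inter> edge_pairs (insert r I)" "iedges \<omega>" r] c by auto
  ultimately show "\<omega> \<in> global_event A D r I" using R by (auto simp: global_event_def)
qed

lemma global_event_sets:
  assumes "A \<in> sets borel" "v \<notin> A" "D \<in> sets borel" "finite I"
  shows "global_event A D r I \<in> sets M"
proof -
  have "local_event A (window (0 + l)) D r I \<in> sets M" for l
    by (intro local_event_sets window assms)
  then show ?thesis
    unfolding global_event_INT[OF assms(2), of _ _ _ 0] by (intro sets.countable_INT) auto
qed

lemma integrable_measurable: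
  fixes m :: nat
  shows "{y\<in>space (tuples m). integrable \<Lambda> (\<lambda>z. 1 - rooted_avoid m y z)} \<in> sets (tuples m)"
proof -
  have [measurable]: "(\<lambda>(y, z). rooted_avoid m y z) \<in> borel_measurable ((tuples m) \<Otimes>\<^sub>M \<Lambda>)"
    using rooted_avoid_measurable[of m]
    by (simp add: measurable_cong_sets[OF sets_pair_measure_cong[OF sets_tuples sets_Lambda] refl])
  have m: "(\<lambda>z. 1 - rooted_avoid m y z) \<in> borel_measurable \<Lambda>" for y
    by (simp add: measurable_cong_sets[OF sets_Lambda refl])
  have eq: "integrable \<Lambda> (\<lambda>z. 1 - rooted_avoid m y z) \<longleftrightarrow>
    (\<integral>\<^sup>+z. ennreal (1 - rooted_avoid m y z) \<partial>\<Lambda>) < \<infinity>" for y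
    using m by (simp add: integrable_iff_bounded avoid_prob_range)
  have "(\<lambda>y. \<integral>\<^sup>+z. ennreal (1 - rooted_avoid m y z) \<partial>\<Lambda>) \<in> borel_measurable (tuples m)"
    by (intro Lambda.borel_measurable_nn_integral) (simp add: case_prod_unfold)
  then show ?thesis unfolding eq by simp
qed

text \<open>This is \<open>exp (- t \<phi>\<^sub>\<lambda>)\<close>, with \<open>exp (- \<infinity>) = 0\<close>.\<close>

definition void_weight :: "nat \<Rightarrow> (nat \<Rightarrow> 'a) \<Rightarrow> ennreal" where
  "void_weight m y = (if integrable \<Lambda> (\<lambda>z. 1 - rooted_avoid m y z)
     then ennreal (exp (- t * rooted_hit m y)) else 0)"

text \<open>If \<open>\<phi>\<^sub>\<lambda>\<close> is infinite, its restrictions to the windows tend to infinity by monotone convergence.\<close>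

lemma void_weight_limit:
  "(\<lambda>l. window_void (window (k + l)) m y) \<longlonglongrightarrow> void_weight m y"
proof -
  define h where "h z = 1 - rooted_avoid m y z" for z
  have h [measurable]: "h \<in> borel_measurable \<Lambda>"
    unfolding h_def by (simp add: measurable_cong_sets[OF sets_Lambda refl])
  have h01: "0 \<le> h z" "h z \<le> 1" for z using avoid_prob_range by (auto simp: h_def)
  have sh [measurable]: "window l \<in> sets \<Lambda>" for l using window(1) by (simp add: sets_Lambda)
  define a where "a l = (\<integral>z. indicator (window (k + l)) z * h z \<partial>\<Lambda>)" for l
  have a: "(\<integral>z. h z \<partial>density \<Lambda> (indicator (window (k + l)))) = a l" for l
    using integral_density[of h \<Lambda> "indicator (window (k + l))"]
    by (simp add: a_def ennreal_indicator)
  have ind: "(\<lambda>l. indicator (window (k + l)) z :: real) \<longlonglongrightarrow> 1" if "z \<noteq> v" for z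
  proof -
    have "z \<in> (\<Union>l. window l)" using that unfolding UN_window by simp
    then obtain l0 where l0: "z \<in> window l0" by auto
    have "z \<in> window (k + l)" if "l \<ge> l0" for l using window_mono[of l0 "k + l"] l0 that by auto
    then have "eventually (\<lambda>l. indicator (window (k + l)) z = (1::real)) sequentially"
      by (auto simp: eventually_sequentially indicator_def intro!: exI[of _ l0])
    then show ?thesis by (rule tendsto_eventually)
  qed
  have AE_v: "AE z in \<Lambda>. z \<noteq> v"
    by (rule AE_I[of _ _ "{v}"]) (auto simp: diffuse sets_Lambda)
  have int_a: "integrable \<Lambda> (\<lambda>z. indicator (window (k + l)) z * h z)" for l
  proof (rule Bochner_Integration.integrable_bound)
    show "integrable \<Lambda> (indicator (window (k + l)) :: 'a \<Rightarrow> real)"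
      using window(3)[of "k + l"] by (intro integrable_real_indicator) auto
  qed (use h01 in \<open>auto split: split_indicator\<close>)
  show ?thesis
  proof (cases "integrable \<Lambda> h")
    case True
    have "a \<longlonglongrightarrow> (\<integral>z. h z \<partial>\<Lambda>)"
      unfolding a_def
    proof (rule integral_dominated_convergence[where w=h])
      show "AE z in \<Lambda>. (\<lambda>l. indicator (window (k + l)) z * h z) \<longlonglongrightarrow> h z"
        using AE_v
      proof eventually_elim
        fix z assume "z \<noteq> v"
        from tendsto_mult[OF ind[OF this] tendsto_const[of "h z"]]
        show "(\<lambda>l. indicator (window (k + l)) z * h z) \<longlonglongrightarrow> h z" by simp
      qed
    qed (use True h01 in \<open>auto split: split_indicator\<close>)
    then have "(\<lambda>l. ennreal (exp (- t * a l))) \<longlonglongrightarrow> ennreal (exp (- t * (\<integral>z. h z \<partial>\<Lambda>)))"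
      by (intro tendsto_intros)
    then show ?thesis
      using True unfolding a[symmetric] window_void_def void_weight_def hit_integral_def h_def by simp
  next
    case False
    have "(\<lambda>l. ennreal (a l)) \<longlonglongrightarrow> \<top>"
    proof -
      have "(\<lambda>l. ennreal (a l)) = (\<lambda>l. \<integral>\<^sup>+z. ennreal (indicator (window (k + l)) z * h z) \<partial>\<Lambda>)"
        unfolding a_def using int_a h01 by (intro ext nn_integral_eq_integral[symmetric]) auto
      also have "\<dots> \<longlonglongrightarrow> (\<integral>\<^sup>+z. ennreal (indicator (- {v}) z * h z) \<partial>\<Lambda>)"
      proof (rule nn_integral_LIMSEQ)
        show "incseq (\<lambda>l z. ennreal (indicator (window (k + l)) z * h z))"
        proof (intro incseq_SucI le_funI ennreal_leI mult_right_mono h01)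
          show "indicator (window (k + l)) z \<le> (indicator (window (k + Suc l)) z :: real)" for l z
            using window_mono[of "k + l" "k + Suc l"] by (auto split: split_indicator)
        qed
        show "(\<lambda>l. ennreal (indicator (window (k + l)) z * h z)) \<longlonglongrightarrow> ennreal (indicator (- {v}) z * h z)" for z
        proof (cases "z = v")
          case True
          have "indicator (window (k + l)) v = (0 :: real)" for l using window(2) by (simp add: indicator_def)
          then show ?thesis using True by simp
        next
          case False
          from tendsto_mult[OF ind[OF this] tendsto_const[of "h z"]]
          have "(\<lambda>l. ennreal (indicator (window (k + l)) z * h z)) \<longlonglongrightarrow> ennreal (1 * h z)"
            by (rule tendsto_ennrealI)
          then show ?thesis using False by simp
        qed
      qed measurable
      also have "(\<integral>\<^sup>+z. ennreal (indicator (- {v}) z * h z) \<partial>\<Lambda>) = (\<integral>\<^sup>+z. ennreal (h z) \<partial>\<Lambda>)"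
      proof (rule nn_integral_cong_AE)
        show "AE z in \<Lambda>. ennreal (indicator (- {v}) z * h z) = ennreal (h z)"
          using AE_v by eventually_elim simp
      qed
      also have "\<dots> = \<top>"
        using False h h01 by (simp add: integrable_iff_bounded top_unique not_less)
      finally show ?thesis .
    qed
    then have "LIM l sequentially. a l :> at_top"
      by (simp add: ennreal_tendsto_top_eq_at_top)
    then have "LIM l sequentially. - t * a l :> at_bot"
      using t_pos by (subst filterlim_tendsto_neg_mult_at_bot_iff[of _ "- t"]) auto
    then have "(\<lambda>l. exp (- t * a l)) \<longlonglongrightarrow> 0"
      by (rule filterlim_compose[OF exp_at_bot])
    then have "(\<lambda>l. ennreal (exp (- t * a l))) \<longlonglongrightarrow> ennreal 0"
      by (rule tendsto_ennrealI)
    then show ?thesis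
      using False unfolding a[symmetric] window_void_def void_weight_def h_def by simp
  qed
qed

lemma void_measurable [measurable]: "void_weight m \<in> borel_measurable (tuples m)"
proof -
  have [measurable]: "(\<lambda>y. rooted_hit m y) \<in> borel_measurable (tuples m)"
    by (subst measurable_cong_sets[OF sets_tuples refl], intro hit_integral_measurable rooted_measurable)
  show ?thesis
    unfolding void_weight_def
    by (intro measurable_If integrable_measurable) measurable
qed

lemma tuple_weight_measurable_Lambda:
  assumes "A \<in> sets borel" "D \<in> sets borel"
  shows "tuple_weight m A D \<in> borel_measurable (tuples m)"
proof -
  show ?thesis
    using tuple_weight_measurable[OF assms] by (simp add: measurable_cong_sets[OF sets_tuples refl])
qed

lemma tuple_weight_finite:
  assumes A: "A \<in> sets borel" "emeasure \<Lambda> A < \<infinity>"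
  shows "(\<integral>\<^sup>+y. tuple_weight m A D y \<partial>(tuples m)) < \<infinity>"
proof -
  interpret L: product_sigma_finite "\<lambda>_. \<Lambda>" by unfold_locales
  let ?c = "real (card {H. H \<subseteq> edge_pairs {..m} \<and> component H m = {..m}})"
  have "(\<integral>\<^sup>+y. tuple_weight m A D y \<partial>(tuples m)) \<le>
    (\<integral>\<^sup>+y. ennreal ?c * (\<Prod>j<m. indicator A (y j)) \<partial>(tuples m))"
  proof (rule nn_integral_mono)
    fix y :: "nat \<Rightarrow> 'a"
    have "tuple_weight m A D y \<le> (\<Prod>j<m. indicator A (y j)) * 1 * ennreal ?c"
      unfolding tuple_weight_def by (intro mult_mono ennreal_leI conn_prob_le) (auto split: split_indicator)
    then show "tuple_weight m A D y \<le> ennreal ?c * (\<Prod>j<m. indicator A (y j))" by (simp add: mult.commute)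
  qed
  also have "\<dots> = ennreal ?c * (\<integral>\<^sup>+y. (\<Prod>j<m. indicator A (y j)) \<partial>(tuples m))"
    using A by (intro nn_integral_cmult borel_measurable_prod_ennreal
      measurable_compose[OF measurable_component_singleton borel_measurable_indicator]) (auto simp: sets_Lambda)
  also have "(\<integral>\<^sup>+y. (\<Prod>j<m. indicator A (y j)) \<partial>(tuples m)) = (\<Prod>j<m. emeasure \<Lambda> A)"
    using A by (subst L.product_nn_integral_prod) (auto simp: sets_Lambda)
  also have "ennreal ?c * \<dots> < \<infinity>"
    using A by (simp add: ennreal_mult_less_top power_less_top_ennreal)
  finally show ?thesis .
qed

text \<open>Here the window that confines the cluster is kept and the other one grows. Then the events decrease,
and the weights are dominated by \<open>tuple_weight\<close>, which is integrable since the cluster is confined.\<close>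

lemma sum_emeasure_global_event_window:
  assumes D: "D \<in> sets borel"
  shows "(\<integral>\<^sup>+p. emeasure M (global_event (window k) D (fst p) (snd p)) \<partial>count_space (cluster_labels m)) =
    ennreal (t ^ m / fact m) * (\<integral>\<^sup>+y. tuple_weight m (window k) D y * void_weight m y \<partial>(tuples m))"
proof -
  define L where "L l p = emeasure M (local_event (window k) (window (k + l)) D (fst p) (snd p))" for l p
  define w where "w l y = window_void (window (k + l)) m y"
    for l and y :: "nat \<Rightarrow> 'a"
  define TW where "TW = tuple_weight m (window k) D"
  have TW_meas [measurable]: "TW \<in> borel_measurable (tuples m)"
    unfolding TW_def by (intro tuple_weight_measurable_Lambda window D)
  have w_meas [measurable]: "w l \<in> borel_measurable (tuples m)" for l
    unfolding w_def by (intro window_void_measurable window)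
  have w1: "w l y \<le> 1" for l y
  proof -
    have "0 \<le> (\<integral>z. 1 - rooted_avoid m y z \<partial>density \<Lambda> (indicator (window (k + l))))"
      by (intro integral_nonneg_AE AE_I2) (simp add: avoid_prob_range)
    then show ?thesis unfolding w_def window_void_def using t_pos by (intro ennreal_le_1[THEN iffD2]) auto
  qed
  have eq: "(\<integral>\<^sup>+p. L l p \<partial>count_space (cluster_labels m)) =
    ennreal (t ^ m / fact m) * (\<integral>\<^sup>+y. TW y * w l y \<partial>(tuples m))" for l
    unfolding L_def TW_def w_def
    by (intro sum_emeasure_local_event window window_mono D) simp
  have TW_fin: "(\<integral>\<^sup>+y. TW y \<partial>(tuples m)) < \<infinity>"
    unfolding TW_def by (intro tuple_weight_finite window)
  have decL: "local_event (window k) (window (k + l')) D r I \<subseteq> local_event (window k) (window (k + l)) D r I"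
    if "l \<le> l'" for l l' r I
    using window_mono[of "k + l" "k + l'"] that by (auto simp: local_event_def cluster_event_def idx_def)
  have local_sets: "local_event (window k) (window (k + l)) D (fst p) (snd p) \<in> sets M" if "p \<in> cluster_labels m" for l p
    using that by (intro local_event_sets window D) (auto simp: cluster_labels_def)
  have "(\<lambda>l. \<integral>\<^sup>+p. L l p \<partial>count_space (cluster_labels m)) \<longlonglongrightarrow>
    (\<integral>\<^sup>+p. emeasure M (global_event (window k) D (fst p) (snd p)) \<partial>count_space (cluster_labels m))"
  proof (rule nn_integral_dominated_convergence[where w="L 0"])
    show "AE p in count_space (cluster_labels m). L l p \<le> L 0 p" for l
      unfolding L_def by (intro AE_I2 emeasure_mono decL local_sets) auto
    have "(\<integral>\<^sup>+p. L 0 p \<partial>count_space (cluster_labels m)) \<le> ennreal (t ^ m / fact m) * (\<integral>\<^sup>+y. TW y \<partial>(tuples m))"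
      unfolding eq using w1 by (intro mult_left_mono nn_integral_mono) (auto intro: mult_left_le)
    also have "\<dots> < \<infinity>" using TW_fin by (simp add: ennreal_mult_less_top)
    finally show "(\<integral>\<^sup>+p. L 0 p \<partial>count_space (cluster_labels m)) < \<infinity>" .
    show "AE p in count_space (cluster_labels m). (\<lambda>l. L l p) \<longlonglongrightarrow> emeasure M (global_event (window k) D (fst p) (snd p))"
      unfolding L_def global_event_INT[OF window(2), of k D _ _ k]
      using local_sets decL by (intro AE_I2 Lim_emeasure_decseq) (auto simp: decseq_def)
  qed auto
  moreover have "(\<lambda>l. \<integral>\<^sup>+p. L l p \<partial>count_space (cluster_labels m)) \<longlonglongrightarrow>
    ennreal (t ^ m / fact m) * (\<integral>\<^sup>+y. TW y * void_weight m y \<partial>(tuples m))"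
    unfolding eq
  proof (rule ennreal_tendsto_cmult)
    show "(\<lambda>l. \<integral>\<^sup>+y. TW y * w l y \<partial>(tuples m)) \<longlonglongrightarrow> (\<integral>\<^sup>+y. TW y * void_weight m y \<partial>(tuples m))"
    proof (rule nn_integral_dominated_convergence[where w=TW])
      show "AE y in tuples m. TW y * w l y \<le> TW y" for l
        using w1 by (auto intro!: AE_I2 mult_left_le)
      have "TW y < \<top>" for y
        unfolding TW_def tuple_weight_def by (auto simp: ennreal_mult_less_top indicator_def less_top ennreal_prod_eq_top)
      then show "AE y in tuples m. (\<lambda>l. TW y * w l y) \<longlonglongrightarrow> TW y * void_weight m y"
        unfolding w_def by (intro AE_I2 ennreal_tendsto_cmult void_weight_limit)
    qed (use TW_fin in measurable)
  qed simp
  ultimately show ?thesis unfolding TW_def by (rule LIMSEQ_unique)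
qed

text \<open>Now the window that confines the cluster grows too, and both sides increase.\<close>

lemma sum_emeasure_global_event:
  assumes D: "D \<in> sets borel"
  shows "(\<integral>\<^sup>+p. emeasure M (global_event (- {v}) D (fst p) (snd p)) \<partial>count_space (cluster_labels m)) =
    ennreal (t ^ m / fact m) * (\<integral>\<^sup>+y. tuple_weight m (- {v}) D y * void_weight m y \<partial>(tuples m))"
proof -
  let ?L = "\<lambda>k p. emeasure M (global_event (window k) D (fst p) (snd p)) * indicator (cluster_labels m) p"
  have inc: "global_event (window k) D r I \<subseteq> global_event (window k') D r I" if "k \<le> k'" for k k' r I
    using window_mono[OF that] by (auto simp: global_event_def root_event_def idx_def)
  have gsets: "global_event (window k) D (fst p) (snd p) \<in> sets M" if "p \<in> cluster_labels m" for k p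
    using that by (intro global_event_sets window D) (auto simp: cluster_labels_def)
  have UN: "(\<Union>k. global_event (window k) D r I) = global_event (- {v}) D r I" if I: "finite I" for r I
  proof (intro equalityI subsetI)
    fix \<omega> assume "\<omega> \<in> (\<Union>k. global_event (window k) D r I)"
    then show "\<omega> \<in> global_event (- {v}) D r I"
      using window(2) by (auto simp: global_event_def root_event_def idx_def)
  next
    fix \<omega> assume w: "\<omega> \<in> global_event (- {v}) D r I"
    have "\<exists>k. i \<in> idx (window k) \<omega>" if "i \<in> I" for i
    proof -
      have "X i \<omega> \<in> (\<Union>k. window k)" "enat i < K \<omega>"
        using w that unfolding UN_window by (auto simp: global_event_def root_event_def idx_def)
      then show ?thesis by (auto simp: idx_def)
    qed
    then obtain k where k: "\<And>i. i \<in> I \<Longrightarrow> i \<in> idx (window (k i)) \<omega>" by metis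
    obtain k' where k': "\<And>i. i \<in> I \<Longrightarrow> k i \<le> k'"
      using I finite_nat_set_iff_bounded_le[of "k ` I"] by auto
    have "i \<in> idx (window k') \<omega>" if "i \<in> I" for i
      using k[OF that] window_mono[OF k'[OF that]] by (auto simp: idx_def)
    then show "\<omega> \<in> (\<Union>k. global_event (window k) D r I)"
      using w by (intro UN_I[of k']) (auto simp: global_event_def root_event_def)
  qed
  have "(\<lambda>k. \<integral>\<^sup>+p. ?L k p \<partial>count_space (cluster_labels m)) \<longlonglongrightarrow>
    (\<integral>\<^sup>+p. emeasure M (global_event (- {v}) D (fst p) (snd p)) * indicator (cluster_labels m) p \<partial>count_space (cluster_labels m))"
  proof (rule nn_integral_LIMSEQ)
    show "incseq ?L"
    proof (intro incseq_SucI le_funI)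
      fix k p
      show "?L k p \<le> ?L (Suc k) p"
        using emeasure_mono[OF inc gsets, of k "Suc k"] by (cases "p \<in> cluster_labels m") auto
    qed
    show "(\<lambda>k. ?L k p) \<longlonglongrightarrow> emeasure M (global_event (- {v}) D (fst p) (snd p)) * indicator (cluster_labels m) p" for p
    proof (cases "p \<in> cluster_labels m")
      case True
      then have "finite (snd p)" by (auto simp: cluster_labels_def)
      have "(\<lambda>k. emeasure M (global_event (window k) D (fst p) (snd p))) \<longlonglongrightarrow>
        emeasure M (\<Union>k. global_event (window k) D (fst p) (snd p))"
      proof (rule Lim_emeasure_incseq)
        show "range (\<lambda>k. global_event (window k) D (fst p) (snd p)) \<subseteq> sets M" using gsets[OF True] by blast
        show "incseq (\<lambda>k. global_event (window k) D (fst p) (snd p))" unfolding incseq_def using inc by blast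
      qed
      then show ?thesis using True unfolding UN[OF \<open>finite (snd p)\<close>] by simp
    qed simp
  qed simp
  moreover have "(\<integral>\<^sup>+p. f p * indicator (cluster_labels m) p \<partial>count_space (cluster_labels m)) =
    (\<integral>\<^sup>+p. f p \<partial>count_space (cluster_labels m))" for f :: "nat \<times> nat set \<Rightarrow> ennreal"
    by (intro nn_integral_cong) simp
  moreover have "(\<lambda>k. \<integral>\<^sup>+p. emeasure M (global_event (window k) D (fst p) (snd p)) \<partial>count_space (cluster_labels m)) \<longlonglongrightarrow>
    ennreal (t ^ m / fact m) * (\<integral>\<^sup>+y. tuple_weight m (- {v}) D y * void_weight m y \<partial>(tuples m))"
    unfolding sum_emeasure_global_event_window[OF D]
  proof (rule ennreal_tendsto_cmult)
    show "(\<lambda>k. \<integral>\<^sup>+y. tuple_weight m (window k) D y * void_weight m y \<partial>(tuples m)) \<longlonglongrightarrow>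
      (\<integral>\<^sup>+y. tuple_weight m (- {v}) D y * void_weight m y \<partial>(tuples m))"
    proof (rule nn_integral_LIMSEQ)
      show "incseq (\<lambda>k y. tuple_weight m (window k) D y * void_weight m y)"
        unfolding incseq_def le_fun_def tuple_weight_def prod_indicator_eq
        by (intro allI impI mult_right_mono) (use window_mono in \<open>auto dest: subsetD\<close>)
      show "(\<lambda>y. tuple_weight m (window k) D y * void_weight m y) \<in> borel_measurable (tuples m)" for k
        using tuple_weight_measurable_Lambda[OF window(1) D] by measurable
      show "(\<lambda>k. tuple_weight m (window k) D y * void_weight m y) \<longlonglongrightarrow> tuple_weight m (- {v}) D y * void_weight m y" for y
      proof (rule tendsto_eventually)
        have "eventually (\<lambda>k. indicator (window k) z = (indicator (- {v}) z :: ennreal)) sequentially" for z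
        proof (cases "z = v")
          case True then show ?thesis using window(2) by (simp add: indicator_def)
        next
          case False
          then have "z \<in> (\<Union>l. window l)" unfolding UN_window by simp
          then obtain l0 where "z \<in> window l0" by auto
          then have "z \<in> window l" if "l \<ge> l0" for l using window_mono[OF that] by auto
          then show ?thesis using False by (auto simp: eventually_sequentially indicator_def)
        qed
        then have "eventually (\<lambda>k. \<forall>j\<in>{..<m}. indicator (window k) (y j) = (indicator (- {v}) (y j) :: ennreal)) sequentially"
          by (intro eventually_ball_finite) auto
        then show "eventually (\<lambda>k. tuple_weight m (window k) D y * void_weight m y = tuple_weight m (- {v}) D y * void_weight m y) sequentially"
          by eventually_elim (auto simp: tuple_weight_def intro!: arg_cong2[where f="(*)"] prod.cong)
      qed
    qed
  qed simp
  ultimately show ?thesis by (simp add: LIMSEQ_unique)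
qed

lemma component_event:
  "{\<omega>\<in>space M. num_vertices (component (E \<omega>) v) = enat (Suc m) \<and> phi_lambda \<Lambda> \<phi> (component (E \<omega>) v) \<in> D} =
    (\<Union>p\<in>cluster_labels m. global_event (- {v}) D (fst p) (snd p))" (is "?L = ?R")
proof (intro equalityI subsetI)
  fix \<omega> assume w: "\<omega> \<in> ?L"
  then have \<omega>: "\<omega> \<in> space M" and card: "num_vertices (component (E \<omega>) v) = enat (Suc m)"
    and phiD: "phi_lambda \<Lambda> \<phi> (component (E \<omega>) v) \<in> D" by simp_all
  define V where "V = component (iedges \<omega>) (root_index \<omega>)"
  define I where "I = V - {root_index \<omega>}"
  have root: "enat (root_index \<omega>) < K \<omega>" "X (root_index \<omega>) \<omega> = v" using root_iff[OF \<omega>, of "root_index \<omega>"] by auto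
  have VK: "V \<subseteq> {i. enat i < K \<omega>}" unfolding V_def by (rule component_iedges_subset[OF \<omega>])
  have inj: "inj_on (pos \<omega>) V" using X_inj[OF \<omega>] VK by (auto simp: inj_on_def)
  have C: "component (E \<omega>) v = (pos \<omega>) ` V" unfolding V_def by (rule component_iedges[OF \<omega>])
  have rV: "root_index \<omega> \<in> V" by (simp add: V_def)
  have VI: "V = insert (root_index \<omega>) I" using rV by (auto simp: I_def)
  have "finite V \<and> card V = Suc m"
    using card finite_image_iff[OF inj] card_image[OF inj] unfolding C num_vertices_def by (auto split: if_splits)
  then have I: "finite I" "card I = m" using rV by (auto simp: I_def)
  have "X i \<omega> \<noteq> v" if "i \<in> I" for i
    using X_inj[OF \<omega>, of i "root_index \<omega>"] root that VK by (auto simp: I_def)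
  then have "\<omega> \<in> global_event (- {v}) D (root_index \<omega>) I"
  proof -
    have "hit_integral \<Lambda> \<phi> (insert (root_index \<omega>) I) (pos \<omega>) \<in> D"
      using phiD phi_lambda_image[OF inj, of \<Lambda> \<phi>] unfolding C VI by simp
    moreover have "I \<subseteq> idx (- {v}) \<omega>"
      using VK \<open>\<And>i. i \<in> I \<Longrightarrow> X i \<omega> \<noteq> v\<close> VI by (auto simp: idx_def)
    moreover have "component (iedges \<omega>) (root_index \<omega>) = insert (root_index \<omega>) I"
      using VI by (simp add: V_def)
    ultimately show ?thesis using \<omega> root by (simp add: global_event_def root_event_def)
  qed
  then show "\<omega> \<in> ?R" using I by (intro UN_I[of "(root_index \<omega>, I)"]) (auto simp: cluster_labels_def)
next
  fix \<omega> assume "\<omega> \<in> ?R"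
  then obtain r I where p: "finite I" "card I = m" and w: "\<omega> \<in> global_event (- {v}) D r I"
    by (auto simp: cluster_labels_def)
  have \<omega>: "\<omega> \<in> space M" using w by (auto simp: global_event_def root_event_def)
  have r: "r = root_index \<omega>" using w root_iff[OF \<omega>, of r] by (auto simp: global_event_def root_event_def)
  have V: "component (iedges \<omega>) (root_index \<omega>) = insert r I" using w r by (auto simp: global_event_def)
  have rI: "r \<notin> I" using w by (auto simp: global_event_def root_event_def idx_def)
  have inj: "inj_on (pos \<omega>) (insert r I)"
    using X_inj[OF \<omega>] component_iedges_subset[OF \<omega>] unfolding V by (auto simp: inj_on_def)
  have C: "component (E \<omega>) v = (pos \<omega>) ` insert r I"
    using component_iedges[OF \<omega>] unfolding V .
  have "num_vertices (component (E \<omega>) v) = enat (Suc m)"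
    unfolding C num_vertices_def using p rI card_image[OF inj] by simp
  moreover have "phi_lambda \<Lambda> \<phi> (component (E \<omega>) v) \<in> D"
    unfolding C phi_lambda_image[OF inj] using w by (simp add: global_event_def root_event_def)
  ultimately show "\<omega> \<in> ?L" using \<omega> by simp
qed

lemma component_event_sets:
  assumes "D \<in> sets borel"
  shows "{\<omega>\<in>space M. num_vertices (component (E \<omega>) v) = enat (Suc m) \<and> phi_lambda \<Lambda> \<phi> (component (E \<omega>) v) \<in> D} \<in> sets M"
  unfolding component_event
proof (rule sets.countable_UN'[OF countable_cluster_labels])
  show "(\<lambda>p. global_event (- {v}) D (fst p) (snd p)) ` cluster_labels m \<subseteq> sets M"
    using assms by (auto simp: cluster_labels_def intro!: global_event_sets)
qed

text \<open>The index sets \<open>r\<close> and \<open>I\<close> are determined by the graph, so that the events are disjoint and their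
probabilities add up to that of the cluster having \<open>m + 1\<close> vertices.\<close>

lemma emeasure_component_event:
  assumes D: "D \<in> sets borel"
  shows "emeasure M {\<omega>\<in>space M. num_vertices (component (E \<omega>) v) = enat (Suc m) \<and> phi_lambda \<Lambda> \<phi> (component (E \<omega>) v) \<in> D} =
    (\<integral>\<^sup>+a. ennreal (t ^ m * exp (- t * a)) * indicator D a \<partial>cluster_measure \<Lambda> \<phi> v m)"
proof -
  have hit [measurable]: "(\<lambda>y. rooted_hit m y) \<in> borel_measurable (tuples m)"
    by (subst measurable_cong_sets[OF sets_tuples refl], intro hit_integral_measurable rooted_measurable)
  have conn [measurable]: "(\<lambda>y. rooted_conn m y) \<in> borel_measurable (tuples m)"
    by (subst measurable_cong_sets[OF sets_tuples refl], intro conn_prob_measurable rooted_measurable)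
  define S where "S = {y. (\<forall>j<m. y j \<noteq> v) \<and> integrable \<Lambda> (\<lambda>z. 1 - rooted_avoid m y z)}"
  have S: "(indicator S :: _ \<Rightarrow> ennreal) \<in> borel_measurable (tuples m)"
  proof -
    have [measurable]: "(\<lambda>y. y j) \<in> borel_measurable (tuples m)" if "j \<in> {..<m}" for j
      using measurable_component_singleton[OF that, of "\<lambda>_. \<Lambda>"] by (simp add: measurable_cong_sets[OF refl sets_Lambda])
    have "{y\<in>space (tuples m). \<forall>j\<in>{..<m}. y j \<noteq> v} \<in> sets (tuples m)" by measurable
    from sets.Int[OF this integrable_measurable]
    have "S \<inter> space (tuples m) \<in> sets (tuples m)"
      by (rule back_subst[of "\<lambda>A. A \<in> _"]) (auto simp: S_def)
    then show ?thesis by (simp add: borel_measurable_indicator_iff)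
  qed
  have disj: "disjoint_family_on (\<lambda>p. global_event (- {v}) D (fst p) (snd p)) (cluster_labels m)"
  proof (unfold disjoint_family_on_def, intro ballI impI equals0I)
    fix p q \<omega> assume pq: "p \<in> cluster_labels m" "q \<in> cluster_labels m" "p \<noteq> q"
      and w: "\<omega> \<in> global_event (- {v}) D (fst p) (snd p) \<inter> global_event (- {v}) D (fst q) (snd q)"
    have \<omega>: "\<omega> \<in> space M" using w by (auto simp: global_event_def root_event_def)
    have "fst p = root_index \<omega>" using w root_iff[OF \<omega>, of "fst p"] by (simp add: global_event_def root_event_def)
    moreover have "fst q = root_index \<omega>" using w root_iff[OF \<omega>, of "fst q"] by (simp add: global_event_def root_event_def)
    ultimately have "fst p = fst q" by simp
    moreover from this have "insert (fst p) (snd p) = insert (fst p) (snd q)"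
      using w by (auto simp: global_event_def)
    moreover have "fst p \<notin> snd p" "fst q \<notin> snd q" using w by (auto simp: global_event_def root_event_def idx_def)
    ultimately have "p = q" using insert_ident[of "fst p" "snd p" "snd q"] by (intro prod_eqI) simp_all
    then show False using pq by simp
  qed
  have "emeasure M {\<omega>\<in>space M. num_vertices (component (E \<omega>) v) = enat (Suc m) \<and> phi_lambda \<Lambda> \<phi> (component (E \<omega>) v) \<in> D} =
    (\<integral>\<^sup>+p. emeasure M (global_event (- {v}) D (fst p) (snd p)) \<partial>count_space (cluster_labels m))"
    unfolding component_event
    by (intro emeasure_UN_countable disj countable_cluster_labels global_event_sets D) (auto simp: cluster_labels_def)
  also have "\<dots> = ennreal (t ^ m / fact m) * (\<integral>\<^sup>+y. tuple_weight m (- {v}) D y * void_weight m y \<partial>(tuples m))"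
    by (rule sum_emeasure_global_event[OF D])
  also have "\<dots> = (\<integral>\<^sup>+y. ennreal (t ^ m / fact m) * (tuple_weight m (- {v}) D y * void_weight m y) \<partial>(tuples m))"
    using tuple_weight_measurable_Lambda[of "- {v}" D] D by (intro nn_integral_cmult[symmetric]) auto
  also have "\<dots> = (\<integral>\<^sup>+y. (ennreal (rooted_conn m y / fact m) * indicator S y) *
      (ennreal (t ^ m * exp (- t * rooted_hit m y)) * indicator D (rooted_hit m y))
      \<partial>(tuples m))"
  proof (rule nn_integral_cong)
    fix y
    let ?h = "rooted_hit m y" and ?c = "rooted_conn m y"
    have "ennreal (t ^ m / fact m) * (ennreal ?c * ennreal (exp (- t * ?h))) =
      ennreal (?c / fact m) * ennreal (t ^ m * exp (- t * ?h))"
      using t_pos conn_prob_nonneg[of "{..m}" m "y(m := v)"] by (simp add: ennreal_mult'[symmetric])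
    then show "ennreal (t ^ m / fact m) * (tuple_weight m (- {v}) D y * void_weight m y) =
      (ennreal (?c / fact m) * indicator S y) * (ennreal (t ^ m * exp (- t * ?h)) * indicator D ?h)"
      unfolding tuple_weight_def void_weight_def prod_indicator_eq S_def by (simp add: indicator_def)
  qed
  also have "\<dots> = (\<integral>\<^sup>+a. ennreal (t ^ m * exp (- t * a)) * indicator D a \<partial>cluster_measure \<Lambda> \<phi> v m)"
    unfolding cluster_measure_def S_def[symmetric] using D S
    by (subst nn_integral_distr) (auto simp: nn_integral_density)
  finally show ?thesis .
qed

end

section \<open>Series of mixed gamma weights\<close>

lemma abs_exp_diff_le:
  fixes x y :: real
  shows "\<bar>exp x - exp y\<bar> \<le> \<bar>x - y\<bar> * (exp x + exp y)"
proof -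
  have *: "exp x - exp y \<le> \<bar>x - y\<bar> * (exp x + exp y)" for x y :: real
  proof -
    have "1 + (y - x) \<le> exp (y - x)" by (rule exp_ge_add_one_self)
    then have "exp x * (1 + (y - x)) \<le> exp x * exp (y - x)" by (intro mult_left_mono) auto
    also have "exp x * exp (y - x) = exp y" by (simp flip: exp_add)
    finally have "exp x - exp y \<le> (x - y) * exp x" by (simp add: algebra_simps)
    also have "\<dots> \<le> \<bar>x - y\<bar> * (exp x + exp y)" by (intro mult_mono) auto
    finally show ?thesis .
  qed
  show ?thesis using *[of x y] *[of y x] by (simp add: abs_le_iff abs_minus_commute add.commute)
qed

text \<open>For all \<open>s\<close> near \<open>t\<close>, the derivative of \<open>s \<mapsto> exp (- s a)\<close> is bounded by the same combination of
exponential functions of \<open>a\<close>. This serves as an integrable bound for difference quotients.\<close>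

lemma abs_mult_exp_le:
  fixes a h s t :: real
  assumes h: "h > 0" and s: "\<bar>s - t\<bar> \<le> h"
  shows "\<bar>a\<bar> * exp (- s * a) \<le> (exp (- (t + 2 * h) * a) + exp (- (t - 2 * h) * a)) * (2 / h)"
proof -
  have "h * \<bar>a\<bar> \<le> exp (h * \<bar>a\<bar>)" using exp_ge_add_one_self[of "h * \<bar>a\<bar>"] by linarith
  then have a: "\<bar>a\<bar> \<le> exp (h * \<bar>a\<bar>) / h" using h by (simp add: field_simps)
  have "- s * a = - t * a + (t - s) * a" by (simp add: algebra_simps)
  also have "(t - s) * a \<le> \<bar>t - s\<bar> * \<bar>a\<bar>" by (metis abs_ge_self abs_mult)
  also have "\<dots> \<le> h * \<bar>a\<bar>" using s by (intro mult_right_mono) (auto simp: abs_minus_commute)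
  finally have "exp (- s * a) \<le> exp (- t * a + h * \<bar>a\<bar>)" by simp
  then have "\<bar>a\<bar> * exp (- s * a) \<le> (exp (h * \<bar>a\<bar>) / h) * exp (- t * a + h * \<bar>a\<bar>)"
    using a h by (intro mult_mono) auto
  also have "\<dots> = exp (- t * a + 2 * h * \<bar>a\<bar>) / h"
    by (simp flip: exp_add add: algebra_simps)
  also have "\<dots> \<le> (exp (- (t + 2 * h) * a) + exp (- (t - 2 * h) * a)) / h"
  proof (intro divide_right_mono)
    show "exp (- t * a + 2 * h * \<bar>a\<bar>) \<le> exp (- (t + 2 * h) * a) + exp (- (t - 2 * h) * a)"
      by (cases "a \<ge> 0") (auto simp: algebra_simps)
  qed (use h in auto)
  also have "\<dots> \<le> (exp (- (t + 2 * h) * a) + exp (- (t - 2 * h) * a)) * (2 / h)"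
    using h by (simp add: field_simps add_nonneg_nonneg)
  finally show ?thesis .
qed

text \<open>Differentiation under the integral. The weight \<open>w\<close> allows the lemma to be applied to its own result.\<close>

lemma laplace_transform_deriv:
  fixes w :: "real \<Rightarrow> real"
  assumes sets: "sets \<nu> = sets borel" and w: "w \<in> borel_measurable borel"
    and int: "\<And>t. t > 0 \<Longrightarrow> integrable \<nu> (\<lambda>a. w a * exp (- t * a))" and t: "t > 0"
  shows "integrable \<nu> (\<lambda>a. a * w a * exp (- t * a))" (is ?int)
    and "((\<lambda>t. \<integral>a. w a * exp (- t * a) \<partial>\<nu>) has_real_derivative - (\<integral>a. a * w a * exp (- t * a) \<partial>\<nu>)) (at t)" (is ?deriv)
proof -
  note sets[measurable_cong] w[measurable]
  \<comment> \<open>With this choice \<open>t - 2 h > 0\<close>, so that all exponential functions in the bound \<open>B\<close> are integrable.\<close>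
  define h where "h = t / 4"
  have h: "h > 0" "t - 2 * h > 0" "t + 2 * h > 0" using t by (auto simp: h_def)
  define B where "B a = \<bar>w a\<bar> * ((exp (- (t + 2 * h) * a) + exp (- (t - 2 * h) * a)) * (2 / h))" for a
  have B_eq: "B = (\<lambda>a. (\<bar>w a * exp (- (t + 2 * h) * a)\<bar> + \<bar>w a * exp (- (t - 2 * h) * a)\<bar>) * (2 / h))"
    by (simp add: B_def fun_eq_iff abs_mult algebra_simps)
  have B: "integrable \<nu> B"
    unfolding B_eq by (intro integrable_mult_left Bochner_Integration.integrable_add integrable_abs int h)
  have B0: "B a \<ge> 0" for a using h by (auto simp: B_def intro!: mult_nonneg_nonneg add_nonneg_nonneg)
  show ?int
  proof (rule Bochner_Integration.integrable_bound[OF B])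
    show "AE a in \<nu>. norm (a * w a * exp (- t * a)) \<le> norm (B a)"
    proof (rule AE_I2)
      fix a
      have "\<bar>w a\<bar> * (\<bar>a\<bar> * exp (- t * a)) \<le> B a"
        unfolding B_def using h by (intro mult_left_mono abs_mult_exp_le) auto
      then show "norm (a * w a * exp (- t * a)) \<le> norm (B a)" using B0[of a] by (simp add: abs_mult mult_ac)
    qed
  qed measurable
  have "((\<lambda>s. ((\<integral>a. w a * exp (- s * a) \<partial>\<nu>) - (\<integral>a. w a * exp (- t * a) \<partial>\<nu>)) / (s - t)) \<longlongrightarrow>
    - (\<integral>a. a * w a * exp (- t * a) \<partial>\<nu>)) (at t)"
    unfolding tendsto_at_iff_sequentially
  proof (intro allI impI)
    fix S assume S: "\<forall>i. S i \<in> UNIV - {t}" and lim: "S \<longlonglongrightarrow> t"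
    have "eventually (\<lambda>i. \<bar>S i - t\<bar> \<le> h) sequentially"
      using tendstoD[OF lim h(1)] by eventually_elim (simp add: dist_real_def)
    then obtain N where N: "\<And>i. i \<ge> N \<Longrightarrow> \<bar>S i - t\<bar> \<le> h" by (auto simp: eventually_sequentially)
    define q where "q i a = w a * ((exp (- S (i + N) * a) - exp (- t * a)) / (S (i + N) - t))" for i a
    have "(\<lambda>i. \<integral>a. q i a \<partial>\<nu>) \<longlonglongrightarrow> (\<integral>a. w a * (- a * exp (- t * a)) \<partial>\<nu>)"
    proof (rule integral_dominated_convergence[where w="\<lambda>a. 2 * B a"])
      show "AE a in \<nu>. (\<lambda>i. q i a) \<longlonglongrightarrow> w a * (- a * exp (- t * a))"
      proof (rule AE_I2)
        fix a
        have "((\<lambda>s. exp (- s * a)) has_real_derivative - a * exp (- t * a)) (at t)"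
          by (auto intro!: derivative_eq_intros)
        then have "((\<lambda>s. (exp (- s * a) - exp (- t * a)) / (s - t)) \<longlongrightarrow> - a * exp (- t * a)) (at t)"
          by (simp add: has_field_derivative_iff)
        then have "((\<lambda>s. (exp (- s * a) - exp (- t * a)) / (s - t)) \<circ> S) \<longlonglongrightarrow> - a * exp (- t * a)"
          using S lim unfolding tendsto_at_iff_sequentially by blast
        then have "(\<lambda>i. (exp (- S (i + N) * a) - exp (- t * a)) / (S (i + N) - t)) \<longlonglongrightarrow> - a * exp (- t * a)"
          unfolding comp_def by (rule LIMSEQ_ignore_initial_segment)
        then show "(\<lambda>i. q i a) \<longlonglongrightarrow> w a * (- a * exp (- t * a))"
          unfolding q_def by (intro tendsto_mult tendsto_const)
      qed
      show "AE a in \<nu>. norm (q i a) \<le> 2 * B a" for i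
      proof (rule AE_I2)
        fix a
        let ?s = "S (i + N)"
        have st: "?s \<noteq> t" "\<bar>?s - t\<bar> \<le> h" using S N[of "i + N"] by auto
        have "\<bar>exp (- ?s * a) - exp (- t * a)\<bar> \<le> \<bar>- ?s * a - - t * a\<bar> * (exp (- ?s * a) + exp (- t * a))"
          by (rule abs_exp_diff_le)
        also have "\<bar>- ?s * a - - t * a\<bar> = \<bar>?s - t\<bar> * \<bar>a\<bar>"
          by (simp flip: abs_mult add: algebra_simps abs_minus_commute)
        finally have "\<bar>(exp (- ?s * a) - exp (- t * a)) / (?s - t)\<bar> \<le> \<bar>a\<bar> * exp (- ?s * a) + \<bar>a\<bar> * exp (- t * a)"
          using st by (simp add: field_simps)
        also have "\<dots> \<le> (exp (- (t + 2 * h) * a) + exp (- (t - 2 * h) * a)) * (2 / h) +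
            (exp (- (t + 2 * h) * a) + exp (- (t - 2 * h) * a)) * (2 / h)"
          using h st by (intro add_mono abs_mult_exp_le) auto
        finally have "\<bar>w a\<bar> * \<bar>(exp (- ?s * a) - exp (- t * a)) / (?s - t)\<bar> \<le> \<bar>w a\<bar> *
           ((exp (- (t + 2 * h) * a) + exp (- (t - 2 * h) * a)) * (2 / h) +
            (exp (- (t + 2 * h) * a) + exp (- (t - 2 * h) * a)) * (2 / h))"
          by (intro mult_left_mono) auto
        also have "\<dots> = 2 * B a" unfolding B_def by (simp only: distrib_left mult_2)
        finally show "norm (q i a) \<le> 2 * B a" unfolding q_def real_norm_def abs_mult .
      qed
    qed (use B in \<open>auto simp: q_def\<close>)
    also have "(\<integral>a. w a * (- a * exp (- t * a)) \<partial>\<nu>) = - (\<integral>a. a * w a * exp (- t * a) \<partial>\<nu>)"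
      by (simp flip: Bochner_Integration.integral_minus add: mult_ac)
    finally have "(\<lambda>i. \<integral>a. q i a \<partial>\<nu>) \<longlonglongrightarrow> - (\<integral>a. a * w a * exp (- t * a) \<partial>\<nu>)" .
    moreover have "(\<integral>a. q i a \<partial>\<nu>) = ((\<integral>a. w a * exp (- S (i + N) * a) \<partial>\<nu>) - (\<integral>a. w a * exp (- t * a) \<partial>\<nu>)) / (S (i + N) - t)" for i
    proof -
      have "- (S (i + N) - t) \<le> h" by (rule abs_le_D2[OF N]) simp
      then have "S (i + N) > 0" using t unfolding h_def by linarith
      then have "(\<integral>a. w a * exp (- S (i + N) * a) - w a * exp (- t * a) \<partial>\<nu>) =
        (\<integral>a. w a * exp (- S (i + N) * a) \<partial>\<nu>) - (\<integral>a. w a * exp (- t * a) \<partial>\<nu>)"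
        using int t by (intro Bochner_Integration.integral_diff) auto
      moreover have "q i = (\<lambda>a. (w a * exp (- S (i + N) * a) - w a * exp (- t * a)) / (S (i + N) - t))"
        by (simp add: q_def fun_eq_iff right_diff_distrib)
      ultimately show ?thesis by simp
    qed
    ultimately have "(\<lambda>i. ((\<integral>a. w a * exp (- S (i + N) * a) \<partial>\<nu>) - (\<integral>a. w a * exp (- t * a) \<partial>\<nu>)) / (S (i + N) - t))
      \<longlonglongrightarrow> - (\<integral>a. a * w a * exp (- t * a) \<partial>\<nu>)" by simp
    then have "(\<lambda>i. ((\<integral>a. w a * exp (- S i * a) \<partial>\<nu>) - (\<integral>a. w a * exp (- t * a) \<partial>\<nu>)) / (S i - t))
      \<longlonglongrightarrow> - (\<integral>a. a * w a * exp (- t * a) \<partial>\<nu>)"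
      by (rule LIMSEQ_offset)
    then show "((\<lambda>s. ((\<integral>a. w a * exp (- s * a) \<partial>\<nu>) - (\<integral>a. w a * exp (- t * a) \<partial>\<nu>)) / (s - t)) \<circ> S) \<longlonglongrightarrow>
      - (\<integral>a. a * w a * exp (- t * a) \<partial>\<nu>)"
      by (simp add: comp_def)
  qed
  then show ?deriv by (simp add: has_field_derivative_iff)
qed

text \<open>The weight at \<open>t (1 + \<epsilon>)\<close> is the weight at \<open>t\<close> times \<open>(1 + \<epsilon>)\<^sup>m exp (- \<epsilon> t a)\<close>, which is roughly
\<open>exp (\<epsilon> (m - t a) - \<epsilon>\<^sup>2 m / 2)\<close>. Taking \<open>\<epsilon> = \<delta>\<close> or \<open>\<epsilon> = - \<delta>\<close> according to the sign of \<open>m - t a\<close>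
makes this large.\<close>

lemma gamma_weight_tilt:
  fixes t a \<delta> :: real and m :: nat
  assumes t: "t > 0" and \<delta>: "0 < \<delta>" "\<delta> \<le> 1/2"
  shows "t ^ m * exp (- t * a) \<le> exp (2 * \<delta>\<^sup>2 * m - \<delta> * \<bar>m - t * a\<bar>) *
    ((t * (1 - \<delta>)) ^ m * exp (- (t * (1 - \<delta>)) * a) + (t * (1 + \<delta>)) ^ m * exp (- (t * (1 + \<delta>)) * a))"
proof -
  have key: "t ^ m * exp (- t * a) \<le> exp (2 * \<delta>\<^sup>2 * m - \<delta> * \<bar>m - t * a\<bar>) * ((t * (1 + \<epsilon>)) ^ m * exp (- (t * (1 + \<epsilon>)) * a))"
    if \<epsilon>: "\<epsilon> - 2 * \<delta>\<^sup>2 \<le> ln (1 + \<epsilon>)" "1 + \<epsilon> > 0" and sgn: "\<epsilon> * (m - t * a) = \<delta> * \<bar>m - t * a\<bar>" for \<epsilon>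
  proof -
    have "t ^ m * exp (- t * a) = t ^ m * (1 + \<epsilon>) ^ m * exp (- (m * ln (1 + \<epsilon>)) - t * a)"
    proof -
      have "(1 + \<epsilon>) ^ m = exp (m * ln (1 + \<epsilon>))" using \<epsilon> by (simp add: exp_of_nat_mult)
      then show ?thesis by (simp add: mult.assoc flip: exp_add)
    qed
    also have "\<dots> \<le> t ^ m * (1 + \<epsilon>) ^ m * exp (2 * \<delta>\<^sup>2 * m - \<delta> * \<bar>m - t * a\<bar> - (t * (1 + \<epsilon>)) * a)"
    proof (intro mult_left_mono)
      have "real m * (\<epsilon> - 2 * \<delta>\<^sup>2) \<le> m * ln (1 + \<epsilon>)" using \<epsilon> by (intro mult_left_mono) auto
      moreover have "\<delta> * \<bar>m - t * a\<bar> = \<epsilon> * m - t * \<epsilon> * a" using sgn by (simp add: algebra_simps)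
      ultimately show "exp (- (m * ln (1 + \<epsilon>)) - t * a) \<le> exp (2 * \<delta>\<^sup>2 * m - \<delta> * \<bar>m - t * a\<bar> - (t * (1 + \<epsilon>)) * a)"
        by (simp add: algebra_simps)
    qed (use t \<epsilon> in auto)
    also have "\<dots> = exp (2 * \<delta>\<^sup>2 * m - \<delta> * \<bar>m - t * a\<bar>) * ((t * (1 + \<epsilon>)) ^ m * exp (- (t * (1 + \<epsilon>)) * a))"
    proof -
      have "exp (2 * \<delta>\<^sup>2 * m - \<delta> * \<bar>m - t * a\<bar> - (t * (1 + \<epsilon>)) * a) =
        exp (2 * \<delta>\<^sup>2 * m - \<delta> * \<bar>m - t * a\<bar>) * exp (- (t * (1 + \<epsilon>)) * a)"
        by (simp flip: exp_add)
      then show ?thesis by (simp only: power_mult_distrib mult_ac)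
    qed
    finally show ?thesis .
  qed
  have nn: "0 \<le> (t * (1 - \<delta>)) ^ m * exp (- (t * (1 - \<delta>)) * a)" "0 \<le> (t * (1 + \<delta>)) ^ m * exp (- (t * (1 + \<delta>)) * a)"
    using t \<delta> by auto
  show ?thesis
  proof (cases "m - t * a \<ge> 0")
    case True
    have "\<delta> - \<delta>\<^sup>2 \<le> ln (1 + \<delta>)" using \<delta> by (intro ln_one_plus_pos_lower_bound) auto
    then have "t ^ m * exp (- t * a) \<le> exp (2 * \<delta>\<^sup>2 * m - \<delta> * \<bar>m - t * a\<bar>) * ((t * (1 + \<delta>)) ^ m * exp (- (t * (1 + \<delta>)) * a))"
      using True \<delta> by (intro key) (auto simp: power2_eq_square intro: order_trans[rotated])
    also have "\<dots> \<le> exp (2 * \<delta>\<^sup>2 * m - \<delta> * \<bar>m - t * a\<bar>) *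
      ((t * (1 - \<delta>)) ^ m * exp (- (t * (1 - \<delta>)) * a) + (t * (1 + \<delta>)) ^ m * exp (- (t * (1 + \<delta>)) * a))"
      using nn by (intro mult_left_mono) auto
    finally show ?thesis .
  next
    case False
    have "- \<delta> - 2 * \<delta>\<^sup>2 \<le> ln (1 - \<delta>)" using \<delta> by (intro ln_one_minus_pos_lower_bound) auto
    then have "t ^ m * exp (- t * a) \<le> exp (2 * \<delta>\<^sup>2 * m - \<delta> * \<bar>m - t * a\<bar>) * ((t * (1 + - \<delta>)) ^ m * exp (- (t * (1 + - \<delta>)) * a))"
      using False \<delta> by (intro key) (auto simp: algebra_simps)
    also have "\<dots> \<le> exp (2 * \<delta>\<^sup>2 * m - \<delta> * \<bar>m - t * a\<bar>) *
      ((t * (1 - \<delta>)) ^ m * exp (- (t * (1 - \<delta>)) * a) + (t * (1 + \<delta>)) ^ m * exp (- (t * (1 + \<delta>)) * a))"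
      using nn by (intro mult_left_mono) auto
    finally show ?thesis .
  qed
qed

lemma mult_exp_decreasing:
  fixes d s \<delta> :: real
  assumes "s \<le> d" "1 \<le> \<delta> * s" "0 < s"
  shows "d * exp (- \<delta> * d) \<le> s * exp (- \<delta> * s)"
proof -
  have "d / s = 1 + (d - s) * (1 / s)" using assms by (simp add: field_simps)
  also have "\<dots> \<le> 1 + (d - s) * \<delta>"
    using assms by (intro add_left_mono mult_left_mono) (auto simp: field_simps)
  also have "\<dots> \<le> exp ((d - s) * \<delta>)" by (rule exp_ge_add_one_self)
  finally have "d \<le> s * exp ((d - s) * \<delta>)" using assms by (simp add: field_simps)
  then have "d * exp (- \<delta> * d) \<le> s * exp ((d - s) * \<delta>) * exp (- \<delta> * d)" by (intro mult_right_mono) auto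
  also have "\<dots> = s * exp (- \<delta> * s)" by (simp add: mult.assoc flip: exp_add) (simp add: algebra_simps)
  finally show ?thesis .
qed

lemma half_le_ln_2: "1 / 2 \<le> ln (2 :: real)"
  by (subst ln_ge_iff) (use exp_bound_half[of "1 / 2 :: real"] in simp_all)

text \<open>Deviations \<open>|m - t a|\<close> beyond this bound are negligible; the factor \<open>4\<close> yields the summable factor
\<open>1 / m\<^sup>2\<close> in the next lemma.\<close>

definition spread :: "nat \<Rightarrow> real" where
  "spread m = 4 * sqrt (m * ln m)"

text \<open>For \<open>\<delta> = sqrt (ln m / m)\<close> the factor from \<open>gamma_weight_tilt\<close> is \<open>exp (2 ln m - \<delta> d)\<close> at the deviation
\<open>d\<close>. At \<open>d = spread m\<close> it equals \<open>1 / m\<^sup>2\<close>, and beyond this point even \<open>d exp (- \<delta> d)\<close> is decreasing.\<close>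

lemma deviation_weight_le:
  fixes t a :: real and m :: nat
  defines "\<delta> \<equiv> sqrt (ln m / m)"
  assumes t: "t > 0" and m: "m \<ge> 2" "ln m / m \<le> 1 / 4"
  shows "\<bar>m - t * a\<bar> * (t ^ m * exp (- t * a)) \<le> spread m * (t ^ m * exp (- t * a) +
    ((t * (1 - \<delta>)) ^ m * exp (- (t * (1 - \<delta>)) * a) + (t * (1 + \<delta>)) ^ m * exp (- (t * (1 + \<delta>)) * a)) / (real m)\<^sup>2)"
    (is "_ \<le> spread m * (?w + ?q / _)")
proof -
  have ln2: "1/2 \<le> ln (real m)"
  proof -
    have "1/2 \<le> ln (2::real)" by (rule half_le_ln_2)
    also have "\<dots> \<le> ln (real m)" using m by simp
    finally show ?thesis .
  qed
  have mpos: "real m > 0" using m by simp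
  have \<delta>: "0 < \<delta>"
    unfolding \<delta>_def using ln2 mpos by (intro real_sqrt_gt_zero divide_pos_pos) linarith+
  have \<delta>2: "\<delta> \<le> 1/2"
    unfolding \<delta>_def using m by (intro real_le_lsqrt) (auto simp: power2_eq_square)
  have sq: "\<delta>\<^sup>2 * m = ln m" using ln2 mpos by (simp add: \<delta>_def)
  have s0: "spread m > 0"
    unfolding spread_def using ln2 mpos by (intro mult_pos_pos real_sqrt_gt_zero) linarith+
  have ds: "\<delta> * spread m = 4 * ln m"
  proof -
    have "sqrt (ln m / m) * sqrt (m * ln m) = sqrt ((ln m)\<^sup>2)"
      using mpos by (simp flip: real_sqrt_mult add: power2_eq_square)
    then show ?thesis using ln2 by (simp add: \<delta>_def spread_def)
  qed
  have w0: "?w \<ge> 0" using t by simp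
  have q0: "?q \<ge> 0" using t \<delta> \<delta>2 by (intro add_nonneg_nonneg mult_nonneg_nonneg) auto
  show ?thesis
  proof (cases "\<bar>m - t * a\<bar> \<le> spread m")
    case True
    then have "\<bar>m - t * a\<bar> * ?w \<le> spread m * ?w" using w0 by (intro mult_right_mono)
    also have "\<dots> \<le> spread m * (?w + ?q / (real m)\<^sup>2)" using s0 q0 by (intro mult_left_mono) auto
    finally show ?thesis .
  next
    case False
    have "\<bar>m - t * a\<bar> * ?w \<le> \<bar>m - t * a\<bar> * (exp (2 * \<delta>\<^sup>2 * m - \<delta> * \<bar>m - t * a\<bar>) * ?q)"
      using gamma_weight_tilt[OF t \<delta> \<delta>2, of m a] by (intro mult_left_mono) auto
    also have "\<dots> = (\<bar>m - t * a\<bar> * exp (- \<delta> * \<bar>m - t * a\<bar>)) * (exp (2 * \<delta>\<^sup>2 * m) * ?q)"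
      by (simp add: exp_diff exp_minus field_simps)
    also have "\<dots> \<le> (spread m * exp (- \<delta> * spread m)) * (exp (2 * \<delta>\<^sup>2 * m) * ?q)"
      using False ds ln2 s0 q0 by (intro mult_right_mono mult_exp_decreasing) auto
    also have "\<dots> = spread m * (exp (2 * \<delta>\<^sup>2 * m - \<delta> * spread m) * ?q)"
      by (simp add: exp_diff exp_minus field_simps)
    also have "2 * \<delta>\<^sup>2 * m - \<delta> * spread m = - 2 * ln m" using sq ds by (simp add: mult.assoc)
    also have "exp (- 2 * ln (real m)) = 1 / (real m)\<^sup>2"
      using mpos by (simp add: exp_minus exp_double divide_inverse)
    also have "spread m * (1 / (real m)\<^sup>2 * ?q) \<le> spread m * (?w + ?q / (real m)\<^sup>2)"
      using s0 w0 by (intro mult_left_mono) auto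
    finally show ?thesis .
  qed
qed

text \<open>There is no bound for the terms that is both summable and independent of \<open>x\<close>, as the sums of the
\<open>p m x\<close> need not converge uniformly. The tails are nevertheless uniformly small: they are at most the
largest \<open>\<epsilon> m\<close> in the tail times a bound for the sum of all \<open>p m x + c m\<close>.\<close>

lemma uniform_limit_dominated_series:
  fixes g :: "nat \<Rightarrow> 'a \<Rightarrow> real" and p :: "nat \<Rightarrow> 'a \<Rightarrow> real"
  assumes bound: "\<And>m x. x \<in> S \<Longrightarrow> m \<ge> M \<Longrightarrow> \<bar>g m x\<bar> \<le> \<epsilon> m * (p m x + c m)"
    and p: "\<And>m x. x \<in> S \<Longrightarrow> 0 \<le> p m x" "\<And>x. x \<in> S \<Longrightarrow> summable (\<lambda>m. p m x)" "\<And>x. x \<in> S \<Longrightarrow> (\<Sum>m. p m x) \<le> 1"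
    and c: "\<And>m. 0 \<le> c m" "summable c" and \<epsilon>: "\<And>m. 0 \<le> \<epsilon> m" "\<epsilon> \<longlonglongrightarrow> 0"
  shows "uniform_limit S (\<lambda>n x. \<Sum>m<n. g m x) (\<lambda>x. \<Sum>m. g m x) sequentially"
    and "\<And>x. x \<in> S \<Longrightarrow> summable (\<lambda>m. \<bar>g m x\<bar>)"
proof -
  \<comment> \<open>A bound for the sum of all \<open>p m x + c m\<close>\<close>
  define A where "A = 1 + suminf c"
  have A: "A > 0" using suminf_nonneg[OF c(2,1)] by (simp add: A_def)
  have tail: "summable (\<lambda>m. \<bar>g (m + N) x\<bar>) \<and> (\<Sum>m. \<bar>g (m + N) x\<bar>) \<le> e * A"
    if x: "x \<in> S" and N: "N \<ge> M" "\<And>m. m \<ge> N \<Longrightarrow> \<epsilon> m \<le> e" and e: "e \<ge> 0" for x N e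
  proof -
    have le: "\<bar>g (m + N) x\<bar> \<le> e * (p (m + N) x + c (m + N))" for m
      using bound[OF x, of "m + N"] N(1) mult_right_mono[OF N(2)[of "m + N"], of "p (m + N) x + c (m + N)"]
        p(1)[OF x, of "m + N"] c(1)[of "m + N"] by auto
    have sp: "summable (\<lambda>m. p (m + N) x)" "summable (\<lambda>m. c (m + N))"
      using summable_iff_shift[of "\<lambda>m. p m x" N] p(2)[OF x] c(2) by (simp_all add: summable_iff_shift)
    have s: "summable (\<lambda>m. e * (p (m + N) x + c (m + N)))" using sp by (intro summable_mult summable_add)
    have sg: "summable (\<lambda>m. \<bar>g (m + N) x\<bar>)"
      by (rule summable_comparison_test'[OF s, of 0]) (use le in auto)
    have shift: "(\<Sum>m. h (m + N)) \<le> suminf h" if "\<And>m. 0 \<le> h m" "summable h" for h :: "nat \<Rightarrow> real"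
      using suminf_minus_initial_segment[OF that(2), of N] sum_nonneg[of "{..<N}" h] that(1) by auto
    have "(\<Sum>m. \<bar>g (m + N) x\<bar>) \<le> (\<Sum>m. e * (p (m + N) x + c (m + N)))"
      by (intro suminf_le le sg s)
    also have "\<dots> = e * ((\<Sum>m. p (m + N) x) + (\<Sum>m. c (m + N)))"
      using sp by (simp add: suminf_mult suminf_add summable_add)
    also have "\<dots> \<le> e * A"
      unfolding A_def using shift[OF p(1)[OF x] p(2)[OF x]] p(3)[OF x] shift[OF c] e
      by (intro mult_left_mono add_mono) auto
    finally show ?thesis using sg by simp
  qed
  have summ: "summable (\<lambda>m. \<bar>g m x\<bar>)" if x: "x \<in> S" for x
  proof -
    have "eventually (\<lambda>m. \<epsilon> m < 1) sequentially" using \<epsilon>(2) by (rule order_tendstoD) simp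
    then obtain N where N: "\<And>m. m \<ge> N \<Longrightarrow> \<epsilon> m < 1" by (auto simp: eventually_sequentially)
    have "summable (\<lambda>m. \<bar>g (m + max M N) x\<bar>)"
      using tail[OF x, of "max M N" 1] N less_imp_le by auto
    then show ?thesis using summable_iff_shift[of "\<lambda>m. \<bar>g m x\<bar>" "max M N"] by simp
  qed
  then show "\<And>x. x \<in> S \<Longrightarrow> summable (\<lambda>m. \<bar>g m x\<bar>)" .
  show "uniform_limit S (\<lambda>n x. \<Sum>m<n. g m x) (\<lambda>x. \<Sum>m. g m x) sequentially"
  proof (rule uniform_limitI)
    fix r :: real assume r: "r > 0"
    define e where "e = r / (2 * A)"
    have e: "e > 0" "e * A < r" using r A by (auto simp: e_def)
    have "eventually (\<lambda>m. \<epsilon> m < e) sequentially" using \<epsilon>(2) e(1) by (rule order_tendstoD)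
    then obtain N where N: "\<And>m. m \<ge> N \<Longrightarrow> \<epsilon> m < e" by (auto simp: eventually_sequentially)
    show "\<forall>\<^sub>F n in sequentially. \<forall>x\<in>S. dist (\<Sum>m<n. g m x) (\<Sum>m. g m x) < r"
      unfolding eventually_sequentially
    proof (intro exI[of _ "max M N"] allI impI ballI)
      fix n x assume n: "max M N \<le> n" and x: "x \<in> S"
      have t: "summable (\<lambda>m. \<bar>g (m + n) x\<bar>)" "(\<Sum>m. \<bar>g (m + n) x\<bar>) \<le> e * A"
      proof -
        have "\<epsilon> m \<le> e" if "m \<ge> n" for m using N[of m] that n by auto
        then show "summable (\<lambda>m. \<bar>g (m + n) x\<bar>)" "(\<Sum>m. \<bar>g (m + n) x\<bar>) \<le> e * A"
          using tail[OF x, of n e] n e(1) by auto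
      qed
      have "summable (\<lambda>m. g m x)" using summ[OF x] by (rule summable_rabs_cancel)
      then have "(\<Sum>m. g m x) - (\<Sum>m<n. g m x) = (\<Sum>m. g (m + n) x)"
        by (rule suminf_minus_initial_segment[symmetric])
      then have "dist (\<Sum>m<n. g m x) (\<Sum>m. g m x) = \<bar>\<Sum>m. g (m + n) x\<bar>"
        by (simp add: dist_real_def abs_minus_commute)
      also have "\<dots> \<le> (\<Sum>m. \<bar>g (m + n) x\<bar>)" using t(1) by (rule summable_rabs)
      also have "\<dots> < r" using t(2) e(2) by simp
      finally show "dist (\<Sum>m<n. g m x) (\<Sum>m. g m x) < r" .
    qed
  qed
qed

text \<open>The measures \<open>cluster_measure\<close> have these properties, since \<open>\<integral>t\<^sup>m exp (- t a) \<mu>\<^sub>m(da)\<close> is the probability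
that the cluster has \<open>m + 1\<close> vertices. It is essential that the total mass is at most \<open>1\<close> for all \<open>t\<close>
simultaneously.\<close>

locale gamma_mixtures =
  fixes \<mu> :: "nat \<Rightarrow> real measure"
  assumes sets_mu: "\<And>m. sets (\<mu> m) = sets borel"
    and integrable_exp: "\<And>m t. t > 0 \<Longrightarrow> integrable (\<mu> m) (\<lambda>a. exp (- t * a))"
    and summable_mass: "\<And>t. t > 0 \<Longrightarrow> summable (\<lambda>m. \<integral>a. t ^ m * exp (- t * a) \<partial>\<mu> m)"
    and total_mass: "\<And>t. t > 0 \<Longrightarrow> (\<Sum>m. \<integral>a. t ^ m * exp (- t * a) \<partial>\<mu> m) \<le> 1"
begin

definition mass :: "nat \<Rightarrow> real \<Rightarrow> real" where
  "mass m t = (\<integral>a. t ^ m * exp (- t * a) \<partial>\<mu> m)"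

definition drift :: "nat \<Rightarrow> real \<Rightarrow> real" where
  "drift m t = (\<integral>a. (m - t * a) * (t ^ m * exp (- t * a)) \<partial>\<mu> m)"

definition abs_drift :: "nat \<Rightarrow> real \<Rightarrow> real" where
  "abs_drift m t = (\<integral>a. \<bar>m - t * a\<bar> * (t ^ m * exp (- t * a)) \<partial>\<mu> m)"

lemma integrable_moment: "t > 0 \<Longrightarrow> integrable (\<mu> m) (\<lambda>a. a * exp (- t * a))"
  using laplace_transform_deriv(1)[OF sets_mu, of "\<lambda>_. 1"] integrable_exp by simp

lemma integrable_mass: "t > 0 \<Longrightarrow> integrable (\<mu> m) (\<lambda>a. t ^ m * exp (- t * a))"
  using integrable_exp by simp

lemma integrable_drift:
  assumes "t > 0"
  shows "integrable (\<mu> m) (\<lambda>a. (m - t * a) * (t ^ m * exp (- t * a)))"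
proof -
  have "(\<lambda>a. (m - t * a) * (t ^ m * exp (- t * a))) = (\<lambda>a. m * t ^ m * exp (- t * a) - t * t ^ m * (a * exp (- t * a)))"
    by (simp add: fun_eq_iff algebra_simps)
  then show ?thesis using integrable_exp[OF assms] integrable_moment[OF assms] by simp
qed

lemma integrable_abs_drift:
  assumes "t > 0"
  shows "integrable (\<mu> m) (\<lambda>a. \<bar>m - t * a\<bar> * (t ^ m * exp (- t * a)))"
  using integrable_abs[OF integrable_drift[OF assms, of m]] assms by (simp add: abs_mult)

lemma mass_nonneg: "t > 0 \<Longrightarrow> 0 \<le> mass m t"
  unfolding mass_def by (intro integral_nonneg_AE) auto

lemma mass_le_1: "t > 0 \<Longrightarrow> mass m t \<le> 1"
  using sum_le_suminf[OF summable_mass[of t], of "{m}"] total_mass[of t] mass_nonneg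
  by (auto simp: mass_def)

lemma drift_le: "t > 0 \<Longrightarrow> \<bar>drift m t\<bar> \<le> abs_drift m t"
  unfolding drift_def abs_drift_def
  using integral_abs_bound[of "\<mu> m" "\<lambda>a. (m - t * a) * (t ^ m * exp (- t * a))"] by (simp add: abs_mult)

lemma mass_deriv:
  assumes t: "t > 0"
  shows "(mass m has_real_derivative inverse t * drift m t) (at t)"
proof -
  define L where "L t = (\<integral>a. 1 * exp (- t * a) \<partial>\<mu> m)" for t
  define L1 where "L1 t = (\<integral>a. a * 1 * exp (- t * a) \<partial>\<mu> m)" for t
  have L: "(L has_real_derivative - L1 t) (at t)"
    unfolding L_def L1_def using t integrable_exp by (intro laplace_transform_deriv(2)[OF sets_mu]) auto
  have "((\<lambda>t. t ^ m * L t) has_real_derivative (m * t ^ (m - 1) * L t + t ^ m * (- L1 t))) (at t)"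
    using L by (auto intro!: derivative_eq_intros)
  moreover have "mass m = (\<lambda>t. t ^ m * L t)" by (simp add: mass_def L_def fun_eq_iff)
  moreover have "drift m t = m * t ^ m * L t - t * t ^ m * L1 t"
  proof -
    have "(\<lambda>a. (m - t * a) * (t ^ m * exp (- t * a))) = (\<lambda>a. m * t ^ m * exp (- t * a) - t * t ^ m * (a * exp (- t * a)))"
      by (simp add: fun_eq_iff algebra_simps)
    then show ?thesis
      unfolding drift_def L_def L1_def using integrable_exp[OF t] integrable_moment[OF t] by simp
  qed
  then have "inverse t * drift m t = m * t ^ (m - 1) * L t + t ^ m * (- L1 t)"
    using t by (cases m) (auto simp: field_simps)
  ultimately show ?thesis by simp
qed

lemma drift_continuous: "continuous_on {0<..} (drift m)"
proof -
  have "isCont (drift m) t" if t: "t > 0" for t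
  proof -
    define L where "L t = (\<integral>a. 1 * exp (- t * a) \<partial>\<mu> m)" for t
    define L1 where "L1 t = (\<integral>a. a * exp (- t * a) \<partial>\<mu> m)" for t
    have L: "isCont L t"
      unfolding L_def using t integrable_exp
      by (intro DERIV_isCont[OF laplace_transform_deriv(2)[OF sets_mu]]) auto
    have L1: "isCont L1 t"
      unfolding L1_def using t integrable_moment
      by (intro DERIV_isCont[OF laplace_transform_deriv(2)[OF sets_mu]]) auto
    have eq: "drift m s = m * s ^ m * L s - s * s ^ m * L1 s" if s: "s > 0" for s :: real
    proof -
      have "(\<lambda>a. (m - s * a) * (s ^ m * exp (- s * a))) = (\<lambda>a. m * s ^ m * exp (- s * a) - s * s ^ m * (a * exp (- s * a)))"
        by (simp add: fun_eq_iff algebra_simps)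
      then show ?thesis
        unfolding drift_def L_def L1_def using integrable_exp[OF s] integrable_moment[OF s] by simp
    qed
    have "isCont (\<lambda>s. m * s ^ m * L s - s * s ^ m * L1 s) t"
      using L L1 by (intro continuous_intros)
    moreover have "eventually (\<lambda>s. drift m s = m * s ^ m * L s - s * s ^ m * L1 s) (nhds t)"
      using eventually_nhds_in_open[of "{0<..}" t] t eq by (auto elim: eventually_mono)
    ultimately show ?thesis by (simp add: isCont_cong)
  qed
  then show ?thesis by (intro continuous_at_imp_continuous_on) auto
qed

text \<open>The two terms with the factor \<open>1 / m\<^sup>2\<close> are masses at other intensities, which are at most \<open>1\<close>.\<close>

lemma abs_drift_le:
  assumes t: "t > 0" and m: "m \<ge> 2" "ln (real m) / m \<le> 1 / 4"
  shows "abs_drift m t \<le> spread m * (mass m t + 2 / (real m)\<^sup>2)"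
proof -
  define \<delta> where "\<delta> = sqrt (ln m / m)"
  have \<delta>: "0 \<le> \<delta>" "\<delta> \<le> 1/2"
  proof -
    show "0 \<le> \<delta>" using m by (simp add: \<delta>_def)
    show "\<delta> \<le> 1/2" unfolding \<delta>_def using m by (intro real_le_lsqrt) (auto simp: power2_eq_square)
  qed
  have t1: "t * (1 - \<delta>) > 0" "t * (1 + \<delta>) > 0" using t \<delta> by (auto intro!: mult_pos_pos)
  have "abs_drift m t \<le> (\<integral>a. spread m * (t ^ m * exp (- t * a) +
    ((t * (1 - \<delta>)) ^ m * exp (- (t * (1 - \<delta>)) * a) + (t * (1 + \<delta>)) ^ m * exp (- (t * (1 + \<delta>)) * a)) / (real m)\<^sup>2) \<partial>\<mu> m)"
    unfolding abs_drift_def \<delta>_def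
  proof (rule integral_mono[OF integrable_abs_drift[OF t]])
    show "integrable (\<mu> m) (\<lambda>a. spread m * (t ^ m * exp (- t * a) +
      ((t * (1 - sqrt (ln m / m))) ^ m * exp (- (t * (1 - sqrt (ln m / m))) * a) +
       (t * (1 + sqrt (ln m / m))) ^ m * exp (- (t * (1 + sqrt (ln m / m))) * a)) / (real m)\<^sup>2))"
      using t t1 unfolding \<delta>_def
      by (intro integrable_mult_right Bochner_Integration.integrable_add integrable_divide integrable_mass)
    show "\<bar>m - t * a\<bar> * (t ^ m * exp (- t * a)) \<le> spread m * (t ^ m * exp (- t * a) +
      ((t * (1 - sqrt (ln m / m))) ^ m * exp (- (t * (1 - sqrt (ln m / m))) * a) +
       (t * (1 + sqrt (ln m / m))) ^ m * exp (- (t * (1 + sqrt (ln m / m))) * a)) / (real m)\<^sup>2)" for a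
      by (rule deviation_weight_le[OF t m])
  qed
  also have "\<dots> = spread m * (mass m t + (mass m (t * (1 - \<delta>)) + mass m (t * (1 + \<delta>))) / (real m)\<^sup>2)"
    using integrable_mass[OF t, of m] integrable_mass[OF t1(1), of m] integrable_mass[OF t1(2), of m]
    unfolding mass_def
    by (simp only: Bochner_Integration.integral_mult_right_zero Bochner_Integration.integral_add
        Bochner_Integration.integral_divide_zero Bochner_Integration.integrable_add integrable_divide)
  also have "\<dots> \<le> spread m * (mass m t + 2 / (real m)\<^sup>2)"
    using mass_le_1[OF t1(1), of m] mass_le_1[OF t1(2), of m] m
    by (intro mult_left_mono add_left_mono divide_right_mono) (auto simp: spread_def)
  finally show ?thesis .
qed

context
  fixes f :: "nat \<Rightarrow> real"
  assumes f_limit: "(\<lambda>n. f n * sqrt (real n * ln (real n))) \<longlonglongrightarrow> 0"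
begin

lemma coeff_limit: "(\<lambda>m. \<bar>f (Suc m)\<bar> * spread m) \<longlonglongrightarrow> 0"
proof (rule tendsto_sandwich[OF _ _ tendsto_const])
  have "(\<lambda>m. 4 * \<bar>f (Suc m) * sqrt (real (Suc m) * ln (real (Suc m)))\<bar>) \<longlonglongrightarrow> 4 * \<bar>0\<bar>"
    using LIMSEQ_Suc[OF f_limit] by (intro tendsto_intros)
  then show "(\<lambda>m. 4 * \<bar>f (Suc m) * sqrt (real (Suc m) * ln (real (Suc m)))\<bar>) \<longlonglongrightarrow> 0" by simp
  show "eventually (\<lambda>m. 0 \<le> \<bar>f (Suc m)\<bar> * spread m) sequentially"
    unfolding eventually_sequentially spread_def by (intro exI[of _ 1]) auto
  show "eventually (\<lambda>m. \<bar>f (Suc m)\<bar> * spread m \<le> 4 * \<bar>f (Suc m) * sqrt (real (Suc m) * ln (real (Suc m)))\<bar>) sequentially"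
    unfolding eventually_sequentially
  proof (intro exI[of _ 1] allI impI)
    fix m :: nat assume m: "1 \<le> m"
    have "sqrt (m * ln m) \<le> sqrt (real (Suc m) * ln (real (Suc m)))"
      using m by (intro real_sqrt_le_mono mult_mono) auto
    then have "\<bar>f (Suc m)\<bar> * (4 * sqrt (m * ln m)) \<le> \<bar>f (Suc m)\<bar> * (4 * sqrt (real (Suc m) * ln (real (Suc m))))"
      by (intro mult_left_mono) auto
    then show "\<bar>f (Suc m)\<bar> * spread m \<le> 4 * \<bar>f (Suc m) * sqrt (real (Suc m) * ln (real (Suc m)))\<bar>"
      using m by (simp add: spread_def abs_mult)
  qed
qed

lemma f_bounded: obtains c where "\<And>m. \<bar>f m\<bar> \<le> c"
proof -
  have "eventually (\<lambda>n. \<bar>f n * sqrt (real n * ln (real n))\<bar> < 1) sequentially"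
    using tendstoD[OF f_limit, of 1] by (simp add: dist_real_def)
  moreover have "eventually (\<lambda>n. sqrt (real n * ln (real n)) \<ge> 1) sequentially"
    unfolding eventually_sequentially
  proof (intro exI[of _ 2] allI impI)
    fix n :: nat assume n: "2 \<le> n"
    have "1 / 2 \<le> ln (2::real)" by (rule half_le_ln_2)
    also have "\<dots> \<le> ln (real n)" using n by simp
    finally have "2 * (1 / 2) \<le> real n * ln (real n)" using n by (intro mult_mono) auto
    then show "1 \<le> sqrt (real n * ln (real n))" by simp
  qed
  ultimately have "eventually (\<lambda>n. \<bar>f n\<bar> \<le> 1) sequentially"
  proof eventually_elim
    fix n assume n: "\<bar>f n * sqrt (real n * ln (real n))\<bar> < 1" "sqrt (real n * ln (real n)) \<ge> 1"
    have "\<bar>f n\<bar> * 1 \<le> \<bar>f n\<bar> * sqrt (real n * ln (real n))" using n by (intro mult_left_mono) auto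
    also have "\<dots> = \<bar>f n * sqrt (real n * ln (real n))\<bar>" using n(2) by (simp add: abs_mult)
    finally show "\<bar>f n\<bar> \<le> 1" using n by simp
  qed
  then have "Bfun f sequentially" by (auto simp: Bfun_def intro!: exI[of _ 1])
  then have "Bseq f" .
  then obtain c where "\<forall>n. norm (f n) \<le> c" by (auto elim: BseqE)
  then show thesis by (intro that[of c]) simp
qed

lemma dominated_terms:
  "\<exists>\<epsilon> M. (\<forall>m. 0 \<le> \<epsilon> m) \<and> \<epsilon> \<longlonglongrightarrow> 0 \<and> (\<forall>m t. t > 0 \<longrightarrow> m \<ge> M \<longrightarrow>
     \<bar>f (Suc m)\<bar> * abs_drift m t \<le> \<epsilon> m * (mass m t + 2 / (real m)\<^sup>2))"
proof -
  have "eventually (\<lambda>m::nat. ln (real m) / m < 1 / 4) sequentially"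
    using lim_ln_over_n by (rule order_tendstoD) simp
  then have "eventually (\<lambda>m::nat. ln (real m) / m \<le> 1 / 4) sequentially"
    by (rule eventually_mono) simp
  then obtain M where M: "\<And>m::nat. m \<ge> M \<Longrightarrow> ln (real m) / m \<le> 1 / 4" by (auto simp: eventually_sequentially)
  show ?thesis
  proof (intro exI[of _ "\<lambda>m. \<bar>\<bar>f (Suc m)\<bar> * spread m\<bar>"] exI[of _ "max 2 M"] conjI allI impI)
    show "(\<lambda>m. \<bar>\<bar>f (Suc m)\<bar> * spread m\<bar>) \<longlonglongrightarrow> 0"
      using tendsto_rabs[OF coeff_limit] by simp
    fix m t assume t: "t > (0::real)" and m: "m \<ge> max 2 M"
    have "\<bar>f (Suc m)\<bar> * abs_drift m t \<le> \<bar>f (Suc m)\<bar> * (spread m * (mass m t + 2 / (real m)\<^sup>2))"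
      using abs_drift_le[OF t, of m] M[of m] m by (intro mult_left_mono) auto
    also have "\<dots> \<le> \<bar>\<bar>f (Suc m)\<bar> * spread m\<bar> * (mass m t + 2 / (real m)\<^sup>2)"
      using mass_nonneg[OF t, of m] unfolding mult.assoc[symmetric] by (intro mult_right_mono) auto
    finally show "\<bar>f (Suc m)\<bar> * abs_drift m t \<le> \<bar>\<bar>f (Suc m)\<bar> * spread m\<bar> * (mass m t + 2 / (real m)\<^sup>2)" .
  qed auto
qed

lemma summable_inverse_squares': "summable (\<lambda>m. 2 / (real m)\<^sup>2)"
  using summable_mult[OF inverse_power_summable[of 2, where 'a=real], of 2] by (simp add: divide_inverse)

lemma abs_drift_nonneg: "t > 0 \<Longrightarrow> 0 \<le> abs_drift m t"
  using drift_le[of t m] by linarith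

lemma summable_abs_drift:
  assumes "t > 0"
  shows "summable (\<lambda>m. \<bar>f (Suc m)\<bar> * abs_drift m t)"
proof -
  obtain \<epsilon> M where \<epsilon>: "\<And>m. 0 \<le> \<epsilon> m" "\<epsilon> \<longlonglongrightarrow> 0"
    "\<And>m t. t > 0 \<Longrightarrow> m \<ge> M \<Longrightarrow> \<bar>f (Suc m)\<bar> * abs_drift m t \<le> \<epsilon> m * (mass m t + 2 / (real m)\<^sup>2)"
    using dominated_terms by metis
  have "summable (\<lambda>m. \<bar>\<bar>f (Suc m)\<bar> * abs_drift m t\<bar>)"
  proof (rule uniform_limit_dominated_series(2)[where S="{t}" and M=M and \<epsilon>=\<epsilon> and p=mass and c="\<lambda>m. 2 / (real m)\<^sup>2"])
    show "\<bar>\<bar>f (Suc m)\<bar> * abs_drift m x\<bar> \<le> \<epsilon> m * (mass m x + 2 / (real m)\<^sup>2)" if "x \<in> {t}" "m \<ge> M" for m x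
      using \<epsilon>(3)[of x m] that assms abs_drift_nonneg[of x m] by simp
  qed (use assms \<epsilon> mass_nonneg summable_mass[unfolded mass_def[symmetric]] total_mass[unfolded mass_def[symmetric]] summable_inverse_squares' in auto)
  then show ?thesis using abs_drift_nonneg[OF assms] by simp
qed

lemma summable_f_mass:
  assumes "t > 0"
  shows "summable (\<lambda>m. \<bar>f (Suc m)\<bar> * mass m t)"
proof -
  obtain c where c: "\<And>m. \<bar>f m\<bar> \<le> c" using f_bounded by blast
  show ?thesis
  proof (rule summable_comparison_test'[of "\<lambda>m. c * mass m t" 0])
    show "summable (\<lambda>m. c * mass m t)"
      using summable_mass[OF assms] unfolding mass_def by (rule summable_mult)
    show "norm (\<bar>f (Suc m)\<bar> * mass m t) \<le> c * mass m t" for m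
      using c[of "Suc m"] mass_nonneg[OF assms, of m] by (simp add: abs_mult mult_right_mono)
  qed
qed

text \<open>The factor \<open>inverse t\<close> is bounded only away from \<open>0\<close>.\<close>

lemma derivative_series_uniform:
  assumes b: "b > 0"
  shows "uniform_limit {b<..} (\<lambda>n t. \<Sum>m<n. f (Suc m) * (inverse t * drift m t))
    (\<lambda>t. \<Sum>m. f (Suc m) * (inverse t * drift m t)) sequentially"
proof -
  obtain \<epsilon> M where \<epsilon>: "\<And>m. 0 \<le> \<epsilon> m" "\<epsilon> \<longlonglongrightarrow> 0"
    "\<And>m t. t > 0 \<Longrightarrow> m \<ge> M \<Longrightarrow> \<bar>f (Suc m)\<bar> * abs_drift m t \<le> \<epsilon> m * (mass m t + 2 / (real m)\<^sup>2)"
    using dominated_terms by metis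
  show ?thesis
  proof (rule uniform_limit_dominated_series(1)[where M=M and \<epsilon>="\<lambda>m. inverse b * \<epsilon> m" and p=mass and c="\<lambda>m. 2 / (real m)\<^sup>2"])
    show "\<bar>f (Suc m) * (inverse t * drift m t)\<bar> \<le> inverse b * \<epsilon> m * (mass m t + 2 / (real m)\<^sup>2)"
      if "t \<in> {b<..}" "m \<ge> M" for m t
    proof -
      have t: "t > 0" using that b by auto
      have "\<bar>f (Suc m) * (inverse t * drift m t)\<bar> = inverse t * (\<bar>f (Suc m)\<bar> * \<bar>drift m t\<bar>)"
        using t by (simp add: abs_mult)
      also have "\<dots> \<le> inverse b * (\<bar>f (Suc m)\<bar> * abs_drift m t)"
        using that b t drift_le[OF t, of m] by (intro mult_mono le_imp_inverse_le) auto
      also have "\<dots> \<le> inverse b * (\<epsilon> m * (mass m t + 2 / (real m)\<^sup>2))"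
        using \<epsilon>(3)[OF t that(2)] b by (intro mult_left_mono) auto
      finally show ?thesis by (simp add: mult.assoc)
    qed
    show "(\<lambda>m. inverse b * \<epsilon> m) \<longlonglongrightarrow> 0" using tendsto_mult_right_zero[OF \<epsilon>(2)] by simp
  qed (use b \<epsilon> mass_nonneg summable_mass[unfolded mass_def[symmetric]] total_mass[unfolded mass_def[symmetric]] summable_inverse_squares' in auto)
qed

lemma mass_series_deriv:
  assumes t: "t > 0"
  shows "((\<lambda>t. \<Sum>m. f (Suc m) * mass m t) has_real_derivative (\<Sum>m. f (Suc m) * (inverse t * drift m t))) (at t)"
proof -
  \<comment> \<open>A neighbourhood of \<open>t\<close> on which \<open>inverse\<close> is bounded\<close>
  let ?S = "{t / 2<..}"
  have summ: "summable (\<lambda>m. f (Suc m) * mass m x)" if "x > 0" for x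
    using summable_f_mass[OF that] mass_nonneg[OF that]
    by (intro summable_rabs_cancel[of "\<lambda>m. f (Suc m) * mass m x"]) (simp add: abs_mult)
  have "\<exists>g. \<forall>x\<in>?S. (\<lambda>m. f (Suc m) * mass m x) sums g x \<and>
      (g has_field_derivative (\<Sum>m. f (Suc m) * (inverse x * drift m x))) (at x within ?S)"
  proof (rule has_field_derivative_series)
    show "((\<lambda>x. f (Suc m) * mass m x) has_field_derivative f (Suc m) * (inverse x * drift m x)) (at x within ?S)"
      if "x \<in> ?S" for m x
      using that t by (intro DERIV_cmult has_field_derivative_at_within[OF mass_deriv]) auto
    show "uniform_limit ?S (\<lambda>n x. \<Sum>i<n. f (Suc i) * (inverse x * drift i x))
      (\<lambda>x. \<Sum>m. f (Suc m) * (inverse x * drift m x)) sequentially"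
      using t by (intro derivative_series_uniform) auto
    show "t \<in> ?S" using t by auto
    show "summable (\<lambda>m. f (Suc m) * mass m t)" by (rule summ[OF t])
  qed auto
  then obtain g where g: "\<And>x. x \<in> ?S \<Longrightarrow> (\<lambda>m. f (Suc m) * mass m x) sums g x"
    "\<And>x. x \<in> ?S \<Longrightarrow> (g has_field_derivative (\<Sum>m. f (Suc m) * (inverse x * drift m x))) (at x within ?S)"
    by blast
  have "t \<in> ?S" using t by auto
  then have "(g has_real_derivative (\<Sum>m. f (Suc m) * (inverse t * drift m t))) (at t)"
  proof -
    have "at t within ?S = at t" using \<open>t \<in> ?S\<close> by (intro at_within_open) auto
    then show ?thesis using g(2)[OF \<open>t \<in> ?S\<close>] by (simp only:)
  qed
  moreover have ev: "eventually (\<lambda>x. (\<Sum>m. f (Suc m) * mass m x) = g x) (nhds t)"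
    using eventually_nhds_in_open[of ?S t] \<open>t \<in> ?S\<close> g(1) by (auto elim!: eventually_mono simp: sums_iff)
  ultimately show ?thesis
    by (subst DERIV_cong_ev[OF refl ev refl])
qed

lemma derivative_series_continuous:
  "continuous_on {0<..} (\<lambda>t. \<Sum>m. f (Suc m) * (inverse t * drift m t))"
proof -
  have cont: "continuous_on {b<..} (\<lambda>t. \<Sum>m. f (Suc m) * (inverse t * drift m t))" if b: "b > 0" for b
  proof (rule uniform_limit_theorem[OF _ derivative_series_uniform[OF b]])
    have "continuous_on {b<..} (drift m)" for m
      by (rule continuous_on_subset[OF drift_continuous]) (use b in auto)
    then show "\<forall>\<^sub>F n in sequentially. continuous_on {b<..} (\<lambda>t. \<Sum>m<n. f (Suc m) * (inverse t * drift m t))"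
      using b by (intro always_eventually allI continuous_intros) auto
  qed simp
  have "isCont (\<lambda>t. \<Sum>m. f (Suc m) * (inverse t * drift m t)) t" if "t > 0" for t
  proof -
    have "continuous_on {t / 2<..} (\<lambda>t. \<Sum>m. f (Suc m) * (inverse t * drift m t))"
      using that by (intro cont) simp
    then show ?thesis using that by (subst (asm) continuous_on_eq_continuous_at) auto
  qed
  then show ?thesis by (intro continuous_at_imp_continuous_on) auto
qed

end

end

section \<open>Expectations as series over the cluster size\<close>

context rcm
begin

definition size_event :: "nat \<Rightarrow> 'w set" where
  "size_event m = {\<omega>\<in>space M. num_vertices (component (E \<omega>) v) = enat (Suc m)}"

abbreviation hit :: "'w \<Rightarrow> real" where
  "hit \<omega> \<equiv> phi_lambda \<Lambda> \<phi> (component (E \<omega>) v)"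

lemma size_event_sets [measurable]: "size_event m \<in> sets M"
  using component_event_sets[of UNIV m] by (simp add: size_event_def)

lemma size_event_disjoint: "\<omega> \<in> size_event m \<Longrightarrow> \<omega> \<in> size_event n \<Longrightarrow> m = n"
  by (auto simp: size_event_def)

text \<open>Measurability of \<open>\<phi>\<^sub>\<lambda>\<close> is known only on finite clusters, hence the cut-off in \<open>h\<close>.\<close>

lemma size_event_law:
  defines "h m \<equiv> \<lambda>\<omega>. if \<omega> \<in> size_event m then hit \<omega> else 0"
  shows "h m \<in> borel_measurable M"
    and "distr (density M (indicator (size_event m))) borel (h m) =
      density (cluster_measure \<Lambda> \<phi> v m) (\<lambda>a. ennreal (t ^ m * exp (- t * a)))"
proof -
  have ev: "{\<omega>\<in>size_event m. hit \<omega> \<in> D} =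
    {\<omega>\<in>space M. num_vertices (component (E \<omega>) v) = enat (Suc m) \<and> hit \<omega> \<in> D}" for D
    by (auto simp: size_event_def)
  show [measurable]: "h m \<in> borel_measurable M"
  proof (rule measurableI)
    fix D :: "real set" assume D: "D \<in> sets borel"
    have "h m -` D \<inter> space M = {\<omega>\<in>size_event m. hit \<omega> \<in> D} \<union> (if 0 \<in> D then space M - size_event m else {})"
      by (auto simp: h_def size_event_def split: if_splits)
    also have "\<dots> \<in> sets M" using component_event_sets[OF D, of m] unfolding ev by auto
    finally show "h m -` D \<inter> space M \<in> sets M" .
  qed simp
  have sets_mu [measurable_cong]: "sets (cluster_measure \<Lambda> \<phi> v m) = sets borel"
    by (simp add: cluster_measure_def)
  show "distr (density M (indicator (size_event m))) borel (h m) =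
      density (cluster_measure \<Lambda> \<phi> v m) (\<lambda>a. ennreal (t ^ m * exp (- t * a)))"
  proof (rule measure_eqI)
    show "sets (distr (density M (indicator (size_event m))) borel (h m)) =
      sets (density (cluster_measure \<Lambda> \<phi> v m) (\<lambda>a. ennreal (t ^ m * exp (- t * a))))"
      by (simp add: sets_mu)
    fix D assume "D \<in> sets (distr (density M (indicator (size_event m))) borel (h m))"
    then have D [measurable]: "D \<in> sets borel" by simp
    have "emeasure (distr (density M (indicator (size_event m))) borel (h m)) D =
      emeasure M ((h m -` D \<inter> space M) \<inter> size_event m)"
      by (simp add: emeasure_distr emeasure_density_indicator)
    also have "(h m -` D \<inter> space M) \<inter> size_event m = {\<omega>\<in>size_event m. hit \<omega> \<in> D}"
      by (auto simp: h_def size_event_def)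
    also have "emeasure M \<dots> = (\<integral>\<^sup>+a. ennreal (t ^ m * exp (- t * a)) * indicator D a \<partial>cluster_measure \<Lambda> \<phi> v m)"
      unfolding ev by (rule emeasure_component_event[OF D])
    also have "\<dots> = emeasure (density (cluster_measure \<Lambda> \<phi> v m) (\<lambda>a. ennreal (t ^ m * exp (- t * a)))) D"
      by (simp add: emeasure_density)
    finally show "emeasure (distr (density M (indicator (size_event m))) borel (h m)) D =
      emeasure (density (cluster_measure \<Lambda> \<phi> v m) (\<lambda>a. ennreal (t ^ m * exp (- t * a)))) D" .
  qed
qed

lemma size_event_integral:
  fixes g :: "real \<Rightarrow> real"
  assumes g [measurable]: "g \<in> borel_measurable borel"
  shows "integrable M (\<lambda>\<omega>. indicator (size_event m) \<omega> * g (hit \<omega>)) \<longleftrightarrow>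
      integrable (cluster_measure \<Lambda> \<phi> v m) (\<lambda>a. t ^ m * exp (- t * a) * g a)" (is ?int)
    and "(\<integral>\<omega>. indicator (size_event m) \<omega> * g (hit \<omega>) \<partial>M) =
      (\<integral>a. t ^ m * exp (- t * a) * g a \<partial>cluster_measure \<Lambda> \<phi> v m)" (is ?eq)
proof -
  define h where "h = (\<lambda>\<omega>. if \<omega> \<in> size_event m then hit \<omega> else 0)"
  have [measurable]: "h \<in> borel_measurable M" unfolding h_def by (rule size_event_law(1))
  have sets_mu [measurable_cong]: "sets (cluster_measure \<Lambda> \<phi> v m) = sets borel"
    by (simp add: cluster_measure_def)
  have law: "distr (density M (\<lambda>\<omega>. ennreal (indicator (size_event m) \<omega>))) borel h =
      density (cluster_measure \<Lambda> \<phi> v m) (\<lambda>a. ennreal (t ^ m * exp (- t * a)))"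
    unfolding h_def ennreal_indicator by (rule size_event_law(2))
  have eq: "(\<lambda>\<omega>. indicator (size_event m) \<omega> * g (hit \<omega>)) = (\<lambda>\<omega>. indicator (size_event m) \<omega> *\<^sub>R g (h \<omega>))"
    by (auto simp: h_def fun_eq_iff split: split_indicator)
  have "integrable (distr (density M (\<lambda>\<omega>. ennreal (indicator (size_event m) \<omega>))) borel h) g \<longleftrightarrow>
    integrable M (\<lambda>\<omega>. indicator (size_event m) \<omega> * g (hit \<omega>))"
    unfolding eq by (subst integrable_distr_eq) (simp_all add: integrable_density)
  moreover have "integrable (density (cluster_measure \<Lambda> \<phi> v m) (\<lambda>a. ennreal (t ^ m * exp (- t * a)))) g \<longleftrightarrow>
    integrable (cluster_measure \<Lambda> \<phi> v m) (\<lambda>a. t ^ m * exp (- t * a) * g a)"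
    using t_pos by (subst integrable_density) simp_all
  ultimately show ?int unfolding law by simp
  have "(\<integral>x. g x \<partial>distr (density M (\<lambda>\<omega>. ennreal (indicator (size_event m) \<omega>))) borel h) =
    (\<integral>\<omega>. indicator (size_event m) \<omega> * g (hit \<omega>) \<partial>M)"
    unfolding eq by (subst integral_distr) (simp_all add: integral_density)
  moreover have "(\<integral>x. g x \<partial>density (cluster_measure \<Lambda> \<phi> v m) (\<lambda>a. ennreal (t ^ m * exp (- t * a)))) =
    (\<integral>a. t ^ m * exp (- t * a) * g a \<partial>cluster_measure \<Lambda> \<phi> v m)"
    using t_pos by (subst integral_density) simp_all
  ultimately show ?eq unfolding law by simp
qed

text \<open>The events that the cluster has \<open>m + 1\<close> vertices are disjoint, so that at each \<open>\<omega>\<close> at most one term of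
the series differs from zero.\<close>

lemma integral_over_sizes:
  fixes G :: "nat \<Rightarrow> real \<Rightarrow> real" and Y :: "'w \<Rightarrow> real"
  assumes G [measurable]: "\<And>m. G m \<in> borel_measurable borel"
    and Y: "\<And>m \<omega>. \<omega> \<in> size_event m \<Longrightarrow> Y \<omega> = G m (hit \<omega>)"
    and Y0: "\<And>\<omega>. \<omega> \<in> space M \<Longrightarrow> (\<And>m. \<omega> \<notin> size_event m) \<Longrightarrow> Y \<omega> = 0"
    and int: "\<And>m. integrable (cluster_measure \<Lambda> \<phi> v m) (\<lambda>a. t ^ m * exp (- t * a) * G m a)"
    and summ: "summable (\<lambda>m. \<integral>a. t ^ m * exp (- t * a) * \<bar>G m a\<bar> \<partial>cluster_measure \<Lambda> \<phi> v m)"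
  shows "integrable M Y"
    and "(\<lambda>m. \<integral>a. t ^ m * exp (- t * a) * G m a \<partial>cluster_measure \<Lambda> \<phi> v m) sums (\<integral>\<omega>. Y \<omega> \<partial>M)"
proof -
  define y where "y m \<omega> = indicator (size_event m) \<omega> * G m (hit \<omega>)" for m \<omega>
  have y_zero: "y m \<omega> = 0" if "\<omega> \<in> size_event n" "m \<noteq> n" for m n \<omega>
    using size_event_disjoint[of \<omega> m n] that by (auto simp: y_def indicator_def)
  have fin: "\<exists>n. \<forall>m. m \<noteq> n \<longrightarrow> y m \<omega> = 0" for \<omega>
  proof (cases "\<exists>n. \<omega> \<in> size_event n")
    case True then show ?thesis using y_zero by blast
  next
    case False then show ?thesis by (auto simp: y_def)
  qed
  have y_int: "integrable M (y m)" for m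
    unfolding y_def using int by (subst size_event_integral(1)) auto
  have ae: "AE \<omega> in M. summable (\<lambda>m. norm (y m \<omega>))"
  proof (rule AE_I2)
    fix \<omega>
    obtain n where "\<And>m. m \<noteq> n \<Longrightarrow> y m \<omega> = 0" using fin by blast
    then show "summable (\<lambda>m. norm (y m \<omega>))" by (intro summable_finite[of "{n}"]) auto
  qed
  have norm_int: "(\<integral>\<omega>. norm (y m \<omega>) \<partial>M) = (\<integral>a. t ^ m * exp (- t * a) * \<bar>G m a\<bar> \<partial>cluster_measure \<Lambda> \<phi> v m)" for m
  proof -
    have "(\<lambda>\<omega>. norm (y m \<omega>)) = (\<lambda>\<omega>. indicator (size_event m) \<omega> * \<bar>G m (hit \<omega>)\<bar>)"
      by (simp add: y_def abs_mult fun_eq_iff)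
    then show ?thesis by (simp only:, intro size_event_integral(2)) measurable
  qed
  have sm: "summable (\<lambda>m. \<integral>\<omega>. norm (y m \<omega>) \<partial>M)" unfolding norm_int by (rule summ)
  have Y_eq: "Y \<omega> = (\<Sum>m. y m \<omega>)" if \<omega>: "\<omega> \<in> space M" for \<omega>
  proof (cases "\<exists>n. \<omega> \<in> size_event n")
    case True
    then obtain n where n: "\<omega> \<in> size_event n" by blast
    have "(\<Sum>m. y m \<omega>) = (\<Sum>m\<in>{n}. y m \<omega>)"
      by (rule suminf_finite) (use y_zero[OF n] in auto)
    then show ?thesis using Y[OF n] n by (simp add: y_def)
  next
    case False
    then show ?thesis using Y0[OF \<omega>] by (simp add: y_def)
  qed
  have "integrable M (\<lambda>\<omega>. \<Sum>m. y m \<omega>)" by (rule integrable_suminf[OF y_int ae sm])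
  then show "integrable M Y"
    by (subst Bochner_Integration.integrable_cong[OF refl Y_eq]) auto
  have "(\<lambda>m. \<integral>\<omega>. y m \<omega> \<partial>M) sums (\<integral>\<omega>. (\<Sum>m. y m \<omega>) \<partial>M)" by (rule sums_integral[OF y_int ae sm])
  also have "(\<lambda>m. \<integral>\<omega>. y m \<omega> \<partial>M) = (\<lambda>m. \<integral>a. t ^ m * exp (- t * a) * G m a \<partial>cluster_measure \<Lambda> \<phi> v m)"
    unfolding y_def by (intro ext size_event_integral(2) G)
  also have "(\<integral>\<omega>. (\<Sum>m. y m \<omega>) \<partial>M) = (\<integral>\<omega>. Y \<omega> \<partial>M)"
    by (rule Bochner_Integration.integral_cong[OF refl]) (simp add: Y_eq)
  finally show "(\<lambda>m. \<integral>a. t ^ m * exp (- t * a) * G m a \<partial>cluster_measure \<Lambda> \<phi> v m) sums (\<integral>\<omega>. Y \<omega> \<partial>M)" .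
qed

lemma cluster_measure_mass:
  "integrable (cluster_measure \<Lambda> \<phi> v m) (\<lambda>a. t ^ m * exp (- t * a))"
  "(\<integral>a. t ^ m * exp (- t * a) \<partial>cluster_measure \<Lambda> \<phi> v m) = prob (size_event m)"
  using size_event_integral[of "\<lambda>_. 1" m] by (simp_all add: emeasure_eq_measure)

lemma sums_prob_size_event: "(\<lambda>m. prob (size_event m)) sums prob (\<Union>m. size_event m)"
  using size_event_disjoint by (intro finite_measure_UNION) (auto simp: disjoint_family_on_def)

lemma num_vertices_component_cases:
  assumes "\<omega> \<in> space M"
  obtains "num_vertices (component (E \<omega>) v) = \<infinity>" "\<And>m. \<omega> \<notin> size_event m"
  | m where "num_vertices (component (E \<omega>) v) = enat (Suc m)" "\<omega> \<in> size_event m"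
    "card (component (E \<omega>) v) = Suc m"
proof (cases "finite (component (E \<omega>) v)")
  case True
  have "component (E \<omega>) v \<noteq> {}" by (metis empty_iff root_in_component)
  then have "card (component (E \<omega>) v) \<noteq> 0" using True by simp
  then obtain m where "card (component (E \<omega>) v) = Suc m" using not0_implies_Suc by blast
  then show ?thesis using that(2)[of m] True assms by (simp add: size_event_def num_vertices_def)
next
  case False
  then show ?thesis using that(1) by (simp add: size_event_def num_vertices_def)
qed

end

theorem theorem10p1:
  fixes \<Lambda> :: "'a :: polish_space measure"
    and \<phi> :: "'a \<Rightarrow> 'a \<Rightarrow> real"
    and P :: "real \<Rightarrow> 'w measure"
    and \<eta> :: "'w \<Rightarrow> 'a set"
    and v :: 'a
    and E :: "'w \<Rightarrow> 'a set set"
    and f :: "nat \<Rightarrow> real"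
  assumes sets_Lambda: "sets \<Lambda> = sets borel"
    and locally_finite: "\<And>B. B \<in> sets borel \<Longrightarrow> bounded B \<Longrightarrow> emeasure \<Lambda> B < \<infinity>"
    and diffuse: "\<And>x. emeasure \<Lambda> {x} = 0"
    and phi_measurable: "(\<lambda>(x, y). \<phi> x y) \<in> borel_measurable (borel \<Otimes>\<^sub>M borel)"
    and phi_range: "\<And>x y. \<phi> x y \<in> {0..1}"
    and phi_sym: "\<And>x y. \<phi> x y = \<phi> y x"
    and D_phi_finite: "AE x in \<Lambda>. (\<integral>\<^sup>+ y. ennreal (\<phi> x y) \<partial>\<Lambda>) < \<infinity>"
    and rcm: "\<And>t. t > 0 \<Longrightarrow>
      random_connection_model (P t) (scale_measure (ennreal t) \<Lambda>) \<phi> v \<eta> E"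
    and f_limit: "(\<lambda>n. f n * sqrt (real n * ln (real n))) \<longlonglongrightarrow> 0"
  defines "C \<equiv> \<lambda>\<omega>. component (E \<omega>) v"
  defines "F \<equiv> \<lambda>t. \<integral>\<omega>. extend_by_zero f (num_vertices (C \<omega>)) \<partial>P t"
  defines "Z \<equiv> \<lambda>t \<omega>. M_stat \<Lambda> \<phi> t (C \<omega>) * extend_by_zero f (num_vertices (C \<omega>))
                      * indicator {\<omega>. num_vertices (C \<omega>) < \<infinity>} \<omega>"
  shows "(\<forall>t>0. integrable (P t) (\<lambda>\<omega>. extend_by_zero f (num_vertices (C \<omega>)))
               \<and> integrable (P t) (Z t)
               \<and> (F has_real_derivative inverse t * (\<integral>\<omega>. Z t \<omega> \<partial>P t)) (at t))
         \<and> continuous_on {0<..} (\<lambda>t. inverse t * (\<integral>\<omega>. Z t \<omega> \<partial>P t))"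
proof -
  have model: "\<exists>K X. rcm (P t) \<Lambda> t \<eta> v K X \<phi> E" if t: "t > 0" for t
  proof -
    have R: "random_connection_model (P t) (scale_measure (ennreal t) \<Lambda>) \<phi> v \<eta> E" by (rule rcm[OF t])
    then obtain K X where KX: "vertex_enumeration (P t) (\<lambda>\<omega>. insert v (\<eta> \<omega>)) K X"
      "conditionally_independent_edges (P t) \<phi> E K X"
      by (auto simp: random_connection_model_def)
    have ps: "prob_space (P t)" and pp: "poisson_process (P t) (scale_measure (ennreal t) \<Lambda>) \<eta>"
      and Es: "\<And>\<omega>. \<omega> \<in> space (P t) \<Longrightarrow> E \<omega> \<subseteq> {{x, y} | x y. x \<in> insert v (\<eta> \<omega>) \<and> y \<in> insert v (\<eta> \<omega>) \<and> x \<noteq> y}"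
      using R by (simp_all add: random_connection_model_def)
    interpret prob_space "P t" by (rule ps)
    have "rcm (P t) \<Lambda> t \<eta> v K X \<phi> E"
      by unfold_locales (fact t sets_Lambda pp KX phi_measurable phi_range phi_sym Es locally_finite diffuse)+
    then show ?thesis by blast
  qed
  let ?\<mu> = "cluster_measure \<Lambda> \<phi> v"
  \<comment> \<open>The masses are the probabilities of disjoint events, separately for every \<open>t\<close>.\<close>
  interpret G: gamma_mixtures ?\<mu>
  proof
    show "sets (?\<mu> m) = sets borel" for m by (simp add: cluster_measure_def)
    fix t :: real assume t: "t > 0"
    obtain K X where "rcm (P t) \<Lambda> t \<eta> v K X \<phi> E" using model[OF t] by blast
    then interpret R: rcm "P t" \<Lambda> t \<eta> v K X \<phi> E .
    show "integrable (?\<mu> m) (\<lambda>a. exp (- t * a))" for m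
      using R.cluster_measure_mass(1)[of m] t by simp
    show "summable (\<lambda>m. \<integral>a. t ^ m * exp (- t * a) \<partial>?\<mu> m)"
      unfolding R.cluster_measure_mass(2) using R.sums_prob_size_event by (rule sums_summable)
    show "(\<Sum>m. \<integral>a. t ^ m * exp (- t * a) \<partial>?\<mu> m) \<le> 1"
      unfolding R.cluster_measure_mass(2) sums_unique[OF R.sums_prob_size_event, symmetric] by (rule R.prob_le_1)
  qed
  have main: "integrable (P t) (\<lambda>\<omega>. extend_by_zero f (num_vertices (C \<omega>)))"
    "F t = (\<Sum>m. f (Suc m) * G.mass m t)"
    "integrable (P t) (Z t)"
    "inverse t * (\<integral>\<omega>. Z t \<omega> \<partial>P t) = (\<Sum>m. f (Suc m) * (inverse t * G.drift m t))"
    if t: "t > 0" for t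
  proof -
    obtain K X where "rcm (P t) \<Lambda> t \<eta> v K X \<phi> E" using model[OF t] by blast
    then interpret R: rcm "P t" \<Lambda> t \<eta> v K X \<phi> E .
    let ?N = "\<lambda>\<omega>. extend_by_zero f (num_vertices (C \<omega>))"
    have N1: "?N \<omega> = f (Suc m)" if "\<omega> \<in> R.size_event m" for m \<omega>
      using that by (simp add: R.size_event_def C_def extend_by_zero_def)
    have N0: "?N \<omega> = 0" if "\<omega> \<in> space (P t)" "\<And>m. \<omega> \<notin> R.size_event m" for \<omega>
      using that by (cases rule: R.num_vertices_component_cases[OF that(1)]) (auto simp: C_def extend_by_zero_def)
    have const: "(\<integral>a. t ^ m * exp (- t * a) * c \<partial>?\<mu> m) = c * G.mass m t" for m c
      by (simp add: G.mass_def)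
    have N: "integrable (P t) ?N" "(\<lambda>m. \<integral>a. t ^ m * exp (- t * a) * f (Suc m) \<partial>?\<mu> m) sums F t"
      unfolding F_def
    proof (atomize (full), intro conjI)
      have i: "integrable (?\<mu> m) (\<lambda>a. t ^ m * exp (- t * a) * f (Suc m))" for m
        using G.integrable_mass[OF t, of m] by simp
      have s: "summable (\<lambda>m. \<integral>a. t ^ m * exp (- t * a) * \<bar>f (Suc m)\<bar> \<partial>?\<mu> m)"
        unfolding const by (rule G.summable_f_mass[OF f_limit t])
      show "integrable (P t) ?N"
        by (rule R.integral_over_sizes(1)[where G="\<lambda>m _. f (Suc m)", OF _ N1 N0 i s]) simp
      show "(\<lambda>m. \<integral>a. t ^ m * exp (- t * a) * f (Suc m) \<partial>?\<mu> m) sums (\<integral>\<omega>. ?N \<omega> \<partial>P t)"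
        by (rule R.integral_over_sizes(2)[where G="\<lambda>m _. f (Suc m)", OF _ N1 N0 i s]) simp
    qed
    show "integrable (P t) ?N" by (rule N(1))
    show "F t = (\<Sum>m. f (Suc m) * G.mass m t)"
      using N(2) unfolding const by (rule sums_unique)
    let ?G = "\<lambda>m a. f (Suc m) * (m - t * a)"
    have Z1: "Z t \<omega> = ?G m (phi_lambda \<Lambda> \<phi> (component (E \<omega>) v))" if "\<omega> \<in> R.size_event m" for m \<omega>
    proof -
      have "num_vertices (C \<omega>) = enat (Suc m)" using that by (simp add: R.size_event_def C_def)
      moreover from this have "card (C \<omega>) = Suc m" by (simp add: num_vertices_def split: if_splits)
      ultimately show ?thesis by (simp add: Z_def M_stat_def extend_by_zero_def C_def)
    qed
    have Z0: "Z t \<omega> = 0" if "\<omega> \<in> space (P t)" "\<And>m. \<omega> \<notin> R.size_event m" for \<omega>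
      unfolding Z_def using N0[OF that] by simp
    have eqG: "(\<lambda>a. t ^ m * exp (- t * a) * ?G m a) = (\<lambda>a. f (Suc m) * ((m - t * a) * (t ^ m * exp (- t * a))))" for m
      by (simp add: fun_eq_iff mult_ac)
    have eqA: "(\<lambda>a. t ^ m * exp (- t * a) * \<bar>?G m a\<bar>) = (\<lambda>a. \<bar>f (Suc m)\<bar> * (\<bar>m - t * a\<bar> * (t ^ m * exp (- t * a))))" for m
      by (simp add: fun_eq_iff abs_mult mult_ac)
    have intG: "(\<integral>a. t ^ m * exp (- t * a) * ?G m a \<partial>?\<mu> m) = f (Suc m) * G.drift m t" for m
      unfolding eqG G.drift_def by simp
    have Z: "integrable (P t) (Z t)" "(\<lambda>m. \<integral>a. t ^ m * exp (- t * a) * ?G m a \<partial>?\<mu> m) sums (\<integral>\<omega>. Z t \<omega> \<partial>P t)"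
    proof (atomize (full), intro conjI)
      have i: "integrable (?\<mu> m) (\<lambda>a. t ^ m * exp (- t * a) * ?G m a)" for m
        unfolding eqG using G.integrable_drift[OF t, of m] by simp
      have s: "summable (\<lambda>m. \<integral>a. t ^ m * exp (- t * a) * \<bar>?G m a\<bar> \<partial>?\<mu> m)"
        using G.summable_abs_drift[OF f_limit t] unfolding eqA G.abs_drift_def by simp
      show "integrable (P t) (Z t)"
        by (rule R.integral_over_sizes(1)[where G="?G", OF _ Z1 Z0 i s]) simp
      show "(\<lambda>m. \<integral>a. t ^ m * exp (- t * a) * ?G m a \<partial>?\<mu> m) sums (\<integral>\<omega>. Z t \<omega> \<partial>P t)"
        by (rule R.integral_over_sizes(2)[where G="?G", OF _ Z1 Z0 i s]) simp
    qed
    show "integrable (P t) (Z t)" by (rule Z(1))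
    have "(\<lambda>m. inverse t * (f (Suc m) * G.drift m t)) sums (inverse t * (\<integral>\<omega>. Z t \<omega> \<partial>P t))"
      using Z(2) unfolding intG by (rule sums_mult)
    then have "(\<Sum>m. inverse t * (f (Suc m) * G.drift m t)) = inverse t * (\<integral>\<omega>. Z t \<omega> \<partial>P t)"
      by (rule sums_unique[symmetric])
    then show "inverse t * (\<integral>\<omega>. Z t \<omega> \<partial>P t) = (\<Sum>m. f (Suc m) * (inverse t * G.drift m t))"
      by (simp add: mult.left_commute)
  qed
  have deriv: "(F has_real_derivative inverse t * (\<integral>\<omega>. Z t \<omega> \<partial>P t)) (at t)" if t: "t > 0" for t
  proof -
    have "((\<lambda>t. \<Sum>m. f (Suc m) * G.mass m t) has_real_derivative inverse t * (\<integral>\<omega>. Z t \<omega> \<partial>P t)) (at t)"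
      unfolding main(4)[OF t] by (rule G.mass_series_deriv[OF f_limit t])
    moreover have ev: "eventually (\<lambda>s. F s = (\<Sum>m. f (Suc m) * G.mass m s)) (nhds t)"
      using eventually_nhds_in_open[of "{0<..}" t] t main(2) by (auto elim!: eventually_mono)
    ultimately show ?thesis by (subst DERIV_cong_ev[OF refl ev refl])
  qed
  have "continuous_on {0<..} (\<lambda>t. inverse t * (\<integral>\<omega>. Z t \<omega> \<partial>P t))"
    using G.derivative_series_continuous[OF f_limit] main(4) by (subst continuous_on_cong[OF refl]) auto
  then show ?thesis using main(1,3) deriv by blast
qed

end
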